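(* Let $p,q,r$ be real coefficients satisfying the standing hypotheses (a), (b), (c) listed in the context, and assume in addition that $1/p\in L^\infty(\mathbb R)$ and $q_-\in L^s(\mathbb R)$ for some $s\in[1,\infty]$. Let $$\beta=\begin{cases}\left(4\lVert 1/p\rVert_\infty\lVert q_-\rVert_s\right)^{\frac{s}{2s-1}} & \text{if } s\in[1,\infty),\\ \left(4\lVert 1/p\rVert_\infty\lVert q_-\rVert_\infty\right)^{1/2} & \text{if } s=\infty,\end{cases}\qquad \alpha=\begin{cases}\lVert q_-\rVert_s\,\beta^{\frac1s} & \text{if } s\in[1,\infty),\\ \lVert q_-\rVert_\infty & \text{if } s=\infty,\end{cases}$$ and let $g\in L^\infty(\mathbb R)$ be a nonnegative function such that $\mu(\Omega_g)\beta<1$, where $\Omega_g=\{x\in\mathbb R : r(x)g(x)<1\}$. Then $$\min\sigma(T)\geq\frac{-\alpha\lVert g\rVert_\infty}{1-\mu(\Omega_g)\beta}.$$ In the special case $1/r\in L^\infty(\mathbb R)$, the choice $g=1/r$ gives $\mu(\Omega_g)=0$ and $$\min\sigma(T)\geq-\bigl(4\lVert 1/p\rVert_\infty\bigr)^{\frac1{2s-1}}\lVert q_-\rVert_s^{\frac{2s}{2s-1}}\lVert 1/r\rVert_\infty\quad\text{if } s\in[1,\infty),$$ while, if $s=\infty$, $$\min\sigma(T)\geq-\lVert q_-\rVert_\infty\lVert 1/r\rVert_\infty.$$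
   Context: Let $p,q,r:\mathbb R\to\mathbb R$ be measurable with $r,1/p,q\in L^1_{\mathrm{loc}}(\mathbb R)$. Let $L^1_{\mathrm u}(\mathbb R)$ be the space of all $h\in L^1_{\mathrm{loc}}(\mathbb R)$ with $\lVert h\rVert_{\mathrm u}:=\sup_{n\in\mathbb Z}\int_n^{n+1}|h(t)|\,\mathrm dt<\infty$. Standing hypotheses: (a) $p(x)>0$ for a.a. $x\in\mathbb R$ and $1/p\in L^\eta(\mathbb R)$ for some $\eta\in[1,\infty]$; (b) $q\in L^1_{\mathrm u}(\mathbb R)$; (c) $r(x)>0$ for a.a. $x\in\mathbb R$ and there exist $a,b\in\mathbb R$ with $a<b$ such that $\operatorname{ess\,inf}_{t\in\mathbb R\setminus[a,b]}r(t)>0$. $L^2_r(\mathbb R)=L^2(\mathbb R;r\,\mathrm dx)$ is the weighted $L^2$-space (complex-valued functions). The operator $T$ in $L^2_r(\mathbb R)$ is the maximal operator $$Tf=\tau f=\frac1r\left(-(pf')'+qf\right),\quad D(T)=\bigl\{f\in L^2_r(\mathbb R) : f,\,pf'\in AC_{\mathrm{loc}}(\mathbb R),\ \tau f\in L^2_r(\mathbb R)\bigr\},$$ where $AC_{\mathrm{loc}}(\mathbb R)$ denotes the locally absolutely continuous functions. It is known that under the standing hypotheses $T$ is self-adjoint and semibounded from below; $\sigma(T)$ is its spectrum. The negative part of $q$ is $q_-=(|q|-q)/2$. $\mu$ is Lebesgue measure on $\mathbb R$, and $\lVert\cdot\rVert_s$ is the (unweighted) norm of $L^s(\mathbb R)$,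 $s\in[1,\infty]$. *)

theory Defs
  imports "HOL-Probability.Essential_Supremum"
begin

section \<open>Function spaces on the real line\<close>

definition L1_loc :: "(real \<Rightarrow> real) set" where
  "L1_loc = {h. \<forall>a b. set_integrable lebesgue {a..b} h}"

definition L1_u :: "(real \<Rightarrow> real) set" where
  "L1_u = {h \<in> L1_loc.
     bdd_above (range (\<lambda>n::int. LINT t:{real_of_int n..real_of_int n + 1}|lebesgue. \<bar>h t\<bar>))}"

text \<open>Exponents are of type \<^typ>\<open>ennreal\<close>; only exponents in \<open>[1,\<infinity>]\<close> are used.\<close>

definition Lp_space :: "ennreal \<Rightarrow> (real \<Rightarrow> real) set" where
  "Lp_space s = {h \<in> borel_measurable lebesgue.
     if s = \<infinity> then esssup lebesgue (\<lambda>x. ereal \<bar>h x\<bar>) < \<infinity>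
     else integrable lebesgue (\<lambda>x. \<bar>h x\<bar> powr enn2real s)}"

text \<open>The value is meaningful only for members of \<^term>\<open>Lp_space s\<close>.\<close>

definition Lp_norm :: "ennreal \<Rightarrow> (real \<Rightarrow> real) \<Rightarrow> real" where
  "Lp_norm s h =
     (if s = \<infinity> then real_of_ereal (esssup lebesgue (\<lambda>x. ereal \<bar>h x\<bar>))
      else (LINT x|lebesgue. \<bar>h x\<bar> powr enn2real s) powr (1 / enn2real s))"

text \<open>Mirrors \<^const>\<open>esssup\<close>, including its convention for non-measurable functions.\<close>

definition essinf :: "'a measure \<Rightarrow> ('a \<Rightarrow> ereal) \<Rightarrow> ereal" where
  "essinf M h = (if h \<in> borel_measurable M then Liminf (ae_filter M) h else bot)"

definition abs_cont_on :: "real \<Rightarrow> real \<Rightarrow> (real \<Rightarrow> complex) \<Rightarrow> bool" where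
  "abs_cont_on a b f \<longleftrightarrow>
     (\<forall>\<epsilon>>0. \<exists>\<delta>>0. \<forall>(n::nat) (u::nat \<Rightarrow> real) (v::nat \<Rightarrow> real).
        (\<forall>i<n. a \<le> u i \<and> u i \<le> v i \<and> v i \<le> b) \<longrightarrow>
        (\<forall>i<n. \<forall>j<n. i \<noteq> j \<longrightarrow> {u i<..<v i} \<inter> {u j<..<v j} = {}) \<longrightarrow>
        (\<Sum>i<n. v i - u i) < \<delta> \<longrightarrow>
        (\<Sum>i<n. norm (f (v i) - f (u i))) < \<epsilon>)"

definition AC_loc :: "(real \<Rightarrow> complex) set" where
  "AC_loc = {f. \<forall>a b. abs_cont_on a b f}"

section \<open>Operators in \<open>L\<^sup>2\<close> and their spectrum\<close>

definition L2_space :: "'a measure \<Rightarrow> ('a \<Rightarrow> complex) set" where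
  "L2_space M = {f \<in> borel_measurable M. integrable M (\<lambda>x. (norm (f x))\<^sup>2)}"

definition L2_norm :: "'a measure \<Rightarrow> ('a \<Rightarrow> complex) \<Rightarrow> real" where
  "L2_norm M f = sqrt (LINT x|M. (norm (f x))\<^sup>2)"

text \<open>
  Elements of \<open>L\<^sup>2\<close> are represented by functions, so identities in \<open>L\<^sup>2\<close> become identities
  almost everywhere. For an operator \<open>A\<close> with domain \<open>D \<subseteq> L2_space M\<close>, the number \<open>z\<close> is in the
  resolvent set iff \<open>A - z : D \<rightarrow> L\<^sup>2\<close> is injective and surjective with bounded inverse.
\<close>

definition resolvent_set ::
  "'a measure \<Rightarrow> ('a \<Rightarrow> complex) set \<Rightarrow> (('a \<Rightarrow> complex) \<Rightarrow> 'a \<Rightarrow> complex) \<Rightarrow> complex set" where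
  "resolvent_set M D A = {z.
     (\<forall>f\<in>D. (AE x in M. A f x - z * f x = 0) \<longrightarrow> (AE x in M. f x = 0)) \<and>
     (\<forall>h\<in>L2_space M. \<exists>f\<in>D. AE x in M. A f x - z * f x = h x) \<and>
     (\<exists>C. \<forall>f\<in>D. L2_norm M f \<le> C * L2_norm M (\<lambda>x. A f x - z * f x))}"

definition spectrum ::
  "'a measure \<Rightarrow> ('a \<Rightarrow> complex) set \<Rightarrow> (('a \<Rightarrow> complex) \<Rightarrow> 'a \<Rightarrow> complex) \<Rightarrow> complex set" where
  "spectrum M D A = - resolvent_set M D A"

definition is_real_min :: "complex set \<Rightarrow> real \<Rightarrow> bool" where
  "is_real_min S m \<longleftrightarrow> S \<subseteq> \<real> \<and> complex_of_real m \<in> S \<and> (\<forall>z\<in>S. m \<le> Re z)"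

section \<open>The maximal Sturm--Liouville operator\<close>

definition weighted_measure :: "(real \<Rightarrow> real) \<Rightarrow> real measure" where
  "weighted_measure r = density lebesgue (\<lambda>x. ennreal (r x))"

text \<open>
  For \<open>f \<in> AC_loc\<close> the derivative \<open>f'\<close> exists only almost everywhere, so \<open>p f' \<in> AC_loc\<close> means that
  \<open>p f'\<close> agrees almost everywhere with a function \<open>h\<close> in \<^const>\<open>AC_loc\<close>. By continuity there is at
  most one such \<open>h\<close>, and \<open>(p f')'\<close> is \<open>h'\<close>. (At points without a derivative,
  \<^const>\<open>vector_derivative\<close> is unspecified; these points form a null set.)
\<close>

definition is_quasi_deriv :: "(real \<Rightarrow> real) \<Rightarrow> (real \<Rightarrow> complex) \<Rightarrow> (real \<Rightarrow> complex) \<Rightarrow> bool" where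
  "is_quasi_deriv p f h \<longleftrightarrow>
     h \<in> AC_loc \<and> (AE x in lebesgue. h x = p x *\<^sub>R vector_derivative f (at x))"

definition quasi_deriv :: "(real \<Rightarrow> real) \<Rightarrow> (real \<Rightarrow> complex) \<Rightarrow> real \<Rightarrow> complex" where
  "quasi_deriv p f = (THE h. is_quasi_deriv p f h)"

definition SL_expr ::
  "(real \<Rightarrow> real) \<Rightarrow> (real \<Rightarrow> real) \<Rightarrow> (real \<Rightarrow> real) \<Rightarrow> (real \<Rightarrow> complex) \<Rightarrow> real \<Rightarrow> complex" where
  "SL_expr p q r f = (\<lambda>x. (1 / r x) *\<^sub>R
     (- vector_derivative (quasi_deriv p f) (at x) + q x *\<^sub>R f x))"

definition SL_domain ::
  "(real \<Rightarrow> real) \<Rightarrow> (real \<Rightarrow> real) \<Rightarrow> (real \<Rightarrow> real) \<Rightarrow> (real \<Rightarrow> complex) set" where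
  "SL_domain p q r = {f \<in> L2_space (weighted_measure r).
     f \<in> AC_loc \<and> (\<exists>h. is_quasi_deriv p f h) \<and>
     SL_expr p q r f \<in> L2_space (weighted_measure r)}"

definition SL_spectrum ::
  "(real \<Rightarrow> real) \<Rightarrow> (real \<Rightarrow> real) \<Rightarrow> (real \<Rightarrow> real) \<Rightarrow> complex set" where
  "SL_spectrum p q r = spectrum (weighted_measure r) (SL_domain p q r) (SL_expr p q r)"

section \<open>The quantities in the spectral bound\<close>

definition neg_part :: "(real \<Rightarrow> real) \<Rightarrow> real \<Rightarrow> real" where
  "neg_part q = (\<lambda>x. (\<bar>q x\<bar> - q x) / 2)"

definition SL_beta :: "(real \<Rightarrow> real) \<Rightarrow> (real \<Rightarrow> real) \<Rightarrow> ennreal \<Rightarrow> real" where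
  "SL_beta p q s =
     (4 * Lp_norm \<infinity> (\<lambda>x. 1 / p x) * Lp_norm s (neg_part q)) powr
       (if s = \<infinity> then 1 / 2 else enn2real s / (2 * enn2real s - 1))"

definition SL_alpha :: "(real \<Rightarrow> real) \<Rightarrow> (real \<Rightarrow> real) \<Rightarrow> ennreal \<Rightarrow> real" where
  "SL_alpha p q s =
     (if s = \<infinity> then Lp_norm \<infinity> (neg_part q)
      else Lp_norm s (neg_part q) * SL_beta p q s powr (1 / enn2real s))"

definition Omega_set :: "(real \<Rightarrow> real) \<Rightarrow> (real \<Rightarrow> real) \<Rightarrow> real set" where
  "Omega_set r g = {x. r x * g x < 1}"

end

theory Submission imports Defs
begin

text \<open>
  \<^bold>\<open>The inequality.\<close> Let \<open>f\<close> be a function of finite energy on a compact interval that vanishes at an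
  end point, and write \<open>N = \<integral>|f|\<^sup>2\<close>, \<open>X = sup |f|\<^sup>2\<close>, \<open>E = \<integral>p|f'|\<^sup>2\<close>, \<open>R = \<integral>r|f|\<^sup>2\<close>, \<open>P = \<parallel>1/p\<parallel>\<^sub>\<infinity>\<close>,
  \<open>Q = \<parallel>q\<^sub>-\<parallel>\<^sub>s\<close>, \<open>\<sigma> = 1/s\<close>. Integrating \<open>(|f|\<^sup>2)'\<close> from the end point gives \<open>X\<^sup>2 \<le> 4NPE\<close>, and the Hoelder
  inequality gives \<open>\<integral>q\<^sub>-|f|\<^sup>2 \<le> Q X\<^sup>\<sigma> N\<^bsup>1-\<sigma>\<^esup>\<close>. If the energy \<open>\<integral>p|f'|\<^sup>2 + q|f|\<^sup>2\<close> is negative, then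
  \<open>E \<le> Q X\<^sup>\<sigma> N\<^bsup>1-\<sigma>\<^esup>\<close>, and the two facts combine to \<open>X \<le> \<beta>N\<close>. Hence the energy is at least
  \<open>-Q \<beta>\<^sup>\<sigma> N = -\<alpha>N\<close>. Where \<open>rg \<ge> 1\<close> one has \<open>|f|\<^sup>2 \<le> \<parallel>g\<parallel>\<^sub>\<infinity> r|f|\<^sup>2\<close>, and the remaining set \<open>\<Omega>\<^sub>g\<close> contributes
  at most \<open>\<mu>(\<Omega>\<^sub>g) X \<le> \<mu>(\<Omega>\<^sub>g) \<beta> N\<close> to \<open>N\<close>; so \<open>N \<le> \<parallel>g\<parallel>\<^sub>\<infinity> R / (1 - \<mu>(\<Omega>\<^sub>g)\<beta>)\<close>, which is the asserted
  bound for the quotient of energy and \<open>R\<close> (\<open>energy_lower_bound_vanishing\<close>).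

  \<^bold>\<open>The operator.\<close> It remains to identify the infimum \<open>bottom\<close> of these quotients, taken over all
  functions with Dirichlet conditions on some \<open>[-a,a]\<close>, as the minimum of the spectrum of the
  maximal operator. No spectral theorem is used. If \<open>z\<close> is not in \<open>[bottom,\<infinity>)\<close>, the form is coercive at
  \<open>z\<close>, so the Dirichlet problem for \<open>\<tau>f - zf = k\<close> on \<open>[-n,n]\<close> has a unique solution, found by
  shooting, and its norm is bounded independently of \<open>n\<close>. All these solutions lie in one affine
  plane of solutions of the differential equation, so a subsequence converges locally uniformly,
  and weakly in the Hilbert space, to a square integrable solution on the line (\<open>exhaustion\<close>).
  Hence \<open>T - z\<close> is onto, with a bounded right inverse.

  For one real \<open>l\<^sub>0\<close> far to the left, \<open>T - l\<^sub>0\<close> is also injective: for a square integrable solution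
  \<open>u\<close> of \<open>\<tau>u = l\<^sub>0u\<close> the function \<open>F = Re (pu' cnj u)\<close> grows by at least a multiple of \<open>\<integral>r|u|\<^sup>2\<close> over
  every interval of length at least one, and a nonzero value of \<open>F\<close> would make \<open>|u|\<^sup>2\<close> monotone
  towards one end of the line, against \<open>r \<ge> c\<^sub>0 > 0\<close> there (\<open>limit_point\<close>). So every element of the
  domain is a weak limit of Dirichlet solutions, and \<open>\<langle>Tf,f\<rangle>\<close> is real and at least
  \<open>bottom \<parallel>f\<parallel>\<^sup>2\<close> (\<open>numerical_range\<close>). This gives injectivity for all other \<open>z\<close>. Finally, if \<open>T - bottom\<close>
  had an inverse bounded by \<open>C\<close>, the Cauchy--Schwarz inequality for the nonnegative form of
  \<open>T - bottom\<close>, applied to \<open>f\<close> and \<open>(T - bottom)\<^bsup>-1\<^esup>f\<close>, would raise the lower bound of the quotients to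
  \<open>bottom + 1/C\<close> (\<open>bottom_in_spectrum\<close>).

  \<^bold>\<open>Absolute continuity.\<close> The domain is defined by the \<open>\<epsilon>\<close>-\<open>\<delta>\<close> condition and by derivatives that exist
  almost everywhere. All computations use the equivalent condition \<open>antideriv_on\<close>, that the function is
  the indefinite integral of an integrable function. One direction is Lebesgue's differentiation
  theorem, proved by a Vitali covering argument; for the other, the variation function of an
  absolutely continuous function defines a Stieltjes measure, to which the Radon--Nikodym
  theorem applies.
\<close>

section \<open>Differentiation of indefinite integrals\<close>

text \<open>Split \<open>k\<close> at the height \<open>n\<close>: the part above it has small integral by dominated convergence.\<close>

lemma integrable_small_on_small_sets:
  fixes k :: "'a \<Rightarrow> real"
  assumes k: "integrable M k" and nn: "\<And>x. 0 \<le> k x" and e: "0 < e"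
  shows "\<exists>n::nat. \<forall>A\<in>sets M. emeasure M A < \<infinity> \<longrightarrow>
           (LINT x:A|M. k x) \<le> e + real n * measure M A"
proof -
  have [measurable]: "k \<in> borel_measurable M" using k by auto
  have "(\<lambda>n. LINT x|M. max 0 (k x - real n)) \<longlonglongrightarrow> (LINT x|M. 0)"
  proof (rule integral_dominated_convergence[where w=k])
    show "AE x in M. (\<lambda>n. max 0 (k x - real n)) \<longlonglongrightarrow> 0"
    proof (rule AE_I2)
      fix x
      obtain N :: nat where "k x \<le> real N" using real_arch_simple by blast
      then have "eventually (\<lambda>n. max 0 (k x - real n) = 0) sequentially"
        by (intro eventually_sequentiallyI[of N]) auto
      then show "(\<lambda>n. max 0 (k x - real n)) \<longlonglongrightarrow> 0" by (rule tendsto_eventually)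
    qed
  qed (use k nn in auto)
  then have "eventually (\<lambda>n. (LINT x|M. max 0 (k x - real n)) < e) sequentially"
    using e by (intro order_tendstoD) auto
  then obtain n where n: "(LINT x|M. max 0 (k x - real n)) < e"
    by (auto simp: eventually_sequentially)
  have int: "integrable M (\<lambda>x. max 0 (k x - real n))"
    by (rule Bochner_Integration.integrable_bound[OF k]) (use nn in auto)
  show ?thesis
  proof (intro exI[of _ n] ballI impI)
    fix A assume A[measurable]: "A \<in> sets M" and fin: "emeasure M A < \<infinity>"
    have "(LINT x:A|M. k x) \<le> (LINT x|M. max 0 (k x - real n) + real n * indicator A x)"
      unfolding set_lebesgue_integral_def
    proof (rule integral_mono)
      show "integrable M (\<lambda>x. indicator A x *\<^sub>R k x)"
        using k by (intro integrable_mult_indicator) auto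
      show "integrable M (\<lambda>x. max 0 (k x - real n) + real n * indicator A x)"
        using int fin by auto
    qed (auto simp: indicator_def)
    also have "\<dots> = (LINT x|M. max 0 (k x - real n)) + real n * measure M A"
      using int fin by (subst Bochner_Integration.integral_add) auto
    finally show "(LINT x:A|M. k x) \<le> e + real n * measure M A" using n by linarith
  qed
qed

text \<open>The core of the differentiation theorem. Suppose that near every point of a subset \<open>S\<close> of the zero
set of \<open>k\<close> there are arbitrarily small balls with average of \<open>k\<close> above a fixed level. An open set \<open>U\<close>
that exceeds the zero set by little has small integral of \<open>k\<close>, and the Vitali theorem selects disjoint
such balls in \<open>U\<close> that cover \<open>S\<close> up to a null set; so \<open>S\<close> is null.\<close>

lemma AE_indefinite_integral_small_on_zero_set:
  fixes k :: "real \<Rightarrow> real"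
  assumes k: "integrable lebesgue k" and nn: "\<And>x. 0 \<le> k x"
  shows "AE x in lebesgue. k x = 0 \<longrightarrow>
     (\<forall>e>0. \<exists>d>0. \<forall>r. 0 < r \<and> r < d \<longrightarrow> (LINT t:cball x r|lebesgue. k t) \<le> e * r)"
proof -
  have [measurable]: "k \<in> borel_measurable lebesgue" using k by auto
  define Z where "Z = {x. k x = 0}"
  have Z[measurable]: "Z \<in> sets lebesgue" proof -
    have "Z = k -` {0} \<inter> space lebesgue" by (auto simp: Z_def)
    then show ?thesis by (metis \<open>k \<in> borel_measurable lebesgue\<close> borel_closed closed_singleton measurable_sets)
  qed
  define S where "S e = {x\<in>Z. \<forall>d>0. \<exists>r. 0 < r \<and> r < d \<and> e * r < (LINT t:cball x r|lebesgue. k t)}" for e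
  let ?nu = "density lebesgue k"
  have nu: "emeasure ?nu A = ennreal (LINT x:A|lebesgue. k x)" if "A \<in> sets lebesgue" for A
  proof -
    have "emeasure ?nu A = (\<integral>\<^sup>+x. ennreal (indicator A x *\<^sub>R k x) \<partial>lebesgue)"
      using that by (subst emeasure_density) (auto simp: indicator_def intro!: nn_integral_cong)
    also have "\<dots> = ennreal (LINT x:A|lebesgue. k x)"
      unfolding set_lebesgue_integral_def
      using that nn by (intro nn_integral_eq_integral integrable_mult_indicator k) auto
    finally show ?thesis .
  qed
  have negl: "negligible (S e)" if e: "0 < e" for e
  proof (rule iffD2[OF negligible_outer_le], intro allI impI)
    fix \<eta> :: real assume \<eta>: "0 < \<eta>"
    define e' where "e' = \<eta> * e / 8"
    have e': "0 < e'" using \<eta> e by (simp add: e'_def)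
    obtain n :: nat where n: "\<And>A. A\<in>sets lebesgue \<Longrightarrow> emeasure lebesgue A < \<infinity> \<Longrightarrow>
           (LINT x:A|lebesgue. k x) \<le> e' + real n * measure lebesgue A"
      using integrable_small_on_small_sets[OF k nn e'] by blast
    have "0 < e' / (real n + 1)" using e' by simp
    then obtain U where U: "open U" "Z \<subseteq> U" "U - Z \<in> lmeasurable"
        "emeasure lebesgue (U - Z) < ennreal (e' / (real n + 1))"
      by (rule sets_lebesgue_outer_open[OF Z])
    have [measurable]: "U \<in> sets lebesgue" by (metis U(1) borel_open sets_completionI_sets sets_lborel)
    have "measure lebesgue (U - Z) < e' / (real n + 1)"
      using U(3,4) e' by (simp add: emeasure_eq_measure2 ennreal_less_iff)
    then have "real n * measure lebesgue (U - Z) \<le> real n * (e' / (real n + 1))"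
      by (intro mult_left_mono) auto
    also have "\<dots> \<le> e'" using e' by (simp add: field_simps)
    finally have "(LINT x:(U-Z)|lebesgue. k x) \<le> 2 * e'"
      using n[of "U - Z"] U(3) by (auto simp: fmeasurable_def top.not_eq_extremum)
    moreover have "(LINT x:(U-Z)|lebesgue. k x) = (LINT x:U|lebesgue. k x)"
      unfolding set_lebesgue_integral_def
      by (rule Bochner_Integration.integral_cong) (auto simp: indicator_def Z_def)
    ultimately have kU: "(LINT x:U|lebesgue. k x) \<le> 2 * e'" by simp
    define K where "K = {(x,r). x \<in> S e \<and> 0 < r \<and> cball x r \<subseteq> U \<and> e * r < (LINT t:cball x r|lebesgue. k t)}"
    have r0: "\<And>i. i \<in> K \<Longrightarrow> 0 < snd i" by (auto simp: K_def)
    have cov: "\<exists>i. i \<in> K \<and> x \<in> cball (fst i) (snd i) \<and> snd i < d" if x: "x \<in> S e" and d: "0 < d" for x d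
    proof -
      from x have "x \<in> U" using U(2) by (auto simp: S_def)
      then obtain d' where d': "0 < d'" "cball x d' \<subseteq> U" using U(1) open_contains_cball by blast
      obtain r where r: "0 < r" "r < min d d'" "e * r < (LINT t:cball x r|lebesgue. k t)"
        using x[unfolded S_def] d d'(1) by (auto dest!: spec[of _ "min d d'"])
      have "cball x r \<subseteq> U" by (rule order_trans[OF subset_cball d'(2)]) (use r(2) in simp)
      then show "\<exists>i. i \<in> K \<and> x \<in> cball (fst i) (snd i) \<and> snd i < d"
        using x r by (intro exI[of _ "(x,r)"]) (simp add: K_def)
    qed
    obtain C where C: "countable C" "C \<subseteq> K"
      "pairwise (\<lambda>i j. disjnt (cball (fst i) (snd i)) (cball (fst j) (snd j))) C"
      "negligible (S e - (\<Union>i\<in>C. cball (fst i) (snd i)))"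
      by (rule Vitali_covering_theorem_cballs[OF r0 cov])
    let ?B = "\<lambda>i::real\<times>real. cball (fst i) (snd i)"
    have disj: "disjoint_family_on ?B C"
      using C(3) by (auto simp: disjoint_family_on_def pairwise_def disjnt_def)
    have Bs: "(\<Union>i\<in>C. ?B i) \<in> sets lebesgue" using C(1) by (intro sets.countable_UN') auto
    have "emeasure lebesgue (\<Union>i\<in>C. ?B i) = (\<integral>\<^sup>+i. emeasure lebesgue (?B i) \<partial>count_space C)"
      using disj C(1) by (intro emeasure_UN_countable) auto
    also have "\<dots> \<le> (\<integral>\<^sup>+i. ennreal (2 / e) * emeasure ?nu (?B i) \<partial>count_space C)"
    proof (rule nn_integral_mono)
      fix i assume "i \<in> space (count_space C)"
      then have "i \<in> K" using C(2) by auto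
      then have i: "0 < snd i" "e * snd i < (LINT t:?B i|lebesgue. k t)" by (auto simp: K_def)
      have "emeasure lebesgue (?B i) = ennreal (2 * snd i)"
        using i(1) by (simp add: cball_eq_atLeastAtMost)
      also have "\<dots> \<le> ennreal ((2 / e) * (LINT t:?B i|lebesgue. k t))"
        using i e by (intro ennreal_leI) (simp add: field_simps)
      also have "\<dots> = ennreal (2 / e) * emeasure ?nu (?B i)"
        using e nu[of "?B i"] ennreal_mult'[of "2 / e" "LINT t:?B i|lebesgue. k t"] by simp
      finally show "emeasure lebesgue (?B i) \<le> ennreal (2 / e) * emeasure ?nu (?B i)" .
    qed
    also have "\<dots> = ennreal (2 / e) * (\<integral>\<^sup>+i. emeasure ?nu (?B i) \<partial>count_space C)"
      by (rule nn_integral_cmult) auto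
    also have "(\<integral>\<^sup>+i. emeasure ?nu (?B i) \<partial>count_space C) = emeasure ?nu (\<Union>i\<in>C. ?B i)"
      using disj C(1) by (intro emeasure_UN_countable[symmetric]) auto
    also have "\<dots> \<le> emeasure ?nu U"
    proof (intro emeasure_mono UN_least)
      fix i assume "i \<in> C"
      then have "i \<in> K" using C(2) by blast
      then show "?B i \<subseteq> U" by (simp add: K_def case_prod_beta)
    qed auto
    also have "\<dots> \<le> ennreal (2 * e')" using kU nu[of U] by (simp add: ennreal_leI)
    also have "ennreal (2 / e) * ennreal (2 * e') = ennreal (\<eta> / 2)"
      using e \<eta> by (simp add: ennreal_mult'[symmetric] e'_def field_simps)
    finally have m: "emeasure lebesgue (\<Union>i\<in>C. ?B i) \<le> ennreal (\<eta> / 2)"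
      by (simp add: mult_left_mono)
    then have Bm: "(\<Union>i\<in>C. ?B i) \<in> lmeasurable"
      using Bs by (auto simp: fmeasurable_def intro: le_less_trans)
    let ?T = "(\<Union>i\<in>C. ?B i) \<union> (S e - (\<Union>i\<in>C. ?B i))"
    have "?T \<in> lmeasurable" using Bm C(4) negligible_imp_measurable by blast
    moreover have "measure lebesgue ?T = measure lebesgue (\<Union>i\<in>C. ?B i)"
      using C(4) Bs by (intro measure_Un_null_set) (auto simp: negligible_iff_null_sets)
    moreover have "measure lebesgue (\<Union>i\<in>C. ?B i) \<le> \<eta>"
      using m Bm \<eta> by (simp add: emeasure_eq_measure2)
    ultimately show "\<exists>T. S e \<subseteq> T \<and> T \<in> lmeasurable \<and> measure lebesgue T \<le> \<eta>"
      by (intro exI[of _ ?T]) auto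
  qed
  have "AE x in lebesgue. \<forall>m::nat. x \<notin> S (1 / real (Suc m))"
    unfolding AE_all_countable
  proof
    fix m :: nat
    have "S (1 / real (Suc m)) \<in> null_sets lebesgue"
      using negl[of "1 / real (Suc m)"] by (simp add: negligible_iff_null_sets)
    then show "AE x in lebesgue. x \<notin> S (1 / real (Suc m))" by (rule AE_not_in)
  qed
  then show ?thesis
  proof (rule eventually_mono, intro impI allI)
    fix x e :: real assume x: "\<forall>m::nat. x \<notin> S (1 / real (Suc m))" and k0: "k x = 0" and e: "0 < e"
    obtain m :: nat where m: "1 / real (Suc m) < e" using e nat_approx_posE by blast
    have "x \<in> Z" using k0 by (simp add: Z_def)
    then obtain d where d: "d > 0" "\<And>r. 0 < r \<Longrightarrow> r < d \<Longrightarrow> (LINT t:cball x r|lebesgue. k t) \<le> 1 / real (Suc m) * r"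
      using x[THEN spec[of _ m]] unfolding S_def mem_Collect_eq by (meson not_le)
    show "\<exists>d>0. \<forall>r. 0 < r \<and> r < d \<longrightarrow> (LINT t:cball x r|lebesgue. k t) \<le> e * r"
    proof (intro exI[of _ d] conjI allI impI d(1))
      fix r assume r: "0 < r \<and> r < d"
      have "(LINT t:cball x r|lebesgue. k t) \<le> 1 / real (Suc m) * r" using d(2) r by blast
      also have "\<dots> \<le> e * r" using m r by (intro mult_right_mono) auto
      finally show "(LINT t:cball x r|lebesgue. k t) \<le> e * r" .
    qed
  qed
qed

text \<open>Apply the preceding lemma to the positive part of \<open>g - c\<close>, which vanishes exactly where \<open>g \<le> c\<close>.\<close>

lemma AE_upper_derivative_le:
  fixes g :: "real \<Rightarrow> real"
  assumes g: "\<And>a b. g absolutely_integrable_on {a..b}"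
  shows "AE x in lebesgue. g x \<le> c \<longrightarrow>
     (\<forall>e>0. \<exists>d>0. \<forall>a b. a \<le> x \<and> x \<le> b \<and> b - a < d \<longrightarrow> integral {a..b} g \<le> (c + e) * (b - a))"
proof -
  define k where "k N = (\<lambda>x. indicator {-real N..real N} x *\<^sub>R max 0 (g x - c))" for N :: nat
  have loc: "(\<lambda>x. max 0 (g x - c)) absolutely_integrable_on {a..b}" for a b
    by (rule absolutely_integrable_max_1) (auto intro!: set_integral_diff g)
  have gi: "g integrable_on {a..b}" for a b using g by (rule set_lebesgue_integral_eq_integral(1))
  have loci: "(\<lambda>x. max 0 (g x - c)) integrable_on {a..b}" for a b
    using loc by (rule set_lebesgue_integral_eq_integral(1))
  have kint: "integrable lebesgue (k N)" for N
    using loc[of "-real N" "real N"] unfolding k_def set_integrable_def .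
  have knn: "0 \<le> k N x" for N x by (auto simp: k_def indicator_def)
  have "AE x in lebesgue. \<forall>N. k N x = 0 \<longrightarrow>
     (\<forall>e>0. \<exists>d>0. \<forall>r. 0 < r \<and> r < d \<longrightarrow> (LINT t:cball x r|lebesgue. k N t) \<le> e * r)"
    unfolding AE_all_countable using AE_indefinite_integral_small_on_zero_set[OF kint knn] by blast
  then show ?thesis
  proof (rule eventually_mono, intro impI allI)
    fix x e :: real
    assume x: "\<forall>N. k N x = 0 \<longrightarrow> (\<forall>e>0. \<exists>d>0. \<forall>r. 0 < r \<and> r < d \<longrightarrow> (LINT t:cball x r|lebesgue. k N t) \<le> e * r)"
      and gx: "g x \<le> c" and e: "0 < e"
    obtain N :: nat where N: "\<bar>x\<bar> + 1 \<le> real N" using real_arch_simple by blast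
    have "k N x = 0" using gx by (simp add: k_def)
    then obtain d where d: "d > 0" "\<And>r. 0 < r \<Longrightarrow> r < d \<Longrightarrow> (LINT t:cball x r|lebesgue. k N t) \<le> e * r"
      using x[THEN spec, THEN mp, THEN spec, THEN mp, OF _ e] by blast
    show "\<exists>d>0. \<forall>a b. a \<le> x \<and> x \<le> b \<and> b - a < d \<longrightarrow> integral {a..b} g \<le> (c + e) * (b - a)"
    proof (intro exI[of _ "min d 1"] conjI allI impI)
      fix a b assume ab: "a \<le> x \<and> x \<le> b \<and> b - a < min d 1"
      show "integral {a..b} g \<le> (c + e) * (b - a)"
      proof (cases "a = b")
        case False
        then have lt: "a < b" using ab by simp
        have "integral {a..b} g \<le> integral {a..b} (\<lambda>t. c + max 0 (g t - c))"
          by (rule integral_le[OF gi integrable_add[OF integrable_const_ivl loci]]) auto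
        also have "\<dots> = c * (b - a) + integral {a..b} (\<lambda>t. max 0 (g t - c))"
          using lt by (subst integral_add[OF integrable_const_ivl loci]) auto
        also have "integral {a..b} (\<lambda>t. max 0 (g t - c)) = (LINT t:{a..b}|lebesgue. max 0 (g t - c))"
          by (simp add: set_lebesgue_integral_eq_integral(2) loc)
        also have "\<dots> \<le> (LINT t:cball x (b - a)|lebesgue. k N t)"
          unfolding set_lebesgue_integral_def
        proof (rule integral_mono)
          show "integrable lebesgue (\<lambda>t. indicator {a..b} t *\<^sub>R max 0 (g t - c))"
            using loc unfolding set_integrable_def .
          show "integrable lebesgue (\<lambda>t. indicator (cball x (b - a)) t *\<^sub>R k N t)"
            by (rule integrable_mult_indicator[OF _ kint]) auto
        next
          fix t
          have "t \<in> cball x (b - a)" "t \<in> {- real N..real N}" if "t \<in> {a..b}"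
            using that ab N by (auto simp: dist_real_def)
          then show "indicator {a..b} t *\<^sub>R max 0 (g t - c) \<le> indicator (cball x (b - a)) t *\<^sub>R k N t"
            by (auto simp: indicator_def k_def)
        qed
        also have "\<dots> \<le> e * (b - a)" using d(2) ab lt by auto
        finally show ?thesis by (simp add: algebra_simps)
      qed (use ab in auto)
    qed (use d in auto)
  qed
qed

lemma AE_averages_tendsto:
  fixes g :: "real \<Rightarrow> real"
  assumes g: "\<And>a b. g absolutely_integrable_on {a..b}"
  shows "AE x in lebesgue. \<forall>e>0. \<exists>d>0. \<forall>a b. a \<le> x \<and> x \<le> b \<and> b - a < d \<longrightarrow>
           \<bar>integral {a..b} g - g x * (b - a)\<bar> \<le> e * (b - a)"
proof -
  let ?P = "\<lambda>g c x. g x \<le> c \<longrightarrow> (\<forall>e>0. \<exists>d>0. \<forall>a b. a \<le> x \<and> x \<le> b \<and> b - a < d \<longrightarrow> integral {a..b} g \<le> (c + e) * (b - a))"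
  have g': "(\<lambda>x. - g x) absolutely_integrable_on {a..b}" for a b
    using absolutely_integrable_linear[OF g bounded_linear_minus[OF bounded_linear_ident]] by (simp add: o_def)
  have "AE x in lebesgue. \<forall>c::rat. ?P g (of_rat c) x \<and> ?P (\<lambda>x. - g x) (of_rat c) x"
    unfolding AE_all_countable
    by (intro allI AE_conjI AE_upper_derivative_le[OF g] AE_upper_derivative_le[OF g'])
  then show ?thesis
  proof (rule eventually_mono, intro impI allI)
    fix x e :: real
    assume x: "\<forall>c::rat. ?P g (of_rat c) x \<and> ?P (\<lambda>x. - g x) (of_rat c) x" and e: "0 < e"
    obtain c1 :: rat where c1: "g x < of_rat c1" "of_rat c1 < g x + e / 2"
      using of_rat_dense[of "g x" "g x + e / 2"] e by auto
    obtain c2 :: rat where c2: "- g x < of_rat c2" "of_rat c2 < - g x + e / 2"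
      using of_rat_dense[of "- g x" "- g x + e / 2"] e by auto
    have e2: "e / 2 > 0" using e by simp
    obtain d1 where d1: "d1 > 0" "\<And>a b. a \<le> x \<and> x \<le> b \<and> b - a < d1 \<Longrightarrow> integral {a..b} g \<le> (of_rat c1 + e/2) * (b - a)"
      using x[rule_format, of c1] c1(1) e2 by (meson less_imp_le)
    obtain d2 where d2: "d2 > 0" "\<And>a b. a \<le> x \<and> x \<le> b \<and> b - a < d2 \<Longrightarrow> integral {a..b} (\<lambda>x. - g x) \<le> (of_rat c2 + e/2) * (b - a)"
      using x[rule_format, of c2] c2(1) e2 by (meson less_imp_le)
    \<comment> \<open>rational levels just above \<open>g x\<close>, and just above \<open>- g x\<close> for the lower bound, enclose the averages\<close>
    show "\<exists>d>0. \<forall>a b. a \<le> x \<and> x \<le> b \<and> b - a < d \<longrightarrow> \<bar>integral {a..b} g - g x * (b - a)\<bar> \<le> e * (b - a)"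
    proof (intro exI[of _ "min d1 d2"] conjI allI impI)
      fix a b assume ab: "a \<le> x \<and> x \<le> b \<and> b - a < min d1 d2"
      have "integral {a..b} g \<le> (of_rat c1 + e/2) * (b - a)" using d1 ab by auto
      also have "\<dots> \<le> (g x + e) * (b - a)" using c1 ab by (intro mult_right_mono) auto
      finally have 1: "integral {a..b} g \<le> (g x + e) * (b - a)" .
      have "integral {a..b} (\<lambda>x. - g x) \<le> (of_rat c2 + e/2) * (b - a)" using d2 ab by auto
      also have "\<dots> \<le> (- g x + e) * (b - a)" using c2 ab by (intro mult_right_mono) auto
      finally have 2: "- integral {a..b} g \<le> (- g x + e) * (b - a)" by simp
      show "\<bar>integral {a..b} g - g x * (b - a)\<bar> \<le> e * (b - a)"
        using 1 2 by (auto simp: abs_le_iff algebra_simps)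
    qed (use d1 d2 in auto)
  qed
qed

lemma AE_has_real_derivative_integral:
  fixes F g :: "real \<Rightarrow> real"
  assumes g: "\<And>a b. g absolutely_integrable_on {a..b}"
    and F: "\<And>a b. a \<le> b \<Longrightarrow> F b - F a = integral {a..b} g"
  shows "AE x in lebesgue. (F has_vector_derivative g x) (at x)"
  using AE_averages_tendsto[OF g]
proof (rule eventually_mono)
  fix x :: real
  assume x: "\<forall>e>0. \<exists>d>0. \<forall>a b. a \<le> x \<and> x \<le> b \<and> b - a < d \<longrightarrow>
           \<bar>integral {a..b} g - g x * (b - a)\<bar> \<le> e * (b - a)"
  show "(F has_vector_derivative g x) (at x)"
    unfolding has_vector_derivative_def has_derivative_at_alt
  proof (intro conjI allI impI)
    fix e :: real assume "0 < e"
    from x[THEN spec, THEN mp, OF this]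
    obtain d where d: "d > 0" "\<And>a b. a \<le> x \<Longrightarrow> x \<le> b \<Longrightarrow> b - a < d \<Longrightarrow>
           \<bar>integral {a..b} g - g x * (b - a)\<bar> \<le> e * (b - a)" by blast
    show "\<exists>d>0. \<forall>y. norm (y - x) < d \<longrightarrow> norm (F y - F x - (y - x) *\<^sub>R g x) \<le> e * norm (y - x)"
    proof (intro exI[of _ d] conjI allI impI d(1))
      fix y assume y: "norm (y - x) < d"
      show "norm (F y - F x - (y - x) *\<^sub>R g x) \<le> e * norm (y - x)"
      proof (cases "x \<le> y")
        case True
        then show ?thesis using d(2)[of x y] y F[of x y] by (simp add: mult.commute)
      next
        case False
        then have "F y - F x - (y - x) *\<^sub>R g x = - (integral {y..x} g - g x * (x - y))"
          using F[of y x] by (simp add: algebra_simps)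
        then have "norm (F y - F x - (y - x) *\<^sub>R g x) = \<bar>integral {y..x} g - g x * (x - y)\<bar>"
          by (simp only: real_norm_def abs_minus_cancel)
        also have "\<dots> \<le> e * (x - y)" using d(2)[of y x] y False by simp
        finally show ?thesis using False by simp
      qed
    qed
  qed (rule bounded_linear_scaleR_left)
qed

theorem AE_has_vector_derivative_integral:
  fixes F g :: "real \<Rightarrow> complex"
  assumes g: "\<And>a b. g absolutely_integrable_on {a..b}"
    and F: "\<And>a b. a \<le> b \<Longrightarrow> F b - F a = integral {a..b} g"
  shows "AE x in lebesgue. (F has_vector_derivative g x) (at x)"
proof -
  have gi: "g integrable_on {a..b}" for a b using g by (rule set_lebesgue_integral_eq_integral(1))
  have "AE x in lebesgue. ((\<lambda>x. Re (F x)) has_vector_derivative Re (g x)) (at x)"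
  proof (rule AE_has_real_derivative_integral)
    show "(\<lambda>x. Re (g x)) absolutely_integrable_on {a..b}" for a b
      using absolutely_integrable_linear[OF g bounded_linear_Re] by (simp add: o_def)
    show "Re (F b) - Re (F a) = integral {a..b} (\<lambda>x. Re (g x))" if "a \<le> b" for a b
      using arg_cong[OF F[OF that], of Re] integral_linear[OF gi bounded_linear_Re, of a b] by (simp add: o_def)
  qed
  moreover have "AE x in lebesgue. ((\<lambda>x. Im (F x)) has_vector_derivative Im (g x)) (at x)"
  proof (rule AE_has_real_derivative_integral)
    show "(\<lambda>x. Im (g x)) absolutely_integrable_on {a..b}" for a b
      using absolutely_integrable_linear[OF g bounded_linear_Im] by (simp add: o_def)
    show "Im (F b) - Im (F a) = integral {a..b} (\<lambda>x. Im (g x))" if "a \<le> b" for a b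
      using arg_cong[OF F[OF that], of Im] integral_linear[OF gi bounded_linear_Im, of a b] by (simp add: o_def)
  qed
  ultimately show ?thesis
  proof eventually_elim
    case (elim x)
    then show ?case
      by (simp add: has_vector_derivative_complex_iff has_real_derivative_iff_has_vector_derivative)
  qed
qed

section \<open>Absolutely continuous functions are indefinite integrals\<close>

definition nonoverlapping :: "'i set \<Rightarrow> ('i \<Rightarrow> real) \<Rightarrow> ('i \<Rightarrow> real) \<Rightarrow> bool" where
  "nonoverlapping I u v \<longleftrightarrow> finite I \<and> (\<forall>i\<in>I. u i \<le> v i) \<and>
     (\<forall>i\<in>I. \<forall>j\<in>I. i \<noteq> j \<longrightarrow> {u i<..<v i} \<inter> {u j<..<v j} = {})"

text \<open>The \<open>\<epsilon>\<close>-\<open>\<delta>\<close> condition for families of intervals in the whole line. Index sets may be arbitrary finite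
sets, because unions of families over Sigma types occur below.\<close>

definition AC_on_line :: "(real \<Rightarrow> 'a::real_normed_vector) \<Rightarrow> bool" where
  "AC_on_line f \<longleftrightarrow> (\<forall>e>0. \<exists>d>0. \<forall>(I::nat set) u v. nonoverlapping I u v \<longrightarrow>
     (\<Sum>i\<in>I. v i - u i) < d \<longrightarrow> (\<Sum>i\<in>I. norm (f (v i) - f (u i))) < e)"

lemma nonoverlapping_reindex:
  assumes I: "nonoverlapping I u v" and h: "bij_betw h J I"
  shows "nonoverlapping J (u \<circ> h) (v \<circ> h)"
proof -
  have fin: "finite J" using I h bij_betw_finite unfolding nonoverlapping_def by blast
  have mem: "h i \<in> I" if "i \<in> J" for i using h that bij_betwE by blast
  have inj: "h i \<noteq> h j" if "i \<in> J" "j \<in> J" "i \<noteq> j" for i j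
    using h that by (meson bij_betw_imp_inj_on inj_onD)
  show ?thesis
    using I fin mem inj unfolding nonoverlapping_def o_def by simp
qed

lemma AC_on_lineD:
  assumes f: "AC_on_line f" and e: "0 < e"
  shows "\<exists>d>0. \<forall>(I::'i set) u v. nonoverlapping I u v \<longrightarrow>
     (\<Sum>i\<in>I. v i - u i) < d \<longrightarrow> (\<Sum>i\<in>I. norm (f (v i) - f (u i))) < e"
proof -
  obtain d where d: "0 < d" "\<And>(I::nat set) u v. nonoverlapping I u v \<Longrightarrow>
     (\<Sum>i\<in>I. v i - u i) < d \<Longrightarrow> (\<Sum>i\<in>I. norm (f (v i) - f (u i))) < e"
    using f[unfolded AC_on_line_def, THEN spec, THEN mp, OF e] by blast
  show ?thesis
  proof (intro exI[of _ d] conjI allI impI d(1))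
    fix I :: "'i set" and u v assume I: "nonoverlapping I u v" and s: "(\<Sum>i\<in>I. v i - u i) < d"
    obtain h where h: "bij_betw h {0..<card I} I"
      using ex_bij_betw_nat_finite[of I] I[unfolded nonoverlapping_def] by auto
    have "(\<Sum>i\<in>{0..<card I}. norm (f ((v\<circ>h) i) - f ((u\<circ>h) i))) < e"
    proof (rule d(2)[OF nonoverlapping_reindex[OF I h]])
      show "(\<Sum>i\<in>{0..<card I}. (v\<circ>h) i - (u\<circ>h) i) < d"
        using s sum.reindex_bij_betw[OF h, of "\<lambda>i. v i - u i"] by simp
    qed
    then show "(\<Sum>i\<in>I. norm (f (v i) - f (u i))) < e"
      using sum.reindex_bij_betw[OF h, of "\<lambda>i. norm (f (v i) - f (u i))"] by simp
  qed
qed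

lemma nonoverlapping_total_length_le:
  assumes I: "nonoverlapping I u v" and U: "U \<in> lmeasurable"
    and sub: "\<And>i. i \<in> I \<Longrightarrow> {u i<..<v i} \<subseteq> U"
  shows "(\<Sum>i\<in>I. v i - u i) \<le> measure lebesgue U"
proof -
  have "(\<Sum>i\<in>I. v i - u i) = (\<Sum>i\<in>I. measure lebesgue {u i<..<v i})"
    using I unfolding nonoverlapping_def by (intro sum.cong) (auto simp: measure_def)
  also have "\<dots> = measure lebesgue (\<Union>i\<in>I. {u i<..<v i})"
    using I unfolding nonoverlapping_def
    by (intro measure_finite_Union[symmetric]) (auto simp: disjoint_family_on_def)
  also have "\<dots> \<le> measure lebesgue U"
    using sub U I unfolding nonoverlapping_def
    by (intro measure_mono_fmeasurable) (auto intro!: sets.finite_UN)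
  finally show ?thesis .
qed

lemma AC_on_line_continuous:
  assumes "AC_on_line f"
  shows "continuous_on UNIV f"
  unfolding continuous_on_iff
proof (intro ballI allI impI)
  fix x e :: real assume e: "0 < e"
  obtain d where d: "0 < d" "\<And>(I::nat set) u v. nonoverlapping I u v \<Longrightarrow>
     (\<Sum>i\<in>I. v i - u i) < d \<Longrightarrow> (\<Sum>i\<in>I. norm (f (v i) - f (u i))) < e"
    using AC_on_lineD[OF assms e] by blast
  show "\<exists>d>0. \<forall>x'\<in>UNIV. dist x' x < d \<longrightarrow> dist (f x') (f x) < e"
  proof (intro exI[of _ d] conjI ballI impI d(1))
    fix y assume y: "dist y x < d"
    have "(\<Sum>i\<in>{0::nat}. norm (f (max x y) - f (min x y))) < e"
      using y by (intro d(2)) (auto simp: nonoverlapping_def dist_real_def)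
    then show "dist (f y) (f x) < e"
      by (cases "x \<le> y") (auto simp: dist_norm norm_minus_commute max_def min_def)
  qed
qed

text \<open>Covered economically by nonoverlapping intervals, a null set has small measure: the sum of the increments
over any finite part of the cover is small by absolute continuity.\<close>

lemma AC_on_line_null_sets:
  fixes F :: "real \<Rightarrow> real"
  assumes mono: "mono F" and AC: "AC_on_line F"
  shows "absolutely_continuous lborel (interval_measure F)"
  unfolding absolutely_continuous_def
proof
  let ?m = "interval_measure F"
  have cont: "continuous_on UNIV F" using AC by (rule AC_on_line_continuous)
  have Icc: "emeasure ?m {a..b} = ennreal (F b - F a)" if "a \<le> b" for a b
    using that mono cont by (intro emeasure_interval_measure_Icc) (auto simp: mono_def)
  fix N :: "real set" assume N: "N \<in> null_sets lborel"
  have Nb[measurable]: "N \<in> sets borel" using N by auto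
  have small: "emeasure ?m (N \<inter> cbox (-real m) (real m)) \<le> ennreal e" if e: "0 < e" and m: "0 < m" for e and m :: nat
  proof -
    let ?S = "N \<inter> cbox (-real m) (real m)"
    obtain d where d: "0 < d" "\<And>(I::real set set) u v. nonoverlapping I u v \<Longrightarrow>
       (\<Sum>i\<in>I. v i - u i) < d \<Longrightarrow> (\<Sum>i\<in>I. norm (F (v i) - F (u i))) < e"
      using AC_on_lineD[OF AC e] by blast
    have Nl: "N \<in> null_sets lebesgue" using N by (simp add: null_sets_completionI)
    then have "N \<in> sets lebesgue" by auto
    then obtain U where U: "open U" "N \<subseteq> U" "U - N \<in> lmeasurable" "emeasure lebesgue (U - N) < ennreal d"
      using sets_lebesgue_outer_open[OF _ d(1)] by blast
    have Us: "U \<in> sets lebesgue" by (metis U(1) borel_open sets_completionI_sets sets_lborel)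
    have eU: "emeasure lebesgue U < ennreal d"
      using U(4) emeasure_Diff_null_set[OF Nl Us] by simp
    then have Um: "U \<in> lmeasurable" using Us by (auto simp: fmeasurable_def intro: less_trans)
    then have mU: "measure lebesgue U < d" using eU d(1) by (simp add: emeasure_eq_measure2 ennreal_less_iff)
    let ?g = "\<lambda>x. if x \<in> N then U else ball x 1"
    have g: "gauge ?g" unfolding gauge_def using U(1,2) by auto
    have ne: "box (-real m) (real m) \<noteq> {}" using m by auto
    obtain \<D> where D: "countable \<D>" "\<Union>\<D> \<subseteq> cbox (-real m) (real m)"
      "\<And>K. K \<in> \<D> \<Longrightarrow> interior K \<noteq> {} \<and> (\<exists>c d. K = cbox c d)"
      "pairwise (\<lambda>A B. interior A \<inter> interior B = {}) \<D>"
      "\<And>K. K \<in> \<D> \<Longrightarrow> \<exists>x \<in> ?S \<inter> K. K \<subseteq> ?g x"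
      "?S \<subseteq> \<Union>\<D>"
      using covering_lemma[OF Int_lower2 ne g] by metis
    have K: "K = {Inf K..Sup K} \<and> Inf K \<le> Sup K" if "K \<in> \<D>" for K
    proof -
      obtain c d where cd: "K = {c..d}" "interior K \<noteq> {}" using D(3)[OF \<open>K \<in> \<D>\<close>] by auto
      then have "c \<le> d" by (auto simp: interior_atLeastAtMost_real)
      then show ?thesis using cd by simp
    qed
    have fin: "emeasure ?m (\<Union>\<F>) \<le> ennreal e" if F: "finite \<F>" "\<F> \<subseteq> \<D>" for \<F>
    proof -
      have KF: "K = {Inf K..Sup K} \<and> Inf K \<le> Sup K" if "K \<in> \<F>" for K using K F(2) that by blast
      have int: "interior K = {Inf K<..<Sup K}" if "K \<in> \<F>" for K
        using KF[OF that] interior_atLeastAtMost_real by metis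
      have no: "nonoverlapping \<F> Inf Sup"
        unfolding nonoverlapping_def
      proof (intro conjI ballI impI F(1))
        show "Inf K \<le> Sup K" if "K \<in> \<F>" for K using KF[OF that] by simp
        fix A B assume "A \<in> \<F>" "B \<in> \<F>" "A \<noteq> B"
        then show "{Inf A<..<Sup A} \<inter> {Inf B<..<Sup B} = {}"
          using D(4) F(2) int unfolding pairwise_def by (metis subsetD)
      qed
      have "{Inf K<..<Sup K} \<subseteq> U" if "K \<in> \<F>" for K
      proof -
        have "K \<in> \<D>" using F(2) that by blast
        then have "K \<subseteq> U" using D(5)[of K] by auto
        then show ?thesis using interior_subset[of K] int[OF that] by blast
      qed
      then have "(\<Sum>K\<in>\<F>. Sup K - Inf K) < d"
        using nonoverlapping_total_length_le[OF no Um] mU by fastforce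
      then have lt: "(\<Sum>K\<in>\<F>. norm (F (Sup K) - F (Inf K))) < e" by (rule d(2)[OF no])
      have sb: "K \<in> sets ?m" if "K \<in> \<F>" for K
        using KF[OF that] by (metis atLeastAtMost_borel sets_interval_measure)
      have "emeasure ?m (\<Union>\<F>) \<le> (\<Sum>K\<in>\<F>. emeasure ?m K)"
        using emeasure_subadditive_finite[OF F(1), of "\<lambda>K. K" ?m] sb by (auto simp: image_subset_iff)
      also have "\<dots> = (\<Sum>K\<in>\<F>. ennreal (norm (F (Sup K) - F (Inf K))))"
      proof (rule sum.cong[OF refl])
        fix K assume "K \<in> \<F>"
        then have "K = {Inf K..Sup K}" "Inf K \<le> Sup K" using KF by auto
        then show "emeasure ?m K = ennreal (norm (F (Sup K) - F (Inf K)))"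
          using Icc[of "Inf K" "Sup K"] monoD[OF mono, of "Inf K" "Sup K"] by simp
      qed
      also have "\<dots> = ennreal (\<Sum>K\<in>\<F>. norm (F (Sup K) - F (Inf K)))" by (rule sum_ennreal) auto
      also have "\<dots> \<le> ennreal e" using lt by (intro ennreal_leI) auto
      finally show ?thesis .
    qed
    show ?thesis
    proof (cases "\<D> = {}")
      case True then show ?thesis using D(6) by auto
    next
      case False
      let ?A = "\<lambda>n. \<Union>(from_nat_into \<D> ` {..<n::nat})"
      have sub: "from_nat_into \<D> ` {..<n} \<subseteq> \<D>" for n using False by (auto intro: from_nat_into)
      have As: "?A n \<in> sets ?m" for n
      proof (rule sets.finite_Union)
        show "from_nat_into \<D> ` {..<n} \<subseteq> sets ?m"
        proof
          fix K assume "K \<in> from_nat_into \<D> ` {..<n}"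
          then have "K = {Inf K..Sup K}" using K sub by blast
          then show "K \<in> sets ?m" by (metis atLeastAtMost_borel sets_interval_measure)
        qed
      qed auto
      have un: "\<Union>\<D> = (\<Union>n. ?A n)"
      proof
        show "\<Union>\<D> \<subseteq> (\<Union>n. ?A n)"
        proof
          fix x assume "x \<in> \<Union>\<D>"
          then obtain K where K1: "K \<in> \<D>" "x \<in> K" by blast
          then obtain n where "from_nat_into \<D> n = K" using from_nat_into_surj[OF D(1)] by blast
          then have "x \<in> ?A (Suc n)" using K1(2) by blast
          then show "x \<in> (\<Union>n. ?A n)" by blast
        qed
        show "(\<Union>n. ?A n) \<subseteq> \<Union>\<D>" using sub by blast
      qed
      have "emeasure ?m ?S \<le> emeasure ?m (\<Union>n. ?A n)"
        using D(6) As unfolding un[symmetric] by (intro emeasure_mono) (auto simp: un)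
      also have "\<dots> = (SUP n. emeasure ?m (?A n))"
      proof (intro SUP_emeasure_incseq[symmetric])
        show "incseq ?A" unfolding incseq_def by (intro allI impI Union_mono image_mono) auto
      qed (use As in auto)
      also have "\<dots> \<le> ennreal e" using fin sub by (intro SUP_least) auto
      finally show ?thesis .
    qed
  qed
  have "emeasure ?m (N \<inter> cbox (-real (Suc m)) (real (Suc m))) = 0" for m
    using small[of _ "Suc m"] by (metis ennreal_le_epsilon add_0 le_zero_eq zero_less_Suc)
  then have "(N \<inter> cbox (-real (Suc m)) (real (Suc m))) \<in> null_sets ?m" for m by auto
  then have "(\<Union>m. N \<inter> cbox (-real (Suc m)) (real (Suc m))) \<in> null_sets ?m" by (rule null_sets_UN)
  moreover have "N = (\<Union>m. N \<inter> cbox (-real (Suc m)) (real (Suc m)))"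
  proof -
    have "\<exists>m. x \<in> cbox (-real (Suc m)) (real (Suc m))" for x
    proof -
      obtain m where "\<bar>x\<bar> \<le> real m" using real_arch_simple by blast
      then show ?thesis by (intro exI[of _ m]) auto
    qed
    then show ?thesis by blast
  qed
  ultimately show "N \<in> null_sets ?m" by simp
qed

lemma mono_AC_is_integral:
  fixes F :: "real \<Rightarrow> real"
  assumes mono: "mono F" and AC: "AC_on_line F"
  shows "\<exists>g. \<forall>x y. x \<le> y \<longrightarrow> g absolutely_integrable_on {x..y} \<and> F y - F x = integral {x..y} g"
proof -
  let ?m = "interval_measure F"
  have cont: "continuous_on UNIV F" using AC by (rule AC_on_line_continuous)
  have Icc: "emeasure ?m {a..b} = ennreal (F b - F a)" if "a \<le> b" for a b
    using that mono cont by (intro emeasure_interval_measure_Icc) (auto simp: mono_def)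
  obtain h where h: "h \<in> borel_measurable lborel" "density lborel h = ?m"
    using sigma_finite_measure.Radon_Nikodym[OF sigma_finite_lborel AC_on_line_null_sets[OF mono AC]] by auto
  note [measurable] = h(1)[simplified]
  show ?thesis
  proof (intro exI[of _ "\<lambda>x. enn2real (h x)"] allI impI)
    fix x y :: real assume xy: "x \<le> y"
    have nn: "(\<integral>\<^sup>+t. h t * indicator {x..y} t \<partial>lborel) = ennreal (F y - F x)"
      using Icc[OF xy] emeasure_density[OF h(1), of "{x..y}"] h(2) by simp
    then have "AE t in lborel. h t * indicator {x..y} t \<noteq> \<infinity>"
      by (intro nn_integral_PInf_AE) auto
    then have "AE t in lborel. ennreal (indicator {x..y} t *\<^sub>R enn2real (h t)) = h t * indicator {x..y} t"
      by eventually_elim (auto simp: indicator_def top.not_eq_extremum)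
    then have nn': "(\<integral>\<^sup>+t. ennreal (indicator {x..y} t *\<^sub>R enn2real (h t)) \<partial>lborel) = ennreal (F y - F x)"
      using nn nn_integral_cong_AE by metis
    have "has_bochner_integral lborel (\<lambda>t. indicator {x..y} t *\<^sub>R enn2real (h t)) (F y - F x)"
      using monoD[OF mono xy] by (intro has_bochner_integral_nn_integral nn') auto
    then have b: "integrable lborel (\<lambda>t. indicator {x..y} t *\<^sub>R enn2real (h t))"
        "(LINT t|lborel. indicator {x..y} t *\<^sub>R enn2real (h t)) = F y - F x"
      by (auto simp: has_bochner_integral_iff)
    have i: "(\<lambda>t. enn2real (h t)) absolutely_integrable_on {x..y}"
      unfolding set_integrable_def using b(1) by (subst integrable_completion) auto
    moreover have "(LINT t:{x..y}|lebesgue. enn2real (h t)) = F y - F x"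
      unfolding set_lebesgue_integral_def using b(2) by (subst integral_completion) auto
    ultimately show "(\<lambda>t. enn2real (h t)) absolutely_integrable_on {x..y} \<and> F y - F x = integral {x..y} (\<lambda>t. enn2real (h t))"
      using set_lebesgue_integral_eq_integral(2)[OF i] by simp
  qed
qed

lemma abs_cont_on_finite_family:
  assumes "\<forall>(n::nat) (u::nat \<Rightarrow> real) (v::nat \<Rightarrow> real).
        (\<forall>i<n. a \<le> u i \<and> u i \<le> v i \<and> v i \<le> b) \<longrightarrow>
        (\<forall>i<n. \<forall>j<n. i \<noteq> j \<longrightarrow> {u i<..<v i} \<inter> {u j<..<v j} = {}) \<longrightarrow>
        (\<Sum>i<n. v i - u i) < d \<longrightarrow>
        (\<Sum>i<n. norm (f (v i) - f (u i))) < e"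
    and I: "nonoverlapping I u v" and ab: "\<And>i. i \<in> I \<Longrightarrow> a \<le> u i \<and> v i \<le> b"
    and d: "(\<Sum>i\<in>I. v i - u i) < d"
  shows "(\<Sum>i\<in>I. norm (f (v i) - f (u i))) < e"
proof -
  have "finite I" using I unfolding nonoverlapping_def by simp
  then obtain h where h: "bij_betw h {..<card I} I"
    using ex_bij_betw_nat_finite[of I] by (auto simp: lessThan_atLeast0)
  have J: "nonoverlapping {..<card I} (u \<circ> h) (v \<circ> h)" by (rule nonoverlapping_reindex[OF I h])
  have mem: "h i \<in> I" if "i < card I" for i using h that bij_betwE by blast
  have 1: "\<forall>i<card I. a \<le> (u \<circ> h) i \<and> (u \<circ> h) i \<le> (v \<circ> h) i \<and> (v \<circ> h) i \<le> b"
    using J ab mem unfolding nonoverlapping_def by auto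
  have 2: "\<forall>i<card I. \<forall>j<card I. i \<noteq> j \<longrightarrow> {(u \<circ> h) i<..<(v \<circ> h) i} \<inter> {(u \<circ> h) j<..<(v \<circ> h) j} = {}"
    using J unfolding nonoverlapping_def by simp
  have 3: "(\<Sum>i<card I. (v \<circ> h) i - (u \<circ> h) i) < d"
    using d sum.reindex_bij_betw[OF h, of "\<lambda>i. v i - u i"] by simp
  have "(\<Sum>i<card I. norm (f ((v \<circ> h) i) - f ((u \<circ> h) i))) < e"
    using assms(1)[THEN spec, THEN spec, THEN spec, THEN mp, THEN mp, THEN mp, OF 1 2 3] .
  then show ?thesis
    using sum.reindex_bij_betw[OF h, of "\<lambda>i. norm (f (v i) - f (u i))"] by simp
qed

text \<open>Composition with this map extends a function from \<open>[a,b]\<close> to the line by constants, without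
lengthening any interval.\<close>

definition clamp_to :: "real \<Rightarrow> real \<Rightarrow> real \<Rightarrow> real" where
  "clamp_to a b x = max a (min b x)"

lemma nonoverlapping_clamp:
  assumes "nonoverlapping I u v" "a \<le> b"
  shows "nonoverlapping I (\<lambda>i. clamp_to a b (u i)) (\<lambda>i. clamp_to a b (v i))"
proof -
  have sub: "{clamp_to a b x<..<clamp_to a b y} \<subseteq> {x<..<y}" for x y
    using assms(2) by (auto simp: clamp_to_def)
  have mono: "clamp_to a b x \<le> clamp_to a b y" if "x \<le> y" for x y
    using that by (auto simp: clamp_to_def)
  show ?thesis
    unfolding nonoverlapping_def
  proof (intro conjI ballI impI)
    show "finite I" using assms(1) by (simp add: nonoverlapping_def)
    show "clamp_to a b (u i) \<le> clamp_to a b (v i)" if "i \<in> I" for i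
      using assms(1) that mono by (simp add: nonoverlapping_def)
    fix i j assume "i \<in> I" "j \<in> I" "i \<noteq> j"
    then have "{u i<..<v i} \<inter> {u j<..<v j} = {}" using assms(1) by (simp add: nonoverlapping_def)
    then show "{clamp_to a b (u i)<..<clamp_to a b (v i)} \<inter> {clamp_to a b (u j)<..<clamp_to a b (v j)} = {}"
      using sub[of "u i" "v i"] sub[of "u j" "v j"] by blast
  qed
qed

lemma clamp_to_bounds: "a \<le> b \<Longrightarrow> a \<le> clamp_to a b x \<and> clamp_to a b x \<le> b"
  by (auto simp: clamp_to_def)

lemma AC_on_line_clamp:
  assumes f: "abs_cont_on a b f" and ab: "a \<le> b"
  shows "AC_on_line (\<lambda>x. f (clamp_to a b x))"
  unfolding AC_on_line_def
proof (intro allI impI)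
  fix e :: real assume e: "0 < e"
  obtain d where d: "0 < d" and D: "\<forall>(n::nat) (u::nat \<Rightarrow> real) (v::nat \<Rightarrow> real).
        (\<forall>i<n. a \<le> u i \<and> u i \<le> v i \<and> v i \<le> b) \<longrightarrow>
        (\<forall>i<n. \<forall>j<n. i \<noteq> j \<longrightarrow> {u i<..<v i} \<inter> {u j<..<v j} = {}) \<longrightarrow>
        (\<Sum>i<n. v i - u i) < d \<longrightarrow>
        (\<Sum>i<n. norm (f (v i) - f (u i))) < e"
    using f[unfolded abs_cont_on_def, THEN spec, THEN mp, OF e] by (elim exE conjE)
  show "\<exists>d>0. \<forall>(I::nat set) u v. nonoverlapping I u v \<longrightarrow> (\<Sum>i\<in>I. v i - u i) < d \<longrightarrow>
          (\<Sum>i\<in>I. norm (f (clamp_to a b (v i)) - f (clamp_to a b (u i)))) < e"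
  proof (intro exI[of _ d] conjI allI impI d)
    fix I :: "nat set" and u v
    assume I: "nonoverlapping I u v" and s: "(\<Sum>i\<in>I. v i - u i) < d"
    have "(\<Sum>i\<in>I. clamp_to a b (v i) - clamp_to a b (u i)) \<le> (\<Sum>i\<in>I. v i - u i)"
      using I unfolding nonoverlapping_def by (intro sum_mono) (auto simp: clamp_to_def max_def min_def)
    then show "(\<Sum>i\<in>I. norm (f (clamp_to a b (v i)) - f (clamp_to a b (u i)))) < e"
      using s clamp_to_bounds[OF ab]
      by (intro abs_cont_on_finite_family[OF D nonoverlapping_clamp[OF I ab]]) auto
  qed
qed

definition variation_upto :: "(real \<Rightarrow> complex) \<Rightarrow> real \<Rightarrow> real" where
  "variation_upto f x = Sup {s. \<exists>(I::nat set) u v. nonoverlapping I u v \<and> (\<forall>i\<in>I. v i \<le> x) \<and>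
     s = (\<Sum>i\<in>I. norm (f (v i) - f (u i)))}"

lemma variation_upto_upper:
  assumes B: "\<forall>(I::nat set) u v. nonoverlapping I u v \<longrightarrow> (\<Sum>i\<in>I. norm (f (v i) - f (u i))) \<le> B"
    and I: "nonoverlapping (I::nat set) u v" "\<And>i. i \<in> I \<Longrightarrow> v i \<le> x"
  shows "(\<Sum>i\<in>I. norm (f (v i) - f (u i))) \<le> variation_upto f x"
  unfolding variation_upto_def
proof (rule cSup_upper)
  show "bdd_above {s. \<exists>(I::nat set) u v. nonoverlapping I u v \<and> (\<forall>i\<in>I. v i \<le> x) \<and>
     s = (\<Sum>i\<in>I. norm (f (v i) - f (u i)))}"
  proof (rule bdd_aboveI[of _ B])
    fix s assume "s \<in> {s. \<exists>(I::nat set) u v. nonoverlapping I u v \<and> (\<forall>i\<in>I. v i \<le> x) \<and>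
     s = (\<Sum>i\<in>I. norm (f (v i) - f (u i)))}"
    then obtain I' :: "nat set" and u' v' where s: "nonoverlapping I' u' v'" "s = (\<Sum>i\<in>I'. norm (f (v' i) - f (u' i)))"
      unfolding mem_Collect_eq by (elim exE conjE)
    show "s \<le> B" using B[THEN spec, THEN spec, THEN spec, THEN mp, OF s(1)] s(2) by simp
  qed
  show "(\<Sum>i\<in>I. norm (f (v i) - f (u i))) \<in> {s. \<exists>(I::nat set) u v. nonoverlapping I u v \<and> (\<forall>i\<in>I. v i \<le> x) \<and>
     s = (\<Sum>i\<in>I. norm (f (v i) - f (u i)))}"
    unfolding mem_Collect_eq using I by (intro exI conjI) auto
qed

lemma variation_upto_approx:
  assumes "0 < \<eta>"
  obtains I :: "nat set" and u v where "nonoverlapping I u v" "\<forall>i\<in>I. v i \<le> x"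
    "variation_upto f x - \<eta> < (\<Sum>i\<in>I. norm (f (v i) - f (u i)))"
proof -
  let ?S = "{s. \<exists>(I::nat set) u v. nonoverlapping I u v \<and> (\<forall>i\<in>I. v i \<le> x) \<and>
     s = (\<Sum>i\<in>I. norm (f (v i) - f (u i)))}"
  have "0 \<in> ?S"
    by (simp, rule exI[of _ "{}"]) (simp add: nonoverlapping_def)
  then have ne: "?S \<noteq> {}" by blast
  have lt: "variation_upto f x - \<eta> < Sup ?S" using assms unfolding variation_upto_def by simp
  obtain s where s: "s \<in> ?S" "variation_upto f x - \<eta> < s"
    using less_cSupD[OF ne lt] by (elim bexE)
  obtain I :: "nat set" and u v where "nonoverlapping I u v" "\<forall>i\<in>I. v i \<le> x" "s = (\<Sum>i\<in>I. norm (f (v i) - f (u i)))"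
    using s(1) unfolding mem_Collect_eq by (elim exE conjE)
  then show thesis using that[of I u v] s(2) by simp
qed

lemma variation_upto_increment_ge:
  assumes B: "\<forall>(I::nat set) u v. nonoverlapping I u v \<longrightarrow> (\<Sum>i\<in>I. norm (f (v i) - f (u i))) \<le> B"
    and xy: "x \<le> y"
  shows "norm (f y - f x) \<le> variation_upto f y - variation_upto f x"
proof (rule field_le_epsilon)
  fix \<eta> :: real assume "0 < \<eta>"
  then obtain I :: "nat set" and u v where I: "nonoverlapping I u v" "\<forall>i\<in>I. v i \<le> x"
    "variation_upto f x - \<eta> < (\<Sum>i\<in>I. norm (f (v i) - f (u i)))"
    by (rule variation_upto_approx)
  have fin: "finite I" using I(1) by (simp add: nonoverlapping_def)
  obtain k where k: "k \<notin> I" using ex_new_if_finite[OF infinite_UNIV_nat fin] by blast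
  let ?u = "u(k := x)" and ?v = "v(k := y)"
  have "nonoverlapping (insert k I) ?u ?v"
    unfolding nonoverlapping_def
  proof (intro conjI ballI impI)
    show "finite (insert k I)" using fin by simp
    show "?u i \<le> ?v i" if "i \<in> insert k I" for i using that I(1) xy by (auto simp: nonoverlapping_def)
    fix i j assume ij: "i \<in> insert k I" "j \<in> insert k I" "i \<noteq> j"
    have *: "{u m<..<v m} \<inter> {x<..<y} = {}" if "m \<in> I" for m
      using I(2) that by (force simp: disjoint_iff)
    show "{?u i<..<?v i} \<inter> {?u j<..<?v j} = {}"
    proof (cases "i = k")
      case True then show ?thesis using ij *[of j] by auto
    next
      case False
      then have "i \<in> I" using ij by simp
      show ?thesis
      proof (cases "j = k")
        case True then show ?thesis using False *[OF \<open>i \<in> I\<close>] by simp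
      next
        case False2: False
        then have "j \<in> I" using ij by simp
        then show ?thesis using \<open>i \<in> I\<close> False False2 ij(3) I(1) by (simp add: nonoverlapping_def)
      qed
    qed
  qed
  note no = this
  have vle: "?v i \<le> y" if "i \<in> insert k I" for i
  proof (cases "i = k")
    case False
    then have "v i \<le> x" using that I(2) by simp
    then show ?thesis using False xy by simp
  qed simp
  have "(\<Sum>i\<in>insert k I. norm (f (?v i) - f (?u i))) \<le> variation_upto f y"
    by (rule variation_upto_upper[OF B no vle])
  moreover have "(\<Sum>i\<in>insert k I. norm (f (?v i) - f (?u i))) = norm (f y - f x) + (\<Sum>i\<in>I. norm (f (v i) - f (u i)))"
    using k fin by (subst sum.insert) (auto intro!: sum.cong)
  ultimately show "norm (f y - f x) \<le> variation_upto f y - variation_upto f x + \<eta>" using I(3) by linarith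
qed

text \<open>Cut each interval of a nearly optimal family below \<open>y\<close> at the point \<open>x\<close>. The pieces to the left of \<open>x\<close>
contribute at most the variation up to \<open>x\<close>, so those to the right carry almost all of the increment.\<close>

lemma variation_upto_increment_approx:
  assumes B: "\<forall>(I::nat set) u v. nonoverlapping I u v \<longrightarrow> (\<Sum>i\<in>I. norm (f (v i) - f (u i))) \<le> B"
    and xy: "x \<le> y" and eta: "0 < \<eta>"
  shows "\<exists>(I::nat set) u v. nonoverlapping I u v \<and> (\<forall>i\<in>I. x \<le> u i \<and> v i \<le> y) \<and>
    variation_upto f y - variation_upto f x - \<eta> < (\<Sum>i\<in>I. norm (f (v i) - f (u i)))"
proof -
  obtain I :: "nat set" and u v where I: "nonoverlapping I u v" "\<forall>i\<in>I. v i \<le> y"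
    "variation_upto f y - \<eta> < (\<Sum>i\<in>I. norm (f (v i) - f (u i)))"
    using eta by (rule variation_upto_approx)
  have uv: "u i \<le> v i" if "i \<in> I" for i using I(1) that by (simp add: nonoverlapping_def)
  have dj: "{u i<..<v i} \<inter> {u j<..<v j} = {}" if "i \<in> I" "j \<in> I" "i \<noteq> j" for i j
    using I(1) that by (simp add: nonoverlapping_def)
  have fin: "finite I" using I(1) by (simp add: nonoverlapping_def)
  have s1: "{min x s<..<min x t} \<subseteq> {s<..<t}" and s2: "{max x s<..<max x t} \<subseteq> {s<..<t}" for s t :: real by auto
  have L: "nonoverlapping I (\<lambda>i. min x (u i)) (\<lambda>i. min x (v i))"
    unfolding nonoverlapping_def
  proof (intro conjI ballI impI fin)
    show "min x (u i) \<le> min x (v i)" if "i \<in> I" for i using uv[OF that] by auto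
    show "{min x (u i)<..<min x (v i)} \<inter> {min x (u j)<..<min x (v j)} = {}" if "i \<in> I" "j \<in> I" "i \<noteq> j" for i j
      using dj[OF that] s1[of "u i" "v i"] s1[of "u j" "v j"] by blast
  qed
  have R: "nonoverlapping I (\<lambda>i. max x (u i)) (\<lambda>i. max x (v i))"
    unfolding nonoverlapping_def
  proof (intro conjI ballI impI fin)
    show "max x (u i) \<le> max x (v i)" if "i \<in> I" for i using uv[OF that] by auto
    show "{max x (u i)<..<max x (v i)} \<inter> {max x (u j)<..<max x (v j)} = {}" if "i \<in> I" "j \<in> I" "i \<noteq> j" for i j
      using dj[OF that] s2[of "u i" "v i"] s2[of "u j" "v j"] by blast
  qed
  have Lle: "(\<Sum>i\<in>I. norm (f (min x (v i)) - f (min x (u i)))) \<le> variation_upto f x"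
    by (rule variation_upto_upper[OF B L]) auto
  have "(\<Sum>i\<in>I. norm (f (v i) - f (u i))) \<le>
     (\<Sum>i\<in>I. norm (f (min x (v i)) - f (min x (u i))) + norm (f (max x (v i)) - f (max x (u i))))"
  proof (rule sum_mono)
    fix i assume "i \<in> I"
    then have "u i \<le> v i" by (rule uv)
    then have "f (v i) - f (u i) = (f (min x (v i)) - f (min x (u i))) + (f (max x (v i)) - f (max x (u i)))"
      by (auto simp: min_def max_def)
    then show "norm (f (v i) - f (u i)) \<le> norm (f (min x (v i)) - f (min x (u i))) + norm (f (max x (v i)) - f (max x (u i)))"
      by (metis norm_triangle_ineq)
  qed
  then have "variation_upto f y - variation_upto f x - \<eta> < (\<Sum>i\<in>I. norm (f (max x (v i)) - f (max x (u i))))"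
    using I(3) Lle by (simp add: sum.distrib)
  moreover have "\<forall>i\<in>I. x \<le> max x (u i) \<and> max x (v i) \<le> y" using I(2) xy by auto
  ultimately show ?thesis using R
    by (intro exI[of _ I] exI[of _ "\<lambda>i. max x (u i)"] exI[of _ "\<lambda>i. max x (v i)"] conjI)
qed

text \<open>Replace every interval of a family by a nearly optimal family inside it; the union of these
families is again short, and its increments of \<open>f\<close> nearly add up to the increments of the variation.\<close>

lemma AC_on_line_variation_upto:
  assumes B: "\<forall>(I::nat set) u v. nonoverlapping I u v \<longrightarrow> (\<Sum>i\<in>I. norm (f (v i) - f (u i))) \<le> B"
    and f: "AC_on_line f"
  shows "AC_on_line (variation_upto f)"
  unfolding AC_on_line_def
proof (intro allI impI)
  fix e :: real assume e: "0 < e"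
  then have "0 < e / 2" by simp
  from AC_on_lineD[where 'i="nat\<times>nat", OF f this] obtain d where d: "0 < d"
    "\<forall>(I::(nat\<times>nat) set) u v. nonoverlapping I u v \<longrightarrow>
     (\<Sum>i\<in>I. v i - u i) < d \<longrightarrow> (\<Sum>i\<in>I. norm (f (v i) - f (u i))) < e / 2"
    by (elim exE conjE)
  let ?V = "variation_upto f"
  show "\<exists>d>0. \<forall>(I::nat set) u v. nonoverlapping I u v \<longrightarrow> (\<Sum>i\<in>I. v i - u i) < d \<longrightarrow>
          (\<Sum>i\<in>I. norm (?V (v i) - ?V (u i))) < e"
  proof (intro exI[of _ d] conjI allI impI d(1))
    fix I :: "nat set" and u v
    assume I: "nonoverlapping I u v" and s: "(\<Sum>i\<in>I. v i - u i) < d"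
    have fin: "finite I" and uv: "\<And>i. i \<in> I \<Longrightarrow> u i \<le> v i"
      using I by (auto simp: nonoverlapping_def)
    define \<eta> where "\<eta> = e / (2 * (real (card I) + 1))"
    have eta: "0 < \<eta>" using e by (simp add: \<eta>_def)
    define Q where "Q i t \<longleftrightarrow> nonoverlapping (fst t) (fst (snd t)) (snd (snd t)) \<and>
        (\<forall>j\<in>fst t. u i \<le> fst (snd t) j \<and> snd (snd t) j \<le> v i) \<and>
        ?V (v i) - ?V (u i) - \<eta> < (\<Sum>j\<in>fst t. norm (f (snd (snd t) j) - f (fst (snd t) j)))"
      for i and t :: "nat set \<times> (nat \<Rightarrow> real) \<times> (nat \<Rightarrow> real)"
    have Qex: "\<exists>t. Q i t" if i: "i \<in> I" for i
    proof -
      obtain J :: "nat set" and u' v' where "nonoverlapping J u' v' \<and> (\<forall>j\<in>J. u i \<le> u' j \<and> v' j \<le> v i) \<and>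
        ?V (v i) - ?V (u i) - \<eta> < (\<Sum>j\<in>J. norm (f (v' j) - f (u' j)))"
        using variation_upto_increment_approx[OF B uv[OF i] eta] by (elim exE)
      then have "Q i (J, u', v')" unfolding Q_def by simp
      then show ?thesis ..
    qed
    define J where "J i = fst (SOME t. Q i t)" for i
    define u' where "u' i = fst (snd (SOME t. Q i t))" for i
    define v' where "v' i = snd (snd (SOME t. Q i t))" for i
    have J: "nonoverlapping (J i) (u' i) (v' i) \<and> (\<forall>j\<in>J i. u i \<le> u' i j \<and> v' i j \<le> v i) \<and>
      ?V (v i) - ?V (u i) - \<eta> < (\<Sum>j\<in>J i. norm (f (v' i j) - f (u' i j)))" if "i \<in> I" for i
      using someI_ex[OF Qex[OF that]] unfolding Q_def J_def u'_def v'_def .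
    let ?K = "Sigma I J" and ?u = "\<lambda>(i,j). u' i j" and ?v = "\<lambda>(i,j). v' i j"
    have Jfin: "\<forall>i\<in>I. finite (J i)" using J by (auto simp: nonoverlapping_def)
    have no: "nonoverlapping ?K ?u ?v"
      unfolding nonoverlapping_def
    proof (intro conjI ballI impI)
      show "finite ?K" using fin Jfin by auto
      show "?u p \<le> ?v p" if "p \<in> ?K" for p using that J by (auto simp: nonoverlapping_def)
      fix p p' assume p: "p \<in> ?K" "p' \<in> ?K" "p \<noteq> p'"
      obtain i j i' j' where ij: "p = (i,j)" "p' = (i',j')" by fastforce
      have m: "i \<in> I" "j \<in> J i" "i' \<in> I" "j' \<in> J i'" using p ij by auto
      show "{?u p<..<?v p} \<inter> {?u p'<..<?v p'} = {}"
      proof (cases "i = i'")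
        case True
        then have "j \<noteq> j'" using p ij by auto
        then show ?thesis using J[OF m(1)] m True unfolding ij by (simp add: nonoverlapping_def)
      next
        case False
        have "{u i<..<v i} \<inter> {u i'<..<v i'} = {}" using I m False by (simp add: nonoverlapping_def)
        moreover have "{?u p<..<?v p} \<subseteq> {u i<..<v i}" using J[OF m(1)] m unfolding ij by force
        moreover have "{?u p'<..<?v p'} \<subseteq> {u i'<..<v i'}" using J[OF m(3)] m unfolding ij by force
        ultimately show ?thesis by blast
      qed
    qed
    have "(\<Sum>p\<in>?K. ?v p - ?u p) = (\<Sum>i\<in>I. \<Sum>j\<in>J i. v' i j - u' i j)"
      using sum.Sigma[OF fin Jfin, of "\<lambda>i j. v' i j - u' i j"] by (simp add: case_prod_unfold)
    also have "\<dots> \<le> (\<Sum>i\<in>I. v i - u i)"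
    proof (rule sum_mono)
      fix i assume i: "i \<in> I"
      have "(\<Sum>j\<in>J i. v' i j - u' i j) \<le> measure lebesgue {u i..v i}"
        using J[OF i] by (intro nonoverlapping_total_length_le) force+
      then show "(\<Sum>j\<in>J i. v' i j - u' i j) \<le> v i - u i" using uv[OF i] by simp
    qed
    finally have "(\<Sum>p\<in>?K. ?v p - ?u p) < d" using s by linarith
    then have "(\<Sum>p\<in>?K. norm (f (?v p) - f (?u p))) < e / 2"
      by (rule d(2)[THEN spec, THEN spec, THEN spec, THEN mp, THEN mp, OF no])
    then have lt: "(\<Sum>i\<in>I. \<Sum>j\<in>J i. norm (f (v' i j) - f (u' i j))) < e / 2"
      using sum.Sigma[OF fin Jfin, of "\<lambda>i j. norm (f (v' i j) - f (u' i j))"] by (simp add: case_prod_unfold)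
    have "(\<Sum>i\<in>I. norm (?V (v i) - ?V (u i))) \<le> (\<Sum>i\<in>I. (\<Sum>j\<in>J i. norm (f (v' i j) - f (u' i j))) + \<eta>)"
    proof (rule sum_mono)
      fix i assume i: "i \<in> I"
      have "0 \<le> ?V (v i) - ?V (u i)"
        using order_trans[OF norm_ge_zero variation_upto_increment_ge[OF B uv[OF i]]] .
      then show "norm (?V (v i) - ?V (u i)) \<le> (\<Sum>j\<in>J i. norm (f (v' i j) - f (u' i j))) + \<eta>"
        using J[OF i] by simp
    qed
    also have "\<dots> = (\<Sum>i\<in>I. \<Sum>j\<in>J i. norm (f (v' i j) - f (u' i j))) + real (card I) * \<eta>"
      by (simp add: sum.distrib)
    also have "real (card I) * \<eta> \<le> e / 2" using e by (simp add: \<eta>_def field_simps)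
    finally show "(\<Sum>i\<in>I. norm (?V (v i) - ?V (u i))) < e" using lt by linarith
  qed
qed

lemma AC_on_line_dominated:
  assumes V: "AC_on_line V" and F: "AC_on_line F"
    and le: "\<And>x y. norm (W y - W x) \<le> norm (V y - V x) + norm (F y - F x)"
  shows "AC_on_line W"
  unfolding AC_on_line_def
proof (intro allI impI)
  fix e :: real assume "0 < e"
  then have e: "0 < e / 2" by simp
  obtain d1 where d1: "0 < d1" "\<And>(I::nat set) u v. nonoverlapping I u v \<Longrightarrow>
     (\<Sum>i\<in>I. v i - u i) < d1 \<Longrightarrow> (\<Sum>i\<in>I. norm (V (v i) - V (u i))) < e / 2"
    using V[unfolded AC_on_line_def, THEN spec, THEN mp, OF e] by blast
  obtain d2 where d2: "0 < d2" "\<And>(I::nat set) u v. nonoverlapping I u v \<Longrightarrow>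
     (\<Sum>i\<in>I. v i - u i) < d2 \<Longrightarrow> (\<Sum>i\<in>I. norm (F (v i) - F (u i))) < e / 2"
    using F[unfolded AC_on_line_def, THEN spec, THEN mp, OF e] by blast
  show "\<exists>d>0. \<forall>(I::nat set) u v. nonoverlapping I u v \<longrightarrow> (\<Sum>i\<in>I. v i - u i) < d \<longrightarrow>
          (\<Sum>i\<in>I. norm (W (v i) - W (u i))) < e"
  proof (intro exI[of _ "min d1 d2"] conjI allI impI)
    fix I :: "nat set" and u v
    assume I: "nonoverlapping I u v" and s: "(\<Sum>i\<in>I. v i - u i) < min d1 d2"
    have "(\<Sum>i\<in>I. norm (W (v i) - W (u i))) \<le> (\<Sum>i\<in>I. norm (V (v i) - V (u i)) + norm (F (v i) - F (u i)))"
      by (rule sum_mono) (rule le)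
    also have "\<dots> = (\<Sum>i\<in>I. norm (V (v i) - V (u i))) + (\<Sum>i\<in>I. norm (F (v i) - F (u i)))"
      by (rule sum.distrib)
    also have "\<dots> < e / 2 + e / 2" using d1(2)[OF I] d2(2)[OF I] s by (intro add_strict_mono) auto
    finally show "(\<Sum>i\<in>I. norm (W (v i) - W (u i))) < e" by simp
  qed (use d1 d2 in auto)
qed

text \<open>The variation dominates the increments of the real and imaginary part of \<open>F\<close>, so each of them is a difference
of two monotone absolutely continuous functions.\<close>

lemma AC_on_line_bounded_variation_is_integral:
  fixes F :: "real \<Rightarrow> complex"
  assumes F: "AC_on_line F"
    and B: "\<forall>(I::nat set) u v. nonoverlapping I u v \<longrightarrow> (\<Sum>i\<in>I. norm (F (v i) - F (u i))) \<le> B"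
  shows "\<exists>g. \<forall>x y. x \<le> y \<longrightarrow> g absolutely_integrable_on {x..y} \<and> F y - F x = integral {x..y} g"
proof -
  let ?V = "variation_upto F"
  have inc: "norm (F y - F x) \<le> ?V y - ?V x" if "x \<le> y" for x y
    by (rule variation_upto_increment_ge[OF B that])
  have V: "AC_on_line ?V" by (rule AC_on_line_variation_upto[OF B F])
  have mV: "mono ?V"
  proof (rule monoI)
    fix x y :: real assume "x \<le> y"
    then show "?V x \<le> ?V y" using order_trans[OF norm_ge_zero inc] by auto
  qed
  obtain g0 where g0: "\<And>x y. x \<le> y \<Longrightarrow> g0 absolutely_integrable_on {x..y} \<and> ?V y - ?V x = integral {x..y} g0"
    using mono_AC_is_integral[OF mV V] by blast
  have part: "\<exists>g. \<forall>x y. x \<le> y \<longrightarrow> g absolutely_integrable_on {x..y} \<and> r (F y) - r (F x) = integral {x..y} g"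
    if r: "\<And>z w. r (z - w) = r z - r w" "\<And>z. \<bar>r z\<bar> \<le> norm z" for r :: "complex \<Rightarrow> real"
  proof -
    let ?W = "\<lambda>x. ?V x - r (F x)"
    have rle: "\<bar>r (F y) - r (F x)\<bar> \<le> norm (F y - F x)" for x y using r(2)[of "F y - F x"] r(1) by simp
    have mW: "mono ?W"
    proof (rule monoI)
      fix x y :: real assume "x \<le> y"
      then show "?W x \<le> ?W y" using inc[of x y] rle[of y x] by linarith
    qed
    have "norm (?W y - ?W x) \<le> norm (?V y - ?V x) + norm (F y - F x)" for x y
      using rle[of y x] unfolding real_norm_def by linarith
    then have "AC_on_line ?W" by (rule AC_on_line_dominated[OF V F])
    then obtain g1 where g1: "\<And>x y. x \<le> y \<Longrightarrow> g1 absolutely_integrable_on {x..y} \<and> ?W y - ?W x = integral {x..y} g1"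
      using mono_AC_is_integral[OF mW] by blast
    show ?thesis
    proof (intro exI[of _ "\<lambda>t. g0 t - g1 t"] allI impI conjI)
      fix x y :: real assume xy: "x \<le> y"
      show "(\<lambda>t. g0 t - g1 t) absolutely_integrable_on {x..y}"
        using g0[OF xy] g1[OF xy] by (intro set_integral_diff(1)) auto
      show "r (F y) - r (F x) = integral {x..y} (\<lambda>t. g0 t - g1 t)"
        using g0[OF xy] g1[OF xy] by (subst integral_diff) (auto dest: set_lebesgue_integral_eq_integral(1))
    qed
  qed
  obtain gr where gr: "\<And>x y. x \<le> y \<Longrightarrow> gr absolutely_integrable_on {x..y} \<and> Re (F y) - Re (F x) = integral {x..y} gr"
    using part[of Re] abs_Re_le_cmod by auto
  obtain gi where gi: "\<And>x y. x \<le> y \<Longrightarrow> gi absolutely_integrable_on {x..y} \<and> Im (F y) - Im (F x) = integral {x..y} gi"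
    using part[of Im] abs_Im_le_cmod by auto
  show ?thesis
  proof (intro exI[of _ "\<lambda>t. complex_of_real (gr t) + \<i> * complex_of_real (gi t)"] allI impI)
    fix x y :: real assume xy: "x \<le> y"
    have 1: "(\<lambda>t. complex_of_real (gr t)) absolutely_integrable_on {x..y}"
      using absolutely_integrable_linear[OF _ bounded_linear_of_real] gr[OF xy] by (auto simp: o_def)
    have 2: "(\<lambda>t. \<i> * complex_of_real (gi t)) absolutely_integrable_on {x..y}"
    proof -
      have "(\<lambda>t. complex_of_real (gi t)) absolutely_integrable_on {x..y}"
        using absolutely_integrable_linear[OF _ bounded_linear_of_real] gi[OF xy] by (auto simp: o_def)
      then show ?thesis
        using absolutely_integrable_linear[OF _ bounded_linear_mult_right[of \<i>]] by (auto simp: o_def)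
    qed
    have "((\<lambda>t. complex_of_real (gr t)) has_integral of_real (Re (F y) - Re (F x))) {x..y}"
      using gr[OF xy] by (intro has_integral_of_real) (auto dest: set_lebesgue_integral_eq_integral(1) simp: has_integral_integrable_integral)
    moreover have "((\<lambda>t. \<i> * complex_of_real (gi t)) has_integral \<i> * of_real (Im (F y) - Im (F x))) {x..y}"
      using gi[OF xy] by (intro has_integral_mult_right has_integral_of_real) (auto dest: set_lebesgue_integral_eq_integral(1) simp: has_integral_integrable_integral)
    ultimately have "((\<lambda>t. complex_of_real (gr t) + \<i> * complex_of_real (gi t)) has_integral
        of_real (Re (F y) - Re (F x)) + \<i> * of_real (Im (F y) - Im (F x))) {x..y}" by (rule has_integral_add)
    moreover have "of_real (Re (F y) - Re (F x)) + \<i> * of_real (Im (F y) - Im (F x)) = F y - F x"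
      by (simp add: complex_eq_iff)
    ultimately show "(\<lambda>t. complex_of_real (gr t) + \<i> * complex_of_real (gi t)) absolutely_integrable_on {x..y} \<and>
       F y - F x = integral {x..y} (\<lambda>t. complex_of_real (gr t) + \<i> * complex_of_real (gi t))"
      using set_integral_add(1)[OF 1 2] by (simp add: integral_unique)
  qed
qed

text \<open>On an interval that is short enough, the variation is finite simply because all families of intervals are
short. There \<open>f\<close> is an integral, hence differentiable almost everywhere with the integrand as its
derivative; this identifies the integrand independently of the interval, and the local
representations can be glued.\<close>

theorem AC_loc_is_integral:
  assumes f: "f \<in> AC_loc" and ab: "a \<le> b"
  shows "(\<lambda>t. vector_derivative f (at t)) absolutely_integrable_on {a..b} \<and>
    f b - f a = integral {a..b} (\<lambda>t. vector_derivative f (at t))"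
proof -
  let ?v = "\<lambda>t. vector_derivative f (at t)"
  show ?thesis using ab
  proof (induct rule: Bolzano)
    case (trans a b c)
    have un: "{a..b} \<union> {b..c} = {a..c}" using trans by auto
    have i: "?v absolutely_integrable_on {a..c}"
      using set_integrable_Un[of lebesgue "{a..b}" ?v "{b..c}"] trans unfolding un by auto
    then have "?v integrable_on {a..c}" by (rule set_lebesgue_integral_eq_integral(1))
    from Henstock_Kurzweil_Integration.integral_combine[OF trans(3,4) this] show ?case using i trans by (simp add: algebra_simps)
  next
    case (local x)
    have "abs_cont_on (x - 1) (x + 1) f" using f by (simp add: AC_loc_def)
    from this[unfolded abs_cont_on_def, THEN spec, THEN mp, OF zero_less_one]
    obtain d where d: "0 < d" and D: "\<forall>(n::nat) (u::nat \<Rightarrow> real) (v::nat \<Rightarrow> real).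
        (\<forall>i<n. x - 1 \<le> u i \<and> u i \<le> v i \<and> v i \<le> x + 1) \<longrightarrow>
        (\<forall>i<n. \<forall>j<n. i \<noteq> j \<longrightarrow> {u i<..<v i} \<inter> {u j<..<v j} = {}) \<longrightarrow>
        (\<Sum>i<n. v i - u i) < d \<longrightarrow>
        (\<Sum>i<n. norm (f (v i) - f (u i))) < 1" by (elim exE conjE)
    have "?v absolutely_integrable_on {a..b} \<and> f b - f a = integral {a..b} ?v"
      if "a \<le> x \<and> x \<le> b \<and> b - a < min d 1" for a b
    proof -
      from that have ab: "a \<le> b" "b - a < d" "x - 1 \<le> a" "b \<le> x + 1" by auto
      let ?F = "\<lambda>t. f (clamp_to a b t)"
      have F: "AC_on_line ?F" using f ab(1) by (intro AC_on_line_clamp) (auto simp: AC_loc_def)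
      have B: "\<forall>(I::nat set) u v. nonoverlapping I u v \<longrightarrow> (\<Sum>i\<in>I. norm (?F (v i) - ?F (u i))) \<le> 1"
      proof (intro allI impI)
        fix I :: "nat set" and u v assume I: "nonoverlapping I u v"
        show "(\<Sum>i\<in>I. norm (?F (v i) - ?F (u i))) \<le> 1"
      proof (rule less_imp_le, rule abs_cont_on_finite_family[OF D nonoverlapping_clamp[OF I ab(1)]])
        show "x - 1 \<le> clamp_to a b (u i) \<and> clamp_to a b (v i) \<le> x + 1" for i
          using clamp_to_bounds[OF ab(1), of "u i"] clamp_to_bounds[OF ab(1), of "v i"] ab by auto
        have "(\<Sum>i\<in>I. clamp_to a b (v i) - clamp_to a b (u i)) \<le> measure lebesgue {a..b}"
        proof (rule nonoverlapping_total_length_le[OF nonoverlapping_clamp[OF I ab(1)]])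
          fix i
          show "{clamp_to a b (u i)<..<clamp_to a b (v i)} \<subseteq> {a..b}"
            using clamp_to_bounds[OF ab(1), of "u i"] clamp_to_bounds[OF ab(1), of "v i"] by fastforce
        qed auto
        then show "(\<Sum>i\<in>I. clamp_to a b (v i) - clamp_to a b (u i)) < d" using ab by simp
      qed
      qed
      obtain g where g: "\<And>x y. x \<le> y \<Longrightarrow> g absolutely_integrable_on {x..y} \<and> ?F y - ?F x = integral {x..y} g"
        using AC_on_line_bounded_variation_is_integral[OF F B] by blast
      have g': "g absolutely_integrable_on {x..y}" for x y
        using g[of x y] by (cases "x \<le> y") auto
      have "AE t in lebesgue. (?F has_vector_derivative g t) (at t)"
        using g by (intro AE_has_vector_derivative_integral g') auto
      then have "AE t in lebesgue. t \<in> {a<..<b} \<longrightarrow> ?v t = g t"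
      proof eventually_elim
        case (elim t)
        show ?case
        proof
          assume t: "t \<in> {a<..<b}"
          have "(f has_vector_derivative g t) (at t)"
            using elim t by (rule has_vector_derivative_transform_within_open[OF _ open_greaterThanLessThan])
              (auto simp: clamp_to_def)
          then show "?v t = g t" by (rule vector_derivative_at)
        qed
      qed
      then obtain N where N: "N \<in> null_sets lebesgue" "\<And>t. t \<in> {a<..<b} \<Longrightarrow> t \<notin> N \<Longrightarrow> ?v t = g t"
        unfolding completion.AE_iff_null_sets by auto
      have neg: "negligible (N \<union> {a,b})" using N(1) by (auto simp: negligible_iff_null_sets[symmetric])
      have eq: "?v t = g t" if "t \<in> {a..b} - (N \<union> {a,b})" for t using that N(2) by auto
      have "?v absolutely_integrable_on {a..b}"
        by (rule absolutely_integrable_spike[OF g' neg eq])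
      moreover have "integral {a..b} ?v = integral {a..b} g"
        using eq by (intro integral_spike[OF neg]) auto
      ultimately show ?thesis
        using g[OF ab(1)] ab(1) by (simp add: clamp_to_def)
    qed
    then show ?case using d by (intro exI[of _ "min d 1"]) simp
  qed
qed

section \<open>Calculus with integral representations\<close>

text \<open>Absolute continuity on \<open>[a,b]\<close> with almost everywhere derivative \<open>v\<close>, expressed by integrals only.\<close>

definition antideriv_on :: "real \<Rightarrow> real \<Rightarrow> (real \<Rightarrow> 'a::euclidean_space) \<Rightarrow> (real \<Rightarrow> 'a) \<Rightarrow> bool" where
  "antideriv_on a b F v \<longleftrightarrow> v absolutely_integrable_on {a..b} \<and>
     (\<forall>x y. a \<le> x \<longrightarrow> x \<le> y \<longrightarrow> y \<le> b \<longrightarrow> (v has_integral F y - F x) {x..y})"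

lemma antideriv_onI:
  assumes "v absolutely_integrable_on {a..b}"
    and "\<And>x y. a \<le> x \<Longrightarrow> x \<le> y \<Longrightarrow> y \<le> b \<Longrightarrow> F y - F x = integral {x..y} v"
  shows "antideriv_on a b F v"
  unfolding antideriv_on_def
proof (intro conjI allI impI assms(1))
  fix x y assume xy: "a \<le> x" "x \<le> y" "y \<le> b"
  have "v integrable_on {a..b}" using assms(1) by (rule set_lebesgue_integral_eq_integral(1))
  then have "v integrable_on {x..y}" by (rule integrable_on_subinterval) (use xy in auto)
  then show "(v has_integral F y - F x) {x..y}" using assms(2)[OF xy] by (simp add: has_integral_integral)
qed

lemma antideriv_onD:
  assumes "antideriv_on a b F v" "a \<le> x" "x \<le> y" "y \<le> b"
  shows "(v has_integral F y - F x) {x..y}" "v integrable_on {x..y}" "integral {x..y} v = F y - F x"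
    "v absolutely_integrable_on {x..y}"
proof -
  show 1: "(v has_integral F y - F x) {x..y}" using assms by (simp add: antideriv_on_def)
  then show "v integrable_on {x..y}" "integral {x..y} v = F y - F x" by (auto simp: integral_unique)
  show "v absolutely_integrable_on {x..y}"
    by (rule set_integrable_subset[of _ "{a..b}"]) (use assms in \<open>auto simp: antideriv_on_def\<close>)
qed

lemma antideriv_on_continuous:
  assumes "antideriv_on a b F v"
  shows "continuous_on {a..b} F"
proof (cases "a \<le> b")
  case True
  have "continuous_on {a..b} (\<lambda>x. F a + integral {a..x} v)"
    by (intro continuous_intros indefinite_integral_continuous_1 antideriv_onD(2)[OF assms]) (use True in auto)
  then show ?thesis
    by (rule continuous_on_eq) (use antideriv_onD(3)[OF assms, of a] in auto)
qed auto

lemma antideriv_on_cong: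
  assumes "antideriv_on a b F v" "\<And>x. x \<in> {a..b} \<Longrightarrow> G x = F x" "\<And>x. x \<in> {a..b} \<Longrightarrow> w x = v x"
  shows "antideriv_on a b G w"
  unfolding antideriv_on_def
proof (intro conjI allI impI)
  show "w absolutely_integrable_on {a..b}"
    by (rule absolutely_integrable_spike[where f=v and S="{}"]) (use assms in \<open>auto simp: antideriv_on_def\<close>)
  fix x y assume "a \<le> x" "x \<le> y" "y \<le> b"
  then show "(w has_integral G y - G x) {x..y}"
    using antideriv_onD(1)[OF assms(1)] assms(2,3)
    by (intro has_integral_eq[of "{x..y}" v w]) auto
qed

lemma antideriv_on_linear:
  assumes "antideriv_on a b F v" "bounded_linear h"
  shows "antideriv_on a b (\<lambda>x. h (F x)) (\<lambda>x. h (v x))"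
  unfolding antideriv_on_def
proof (intro conjI allI impI)
  show "(\<lambda>x. h (v x)) absolutely_integrable_on {a..b}"
    using absolutely_integrable_linear[where f=v and h=h] assms by (simp add: antideriv_on_def o_def)
  fix x y assume "a \<le> x" "x \<le> y" "y \<le> b"
  from has_integral_linear[OF antideriv_onD(1)[OF assms(1) this] assms(2)]
  show "((\<lambda>x. h (v x)) has_integral h (F y) - h (F x)) {x..y}"
    using assms(2) by (simp add: o_def linear_diff[OF bounded_linear.linear])
qed

lemma antideriv_on_add:
  assumes "antideriv_on a b F v" "antideriv_on a b G w"
  shows "antideriv_on a b (\<lambda>x. F x + G x) (\<lambda>x. v x + w x)"
  unfolding antideriv_on_def
proof (intro conjI allI impI)
  show "(\<lambda>x. v x + w x) absolutely_integrable_on {a..b}"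
    using assms by (intro set_integral_add(1)) (auto simp: antideriv_on_def)
  fix x y assume "a \<le> x" "x \<le> y" "y \<le> b"
  from has_integral_add[OF antideriv_onD(1)[OF assms(1) this] antideriv_onD(1)[OF assms(2) this]]
  show "((\<lambda>x. v x + w x) has_integral F y + G y - (F x + G x)) {x..y}"
    by (simp add: algebra_simps)
qed

lemma continuous_times_absolutely_integrable:
  fixes F v :: "real \<Rightarrow> 'a::{real_normed_algebra,euclidean_space}"
  assumes F: "continuous_on {a..b} F" and v: "v absolutely_integrable_on {a..b}"
  shows "(\<lambda>x. F x * v x) absolutely_integrable_on {a..b}" "(\<lambda>x. v x * F x) absolutely_integrable_on {a..b}"
proof -
  have m: "F \<in> borel_measurable (lebesgue_on {a..b})"
    using F by (rule continuous_imp_measurable_on_sets_lebesgue) auto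
  have b: "bounded (F ` {a..b})"
    by (intro compact_imp_bounded compact_continuous_image F) auto
  show "(\<lambda>x. F x * v x) absolutely_integrable_on {a..b}"
    by (rule absolutely_integrable_bounded_measurable_product[OF bilinear_times m _ b v]) auto
  have bil: "bilinear (\<lambda>x y::'a. y * x)"
    by (simp add: bilinear_conv_bounded_bilinear bounded_bilinear.flip[OF bounded_bilinear_mult])
  show "(\<lambda>x. v x * F x) absolutely_integrable_on {a..b}"
    using absolutely_integrable_bounded_measurable_product[OF bil m _ b v] by auto
qed

text \<open>The defect \<open>FG|\<^sub>x\<^sup>y - \<integral>(F'G + FG')\<close> is additive in the interval, and by continuity of the factors it is locally
small compared with \<open>\<integral>(|F'| + |G'|)\<close>; hence it vanishes.\<close>

lemma antideriv_on_mult: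
  fixes F G :: "real \<Rightarrow> 'a::{real_normed_algebra,euclidean_space}"
  assumes F: "antideriv_on a b F v" and G: "antideriv_on a b G w"
  shows "antideriv_on a b (\<lambda>x. F x * G x) (\<lambda>x. v x * G x + F x * w x)"
proof -
  have cF: "continuous_on {a..b} F" and cG: "continuous_on {a..b} G"
    using F G by (auto intro: antideriv_on_continuous)
  have va: "v absolutely_integrable_on {a..b}" and wa: "w absolutely_integrable_on {a..b}"
    using F G by (auto simp: antideriv_on_def)
  let ?h = "\<lambda>x. v x * G x + F x * w x"
  have ha: "?h absolutely_integrable_on {a..b}"
    by (intro set_integral_add(1) continuous_times_absolutely_integrable cF cG va wa)
  have hi: "?h integrable_on {x..y}" if "a \<le> x" "y \<le> b" for x y
    using ha that by (intro integrable_on_subinterval[OF set_lebesgue_integral_eq_integral(1)[OF ha]]) auto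
  let ?n = "\<lambda>x. norm (v x) + norm (w x)"
  have na: "?n absolutely_integrable_on {a..b}"
    by (intro set_integral_add(1) absolutely_integrable_norm[unfolded o_def] va wa)
  have ni: "?n integrable_on {x..y}" if "a \<le> x" "y \<le> b" for x y
    using that by (intro integrable_on_subinterval[OF set_lebesgue_integral_eq_integral(1)[OF na]]) auto
  show ?thesis
  proof (rule antideriv_onI[OF ha])
    fix x0 y0 assume x0y0: "a \<le> x0" "x0 \<le> y0" "y0 \<le> b"
    have bound: "norm (F y0 * G y0 - F x0 * G x0 - integral {x0..y0} ?h) \<le> e * integral {x0..y0} ?n" if e: "0 < e" for e
    proof -
      have "a \<le> x0 \<longrightarrow> y0 \<le> b \<longrightarrow> norm (F y0 * G y0 - F x0 * G x0 - integral {x0..y0} ?h) \<le> e * integral {x0..y0} ?n"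
        using x0y0(2)
      proof (induct rule: Bolzano)
        case (trans x y z)
        show ?case
        proof (intro impI)
          assume xz: "a \<le> x" "z \<le> b"
          have c: "integral {x..y} ?h + integral {y..z} ?h = integral {x..z} ?h"
            by (rule Henstock_Kurzweil_Integration.integral_combine[OF trans(3,4) hi[OF xz]])
          have d: "integral {x..y} ?n + integral {y..z} ?n = integral {x..z} ?n"
            by (rule Henstock_Kurzweil_Integration.integral_combine[OF trans(3,4) ni[OF xz]])
          have eq: "F z * G z - F x * G x - integral {x..z} ?h =
             (F y * G y - F x * G x - integral {x..y} ?h) + (F z * G z - F y * G y - integral {y..z} ?h)"
            unfolding c[symmetric] by (simp add: algebra_simps)
          have "norm (F z * G z - F x * G x - integral {x..z} ?h) \<le>
            norm (F y * G y - F x * G x - integral {x..y} ?h) + norm (F z * G z - F y * G y - integral {y..z} ?h)"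
            unfolding eq by (rule norm_triangle_ineq)
          also have "\<dots> \<le> e * integral {x..y} ?n + e * integral {y..z} ?n"
            using trans(1,2) xz trans(3,4) by (intro add_mono) auto
          also have "\<dots> = e * integral {x..z} ?n" unfolding d[symmetric] by (simp add: algebra_simps)
          finally show "norm (F z * G z - F x * G x - integral {x..z} ?h) \<le> e * integral {x..z} ?n" .
        qed
      next
        case (local t)
        then have t: "t \<in> {a..b}" using x0y0 by auto
        obtain d1 where d1: "0 < d1" "\<And>s. s \<in> {a..b} \<Longrightarrow> dist s t < d1 \<Longrightarrow> dist (F s) (F t) < e / 2"
          using cF[unfolded continuous_on_iff, rule_format, OF t, of "e/2"] e by auto
        obtain d2 where d2: "0 < d2" "\<And>s. s \<in> {a..b} \<Longrightarrow> dist s t < d2 \<Longrightarrow> dist (G s) (G t) < e / 2"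
          using cG[unfolded continuous_on_iff, rule_format, OF t, of "e/2"] e by auto
        have "norm (F y * G y - F x * G x - integral {x..y} ?h) \<le> e * integral {x..y} ?n"
          if xy: "x \<le> t" "t \<le> y" "y - x < min d1 d2" "a \<le> x" "y \<le> b" for x y
        proof -
          have le: "x \<le> y" using xy by simp
          have vi: "(v has_integral F y - F x) {x..y}" and wi: "(w has_integral G y - G x) {x..y}"
            using antideriv_onD(1)[OF F xy(4) le xy(5)] antideriv_onD(1)[OF G xy(4) le xy(5)] .
          have near: "norm (F s - F s') \<le> e" "norm (G s - G s') \<le> e" if "s \<in> {x..y}" "s' \<in> {x..y}" for s s'
          proof -
            have ds: "dist s t < min d1 d2" "dist s' t < min d1 d2" "s \<in> {a..b}" "s' \<in> {a..b}"
              using that xy by (auto simp: dist_real_def)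
            have "dist (F s) (F t) < e / 2" "dist (F s') (F t) < e / 2" using ds d1 by auto
            then show "norm (F s - F s') \<le> e" using dist_triangle_half_r[of "F t" "F s" e "F s'"] by (simp add: dist_norm norm_minus_commute)
            have "dist (G s) (G t) < e / 2" "dist (G s') (G t) < e / 2" using ds d2 by auto
            then show "norm (G s - G s') \<le> e" using dist_triangle_half_r[of "G t" "G s" e "G s'"] by (simp add: dist_norm norm_minus_commute)
          qed
          have "((\<lambda>s. v s * G y) has_integral (F y - F x) * G y) {x..y}" by (rule has_integral_mult_left[OF vi])
          moreover have "((\<lambda>s. F x * w s) has_integral F x * (G y - G x)) {x..y}" by (rule has_integral_mult_right[OF wi])
          ultimately have "((\<lambda>s. v s * G y + F x * w s - ?h s) has_integral
             (F y - F x) * G y + F x * (G y - G x) - integral {x..y} ?h) {x..y}"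
            by (intro has_integral_diff has_integral_add integrable_integral hi xy)
          then have hi2: "((\<lambda>s. v s * (G y - G s) + (F x - F s) * w s) has_integral
             F y * G y - F x * G x - integral {x..y} ?h) {x..y}"
            by (simp add: algebra_simps)
          then have "norm (F y * G y - F x * G x - integral {x..y} ?h) = norm (integral {x..y} (\<lambda>s. v s * (G y - G s) + (F x - F s) * w s))"
            by (simp add: integral_unique)
          also have "\<dots> \<le> integral {x..y} (\<lambda>s. e * ?n s)"
          proof (rule integral_norm_bound_integral)
            show "(\<lambda>s. v s * (G y - G s) + (F x - F s) * w s) integrable_on {x..y}" using hi2 by blast
            show "(\<lambda>s. e * ?n s) integrable_on {x..y}" using ni[OF xy(4,5)] by (rule integrable_on_mult_right)
            fix s assume s: "s \<in> {x..y}"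
            have "norm (v s * (G y - G s) + (F x - F s) * w s) \<le> norm (v s) * norm (G y - G s) + norm (F x - F s) * norm (w s)"
              by (intro order_trans[OF norm_triangle_ineq] add_mono norm_mult_ineq)
            also have "\<dots> \<le> norm (v s) * e + e * norm (w s)"
              using near[of x s] near[of y s] s le by (intro add_mono mult_left_mono mult_right_mono) auto
            finally show "norm (v s * (G y - G s) + (F x - F s) * w s) \<le> e * ?n s" by (simp add: algebra_simps)
          qed
          finally show ?thesis by simp
        qed
        then show ?case using d1(1) d2(1) by (intro exI[of _ "min d1 d2"]) auto
      qed
      then show ?thesis using x0y0 by blast
    qed
    have n0: "0 \<le> integral {x0..y0} ?n" by (intro Henstock_Kurzweil_Integration.integral_nonneg ni x0y0) auto
    have "norm (F y0 * G y0 - F x0 * G x0 - integral {x0..y0} ?h) \<le> 0"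
    proof (rule field_le_epsilon)
      fix e :: real assume e: "0 < e"
      let ?N = "integral {x0..y0} ?n"
      have "norm (F y0 * G y0 - F x0 * G x0 - integral {x0..y0} ?h) \<le> e / (?N + 1) * ?N"
        using n0 e by (intro bound) simp
      also have "\<dots> \<le> e" using n0 e by (simp add: field_simps)
      finally show "norm (F y0 * G y0 - F x0 * G x0 - integral {x0..y0} ?h) \<le> 0 + e" by simp
    qed
    then show "F y0 * G y0 - F x0 * G x0 = integral {x0..y0} ?h" by simp
  qed
qed

lemma Cauchy_Schwarz_integral:
  fixes f g :: "'a \<Rightarrow> real"
  assumes [measurable]: "f \<in> borel_measurable M" "g \<in> borel_measurable M"
    and f: "integrable M (\<lambda>x. (f x)\<^sup>2)" and g: "integrable M (\<lambda>x. (g x)\<^sup>2)"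
  shows "integrable M (\<lambda>x. f x * g x)"
    and "\<bar>LINT x|M. f x * g x\<bar> \<le> sqrt (LINT x|M. (f x)\<^sup>2) * sqrt (LINT x|M. (g x)\<^sup>2)"
proof -
  show fg: "integrable M (\<lambda>x. f x * g x)"
  proof (rule Bochner_Integration.integrable_bound[OF Bochner_Integration.integrable_add[OF f g]])
    show "AE x in M. norm (f x * g x) \<le> norm ((f x)\<^sup>2 + (g x)\<^sup>2)"
    proof (rule AE_I2)
      fix x
      have "2 * (\<bar>f x\<bar> * \<bar>g x\<bar>) \<le> (f x)\<^sup>2 + (g x)\<^sup>2"
        using sum_squares_bound[of "\<bar>f x\<bar>" "\<bar>g x\<bar>"] by simp
      moreover have "0 \<le> \<bar>f x\<bar> * \<bar>g x\<bar>" by simp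
      ultimately have "\<bar>f x\<bar> * \<bar>g x\<bar> \<le> (f x)\<^sup>2 + (g x)\<^sup>2" by linarith
      then show "norm (f x * g x) \<le> norm ((f x)\<^sup>2 + (g x)\<^sup>2)" by (simp add: abs_mult)
    qed
  qed measurable
  let ?A = "LINT x|M. (f x)\<^sup>2" and ?B = "LINT x|M. f x * g x" and ?C = "LINT x|M. (g x)\<^sup>2"
  have q: "0 \<le> ?A - 2 * t * ?B + t\<^sup>2 * ?C" for t :: real
  proof -
    have "0 \<le> (LINT x|M. (f x - t * g x)\<^sup>2)" by (intro Bochner_Integration.integral_nonneg) simp
    also have "(LINT x|M. (f x - t * g x)\<^sup>2) = (LINT x|M. (f x)\<^sup>2 - 2 * t * (f x * g x) + t\<^sup>2 * (g x)\<^sup>2)"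
      by (intro Bochner_Integration.integral_cong) (auto simp: power2_eq_square algebra_simps)
    also have "\<dots> = ?A - 2 * t * ?B + t\<^sup>2 * ?C" using f g fg by simp
    finally show ?thesis .
  qed
  have "?B\<^sup>2 \<le> ?A * ?C"
  proof (cases "?C = 0")
    case True
    have "?B = 0"
    proof (rule ccontr)
      assume B: "?B \<noteq> 0"
      have "0 \<le> ?A - 2 * ((?A + 1) / (2 * ?B)) * ?B" using q[of "(?A + 1) / (2 * ?B)"] True by simp
      then show False using B by simp
    qed
    then show ?thesis using True by simp
  next
    case False
    have "0 \<le> ?C" by (intro Bochner_Integration.integral_nonneg) simp
    then have C: "0 < ?C" using False by (rule le_neq_trans[OF _ not_sym])
    have "0 \<le> ?A - 2 * (?B / ?C) * ?B + (?B / ?C)\<^sup>2 * ?C" by (rule q)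
    also have "\<dots> = ?A - ?B\<^sup>2 / ?C" using C by (simp add: power2_eq_square field_simps)
    finally show ?thesis using C by (simp add: field_simps)
  qed
  then have "sqrt (?B\<^sup>2) \<le> sqrt (?A * ?C)" by (rule real_sqrt_le_mono)
  then show "\<bar>?B\<bar> \<le> sqrt ?A * sqrt ?C" by (simp add: real_sqrt_mult)
qed

lemma Cauchy_Schwarz_interval:
  fixes f g :: "real \<Rightarrow> real"
  assumes "f \<in> borel_measurable (lebesgue_on {a..b})" "g \<in> borel_measurable (lebesgue_on {a..b})"
    and f: "(\<lambda>x. (f x)\<^sup>2) absolutely_integrable_on {a..b}" and g: "(\<lambda>x. (g x)\<^sup>2) absolutely_integrable_on {a..b}"
  shows "(\<lambda>x. f x * g x) absolutely_integrable_on {a..b}"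
    and "\<bar>integral {a..b} (\<lambda>x. f x * g x)\<bar> \<le> sqrt (integral {a..b} (\<lambda>x. (f x)\<^sup>2)) * sqrt (integral {a..b} (\<lambda>x. (g x)\<^sup>2))"
proof -
  have conv: "integrable (lebesgue_on {a..b}) h \<longleftrightarrow> h absolutely_integrable_on {a..b}" for h :: "real \<Rightarrow> real"
    unfolding set_integrable_def by (subst integrable_restrict_space) auto
  have eq: "integral\<^sup>L (lebesgue_on {a..b}) h = integral {a..b} h" if "h absolutely_integrable_on {a..b}" for h :: "real \<Rightarrow> real"
    using that conv by (intro lebesgue_integral_eq_integral) auto
  note CS = Cauchy_Schwarz_integral[OF assms(1,2), unfolded conv, OF f g]
  show fg: "(\<lambda>x. f x * g x) absolutely_integrable_on {a..b}" by (rule CS(1))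
  show "\<bar>integral {a..b} (\<lambda>x. f x * g x)\<bar> \<le> sqrt (integral {a..b} (\<lambda>x. (f x)\<^sup>2)) * sqrt (integral {a..b} (\<lambda>x. (g x)\<^sup>2))"
    using CS(2) unfolding eq[OF fg] eq[OF f] eq[OF g] .
qed

text \<open>The form of the Hoelder inequality used for \<open>\<integral>q\<^sub>-|f|\<^sup>2\<close>: the weight \<open>w\<close> enters with its supremum \<open>X\<close> and its integral.
Young's inequality is applied pointwise to \<open>n\<^sup>s/\<integral>n\<^sup>s\<close> and \<open>w/\<integral>w\<close>, after writing
\<open>w \<le> X\<^bsup>1/s\<^esup> w\<^bsup>1-1/s\<^esup>\<close>.\<close>

lemma Hoelder_interval:
  fixes n w :: "real \<Rightarrow> real"
  assumes ab: "a < b" and nn: "\<And>x. 0 \<le> n x" and n: "n absolutely_integrable_on {a..b}"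
    and ns: "integrable lebesgue (\<lambda>x. n x powr s)" and s: "1 \<le> s"
    and w: "continuous_on {a..b} w" "\<And>x. x \<in> {a..b} \<Longrightarrow> 0 \<le> w x" "\<And>x. x \<in> {a..b} \<Longrightarrow> w x \<le> X"
  shows "integral {a..b} (\<lambda>x. n x * w x) \<le>
     (LINT x|lebesgue. n x powr s) powr (1/s) * X powr (1/s) * integral {a..b} w powr (1 - 1/s)"
proof -
  let ?\<sigma> = "1/s"
  let ?I = "LINT x|lebesgue. n x powr s" and ?W = "integral {a..b} w"
  let ?R = "?I powr ?\<sigma> * X powr ?\<sigma> * ?W powr (1 - ?\<sigma>)"
  have R0: "0 \<le> ?R" by simp
  have nw: "(\<lambda>x. n x * w x) integrable_on {a..b}"
    using continuous_times_absolutely_integrable(2)[OF w(1) n] by (rule set_lebesgue_integral_eq_integral(1))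
  have wi: "w integrable_on {a..b}" by (rule integrable_continuous_interval[OF w(1)])
  have I0: "0 \<le> ?I" by (intro Bochner_Integration.integral_nonneg) simp
  have W0: "0 \<le> ?W" using wi w(2) by (rule Henstock_Kurzweil_Integration.integral_nonneg)
  have nsa: "(\<lambda>x. n x powr s) absolutely_integrable_on {a..b}"
    using ns unfolding set_integrable_def by (intro integrable_mult_indicator) auto
  have nsi: "(\<lambda>x. n x powr s) integrable_on {a..b}" using nsa by (rule set_lebesgue_integral_eq_integral(1))
  have nsle: "integral {a..b} (\<lambda>x. n x powr s) \<le> ?I"
  proof -
    have "integral {a..b} (\<lambda>x. n x powr s) = (LINT x:{a..b}|lebesgue. n x powr s)"
      using set_lebesgue_integral_eq_integral(2)[OF nsa] by simp
    also have "\<dots> \<le> ?I" unfolding set_lebesgue_integral_def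
      by (intro Bochner_Integration.integral_mono ns integrable_mult_indicator) (auto simp: indicator_def)
    finally show ?thesis .
  qed
  show ?thesis
  proof (cases "?I = 0 \<or> ?W = 0")
    case True
    have "integral {a..b} (\<lambda>x. n x * w x) = 0"
    proof (cases "?I = 0")
      case True
      then have "AE x in lebesgue. n x powr s = 0"
        using integral_nonneg_eq_0_iff_AE[OF ns] by simp
      then obtain N where N: "N \<in> null_sets lebesgue" "\<And>x. x \<notin> N \<Longrightarrow> n x powr s = 0"
        unfolding completion.AE_iff_null_sets by auto
      have "integral {a..b} (\<lambda>x. n x * w x) = integral {a..b} (\<lambda>x. 0)"
        by (rule integral_spike[of N]) (use N in \<open>auto simp: negligible_iff_null_sets\<close>)
      then show ?thesis by simp
    next
      case False
      then have W: "(w has_integral 0) (cbox a b)" using \<open>?I = 0 \<or> ?W = 0\<close> wi by (auto simp: has_integral_integral)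
      have "w x = 0" if "x \<in> {a..b}" for x
        using has_integral_0_cbox_imp_0[of a b w x] w W that ab by auto
      then have "integral {a..b} (\<lambda>x. n x * w x) = integral {a..b} (\<lambda>x. 0)" by (intro integral_cong) auto
      then show ?thesis by simp
    qed
    then show ?thesis using R0 by simp
  next
    case False
    then have ne: "?I \<noteq> 0" "?W \<noteq> 0" by blast+
    have I: "0 < ?I" by (rule le_neq_trans[OF I0 not_sym[OF ne(1)]])
    have W: "0 < ?W" by (rule le_neq_trans[OF W0 not_sym[OF ne(2)]])
    let ?c = "?I powr ?\<sigma> * X powr ?\<sigma> * ?W powr (1 - ?\<sigma>)"
    have pt: "n x * w x \<le> ?c * (?\<sigma> * (n x powr s / ?I) + (1 - ?\<sigma>) * (w x / ?W))" if x: "x \<in> {a..b}" for x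
    proof (cases "n x = 0 \<or> w x = 0")
      case True
      have "0 \<le> ?c * (?\<sigma> * (n x powr s / ?I) + (1 - ?\<sigma>) * (w x / ?W))"
        using s I W w(2)[OF x] by (intro mult_nonneg_nonneg add_nonneg_nonneg) auto
      then show ?thesis using True by auto
    next
      case False
      then have nx: "0 < n x" and wx: "0 < w x" using nn[of x] w(2)[OF x] by auto
      have X: "0 < X" "w x \<le> X" using wx w(3)[OF x] by auto
      have "(n x powr s / ?I) powr ?\<sigma> * (w x / ?W) powr (1 - ?\<sigma>) \<le> ?\<sigma> * (n x powr s / ?I) + (1 - ?\<sigma>) * (w x / ?W)"
        using s nx wx I W by (intro Youngs_inequality_0) auto
      moreover have "(n x powr s / ?I) powr ?\<sigma> = n x / ?I powr ?\<sigma>"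
        using nx I s by (simp add: powr_divide powr_powr)
      moreover have "(w x / ?W) powr (1 - ?\<sigma>) = w x powr (1 - ?\<sigma>) / ?W powr (1 - ?\<sigma>)"
        using wx W by (simp add: powr_divide)
      ultimately have Y: "n x / ?I powr ?\<sigma> * (w x powr (1 - ?\<sigma>) / ?W powr (1 - ?\<sigma>)) \<le> ?\<sigma> * (n x powr s / ?I) + (1 - ?\<sigma>) * (w x / ?W)"
        by simp
      have "n x * w x = n x * (w x powr ?\<sigma> * w x powr (1 - ?\<sigma>))"
        using wx by (simp add: powr_add[symmetric])
      also have "\<dots> \<le> n x * (X powr ?\<sigma> * w x powr (1 - ?\<sigma>))"
        using nx wx X s by (intro mult_left_mono mult_right_mono powr_mono2) auto
      also have "\<dots> = ?c * (n x / ?I powr ?\<sigma> * (w x powr (1 - ?\<sigma>) / ?W powr (1 - ?\<sigma>)))"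
        using I W by simp
      also have "\<dots> \<le> ?c * (?\<sigma> * (n x powr s / ?I) + (1 - ?\<sigma>) * (w x / ?W))"
        using Y by (intro mult_left_mono) auto
      finally show ?thesis .
    qed
    have "integral {a..b} (\<lambda>x. n x * w x) \<le> integral {a..b} (\<lambda>x. ?c * (?\<sigma> * (n x powr s / ?I) + (1 - ?\<sigma>) * (w x / ?W)))"
      using pt by (intro integral_le nw integrable_on_mult_right integrable_add integrable_on_divide nsi wi) auto
    also have "\<dots> = ?c * (?\<sigma> * (integral {a..b} (\<lambda>x. n x powr s) / ?I) + (1 - ?\<sigma>) * (?W / ?W))"
      by (intro integral_unique has_integral_mult_right has_integral_add has_integral_divide integrable_integral nsi wi)
    also have "\<dots> \<le> ?c * (?\<sigma> * 1 + (1 - ?\<sigma>) * 1)"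
      using nsle I W s by (intro mult_left_mono add_mono) (auto simp: divide_le_eq_1)
    finally show ?thesis by simp
  qed
qed

section \<open>Linear systems with locally integrable coefficients\<close>

definition primitive_from_0 :: "(real \<Rightarrow> 'a::euclidean_space) \<Rightarrow> real \<Rightarrow> 'a" where
  "primitive_from_0 v x = (if 0 \<le> x then integral {0..x} v else - integral {x..0} v)"

lemma primitive_from_0_antideriv_on:
  assumes v: "\<And>a b. v absolutely_integrable_on {a..b}"
  shows "antideriv_on a b (primitive_from_0 v) v"
proof (rule antideriv_onI[OF v])
  fix x y :: real assume xy: "x \<le> y"
  have vi: "v integrable_on {a..b}" for a b using v by (rule set_lebesgue_integral_eq_integral(1))
  consider "0 \<le> x" | "y < 0" | "x < 0" "0 \<le> y" by linarith
  then show "primitive_from_0 v y - primitive_from_0 v x = integral {x..y} v"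
  proof cases
    case 1
    then show ?thesis
      using Henstock_Kurzweil_Integration.integral_combine[OF 1 xy vi] xy by (simp add: primitive_from_0_def algebra_simps)
  next
    case 2
    then show ?thesis
      using Henstock_Kurzweil_Integration.integral_combine[OF xy less_imp_le[OF 2] vi] xy by (simp add: primitive_from_0_def algebra_simps)
  next
    case 3
    then show ?thesis
      using Henstock_Kurzweil_Integration.integral_combine[OF less_imp_le[OF 3(1)] 3(2) vi] by (simp add: primitive_from_0_def algebra_simps)
  qed
qed

lemma primitive_from_0_at_0 [simp]: "primitive_from_0 v 0 = 0" by (simp add: primitive_from_0_def)

lemma antideriv_on_power:
  fixes F :: "real \<Rightarrow> real"
  assumes F: "antideriv_on a b F v"
  shows "antideriv_on a b (\<lambda>x. F x ^ Suc k) (\<lambda>x. real (Suc k) * F x ^ k * v x)"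
proof (induct k)
  case 0
  then show ?case using F by simp
next
  case (Suc k)
  show ?case
    by (rule antideriv_on_cong[OF antideriv_on_mult[OF F Suc]]) (auto simp: algebra_simps)
qed

text \<open>The differences of consecutive Picard iterates of \<open>f' = ch\<close>, \<open>h' = df + e\<close>; the solution is their sum.\<close>

fun picard_terms :: "(real \<Rightarrow> complex) \<Rightarrow> (real \<Rightarrow> complex) \<Rightarrow> (real \<Rightarrow> complex) \<Rightarrow> complex \<Rightarrow> complex
    \<Rightarrow> nat \<Rightarrow> (real \<Rightarrow> complex) \<times> (real \<Rightarrow> complex)" where
  "picard_terms c d e f0 h0 0 = (\<lambda>x. f0, \<lambda>x. h0 + primitive_from_0 e x)"
| "picard_terms c d e f0 h0 (Suc k) =
     (primitive_from_0 (\<lambda>t. c t * snd (picard_terms c d e f0 h0 k) t),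
      primitive_from_0 (\<lambda>t. d t * fst (picard_terms c d e f0 h0 k) t))"

text \<open>The estimate that produces the exponential series: \<open>\<integral>a A\<^sup>k = A\<^bsup>k+1\<^esup>/(k+1)\<close> for a primitive \<open>A\<close> of \<open>a\<close>.
To the left of \<open>0\<close> the primitive is negative, so its negative is used there.\<close>

lemma primitive_from_0_bound_power:
  fixes v :: "real \<Rightarrow> complex"
  assumes a: "\<And>x y. a absolutely_integrable_on {x..y}" "\<And>t. 0 \<le> a t"
    and v: "\<And>x y. v absolutely_integrable_on {x..y}"
    and le: "\<And>t. \<bar>t\<bar> \<le> N \<Longrightarrow> norm (v t) \<le> a t * (M * \<bar>primitive_from_0 a t\<bar> ^ k / fact k)"
    and x: "\<bar>x\<bar> \<le> N"
  shows "norm (primitive_from_0 v x) \<le> M * \<bar>primitive_from_0 a x\<bar> ^ Suc k / fact (Suc k)"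
proof -
  let ?P = "primitive_from_0 a"
  have P: "antideriv_on r s ?P a" for r s by (rule primitive_from_0_antideriv_on[OF a(1)])
  have ai: "a integrable_on {r..s}" for r s using a(1) by (rule set_lebesgue_integral_eq_integral(1))
  have vi: "v integrable_on {r..s}" for r s using v by (rule set_lebesgue_integral_eq_integral(1))
  have fct: "fact (Suc k) = (real (Suc k) * fact k :: real)" by simp
  show ?thesis
  proof (cases "0 \<le> x")
    case True
    have P0: "0 \<le> ?P t" if "0 \<le> t" for t
      using that a(2) ai by (auto simp: primitive_from_0_def intro: Henstock_Kurzweil_Integration.integral_nonneg)
    have I: "((\<lambda>t. M / fact (Suc k) * (real (Suc k) * ?P t ^ k * a t)) has_integral M / fact (Suc k) * (?P x ^ Suc k - ?P 0 ^ Suc k)) {0..x}"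
      by (rule has_integral_mult_right[OF antideriv_onD(1)[OF antideriv_on_power[OF P[of 0 x], of k]]]) (use True in auto)
    have "norm (integral {0..x} v) \<le> integral {0..x} (\<lambda>t. M / fact (Suc k) * (real (Suc k) * ?P t ^ k * a t))"
    proof (rule integral_norm_bound_integral[OF vi])
      show "(\<lambda>t. M / fact (Suc k) * (real (Suc k) * ?P t ^ k * a t)) integrable_on {0..x}" using I by blast
      fix t assume t: "t \<in> {0..x}"
      have "norm (v t) \<le> a t * (M * \<bar>?P t\<bar> ^ k / fact k)" using t x by (intro le) auto
      also have "\<dots> = M / fact (Suc k) * (real (Suc k) * ?P t ^ k * a t)"
        using P0[of t] t unfolding fct by (simp add: field_simps del: of_nat_Suc)
      finally show "norm (v t) \<le> M / fact (Suc k) * (real (Suc k) * ?P t ^ k * a t)" .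
    qed
    then show ?thesis using True P0[OF True] integral_unique[OF I] by (simp add: primitive_from_0_def)
  next
    case False
    have P0: "?P t \<le> 0" if "t \<le> 0" for t
      using that a(2) ai by (cases "t = 0") (auto simp: primitive_from_0_def intro: Henstock_Kurzweil_Integration.integral_nonneg)
    have mP: "antideriv_on x 0 (\<lambda>t. - ?P t) (\<lambda>t. - a t)"
      by (rule antideriv_on_linear[OF P bounded_linear_minus[OF bounded_linear_ident]])
    have I: "((\<lambda>t. - (M / fact (Suc k)) * (real (Suc k) * (- ?P t) ^ k * (- a t))) has_integral - (M / fact (Suc k)) * ((- ?P 0) ^ Suc k - (- ?P x) ^ Suc k)) {x..0}"
      by (rule has_integral_mult_right[OF antideriv_onD(1)[OF antideriv_on_power[OF mP, of k]]]) (use False in auto)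
    have "norm (integral {x..0} v) \<le> integral {x..0} (\<lambda>t. - (M / fact (Suc k)) * (real (Suc k) * (- ?P t) ^ k * (- a t)))"
    proof (rule integral_norm_bound_integral[OF vi])
      show "(\<lambda>t. - (M / fact (Suc k)) * (real (Suc k) * (- ?P t) ^ k * (- a t))) integrable_on {x..0}" using I by blast
      fix t assume t: "t \<in> {x..0}"
      have "norm (v t) \<le> a t * (M * \<bar>?P t\<bar> ^ k / fact k)" using t x by (intro le) auto
      also have "\<dots> = - (M / fact (Suc k)) * (real (Suc k) * (- ?P t) ^ k * (- a t))"
        using P0[of t] t unfolding fct by (simp add: field_simps del: of_nat_Suc)
      finally show "norm (v t) \<le> - (M / fact (Suc k)) * (real (Suc k) * (- ?P t) ^ k * (- a t))" .
    qed
    also have "\<dots> = M * \<bar>?P x\<bar> ^ Suc k / fact (Suc k)"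
      using integral_unique[OF I] P0[of x] False by (simp del: power_Suc fact_Suc)
    finally show ?thesis using False by (simp add: primitive_from_0_def)
  qed
qed

theorem linear_system_solution_exists:
  fixes c d e :: "real \<Rightarrow> complex"
  assumes c: "\<And>a b. c absolutely_integrable_on {a..b}"
    and d: "\<And>a b. d absolutely_integrable_on {a..b}"
    and e: "\<And>a b. e absolutely_integrable_on {a..b}"
  shows "\<exists>f h. f 0 = f0 \<and> h 0 = h0 \<and> (\<forall>a b. antideriv_on a b f (\<lambda>t. c t * h t)) \<and>
     (\<forall>a b. antideriv_on a b h (\<lambda>t. d t * f t + e t))"
proof -
  define u where "u k = fst (picard_terms c d e f0 h0 k)" for k
  define w where "w k = snd (picard_terms c d e f0 h0 k)" for k
  have u0: "u 0 = (\<lambda>x. f0)" and uS: "u (Suc k) = primitive_from_0 (\<lambda>t. c t * w k t)" for k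
    by (auto simp: u_def w_def)
  have w0: "w 0 = (\<lambda>x. h0 + primitive_from_0 e x)" and wS: "w (Suc k) = primitive_from_0 (\<lambda>t. d t * u k t)" for k
    by (auto simp: u_def w_def)
  have cont: "(\<forall>a b. continuous_on {a..b} (u k)) \<and> (\<forall>a b. continuous_on {a..b} (w k))" for k
  proof (induct k)
    case 0
    show ?case unfolding u0 w0
      by (auto intro!: continuous_intros antideriv_on_continuous[OF primitive_from_0_antideriv_on[OF e]])
  next
    case (Suc k)
    have 1: "antideriv_on a b (u (Suc k)) (\<lambda>t. c t * w k t)" for a b unfolding uS
      by (intro primitive_from_0_antideriv_on continuous_times_absolutely_integrable(2)) (use Suc c in auto)
    have 2: "antideriv_on a b (w (Suc k)) (\<lambda>t. d t * u k t)" for a b unfolding wS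
      by (intro primitive_from_0_antideriv_on continuous_times_absolutely_integrable(2)) (use Suc d in auto)
    show ?case using antideriv_on_continuous[OF 1] antideriv_on_continuous[OF 2] by auto
  qed
  have cw: "(\<lambda>t. c t * w k t) absolutely_integrable_on {a..b}" and du: "(\<lambda>t. d t * u k t) absolutely_integrable_on {a..b}" for k a b
    using cont[of k] c d by (auto intro: continuous_times_absolutely_integrable(2))
  have au: "antideriv_on a b (u (Suc k)) (\<lambda>t. c t * w k t)" and aw: "antideriv_on a b (w (Suc k)) (\<lambda>t. d t * u k t)" for a b k
    unfolding uS wS by (intro primitive_from_0_antideriv_on cw du)+
  define A where "A t = norm (c t) + norm (d t)" for t
  have A: "A absolutely_integrable_on {x..y}" for x y
    unfolding A_def by (intro set_integral_add(1) absolutely_integrable_norm[unfolded o_def] c d)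
  have A0: "0 \<le> A t" and cA: "norm (c t) \<le> A t" and dA: "norm (d t) \<le> A t" for t by (auto simp: A_def)
  have bnd: "\<exists>M\<ge>0. \<forall>k x. \<bar>x\<bar> \<le> N \<longrightarrow> norm (u k x) \<le> M * \<bar>primitive_from_0 A x\<bar> ^ k / fact k \<and> norm (w k x) \<le> M * \<bar>primitive_from_0 A x\<bar> ^ k / fact k" for N
  proof -
    have "bounded (w 0 ` {-N..N})"
      using cont[of 0] by (intro compact_imp_bounded compact_continuous_image) auto
    then obtain M0 where "\<forall>x\<in>{-N..N}. norm (w 0 x) \<le> M0"
      unfolding bounded_iff by auto
    then have M0: "norm (w 0 x) \<le> M0" if "\<bar>x\<bar> \<le> N" for x using that by (simp add: abs_le_iff)
    define M where "M = max (norm f0) M0"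
    have "0 \<le> M" by (simp add: M_def le_max_iff_disj)
    moreover have "norm (u k x) \<le> M * \<bar>primitive_from_0 A x\<bar> ^ k / fact k \<and> norm (w k x) \<le> M * \<bar>primitive_from_0 A x\<bar> ^ k / fact k" if "\<bar>x\<bar> \<le> N" for k x
      using that
    proof (induct k arbitrary: x)
      case 0
      then show ?case using M0[of x] by (auto simp: u0 M_def)
    next
      case (Suc k)
      have "norm (c t * w k t) \<le> A t * (M * \<bar>primitive_from_0 A t\<bar> ^ k / fact k)" if "\<bar>t\<bar> \<le> N" for t
        unfolding norm_mult using Suc(1)[OF that] cA A0 by (intro mult_mono) auto
      moreover have "norm (d t * u k t) \<le> A t * (M * \<bar>primitive_from_0 A t\<bar> ^ k / fact k)" if "\<bar>t\<bar> \<le> N" for t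
        unfolding norm_mult using Suc(1)[OF that] dA A0 by (intro mult_mono) auto
      ultimately show ?case unfolding uS wS
        using primitive_from_0_bound_power[where N=N and M=M and k=k and x=x, OF A A0 cw[where k=k]] primitive_from_0_bound_power[where N=N and M=M and k=k and x=x, OF A A0 du[where k=k]] Suc(2) by blast
    qed
    ultimately show ?thesis by blast
  qed
  have expsum: "(\<lambda>k. M * r ^ k / fact k) sums (M * exp r)" for M r :: real
    using sums_mult[OF exp_converges[of r], of M] by (simp add: field_simps)
  have sm: "summable (\<lambda>k. u k x)" "summable (\<lambda>k. w k x)" for x
  proof -
    obtain M where "\<And>k. norm (u k x) \<le> M * \<bar>primitive_from_0 A x\<bar> ^ k / fact k" "\<And>k. norm (w k x) \<le> M * \<bar>primitive_from_0 A x\<bar> ^ k / fact k"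
      using bnd[of "\<bar>x\<bar>"] by auto
    then show "summable (\<lambda>k. u k x)" "summable (\<lambda>k. w k x)"
      using sums_summable[OF expsum[of M "\<bar>primitive_from_0 A x\<bar>"]]
      by (auto intro: summable_comparison_test')
  qed
  define f where "f x = (\<Sum>k. u k x)" for x
  define h where "h x = (\<Sum>k. w k x)" for x
  have flim: "(\<lambda>n. \<Sum>k<n. u k x) \<longlonglongrightarrow> f x" and hlim: "(\<lambda>n. \<Sum>k<n. w k x) \<longlonglongrightarrow> h x" for x
    unfolding f_def h_def using sm by (auto intro: summable_LIMSEQ)
  have partial: "\<exists>B. \<forall>n x. x \<in> {a..b} \<longrightarrow> norm (\<Sum>k<n. u k x) \<le> B \<and> norm (\<Sum>k<n. w k x) \<le> B" for a b
  proof -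
    define N where "N = max \<bar>a\<bar> \<bar>b\<bar>"
    obtain M where M: "0 \<le> M" "\<And>k x. \<bar>x\<bar> \<le> N \<Longrightarrow> norm (u k x) \<le> M * \<bar>primitive_from_0 A x\<bar> ^ k / fact k \<and> norm (w k x) \<le> M * \<bar>primitive_from_0 A x\<bar> ^ k / fact k"
      using bnd[of N] by blast
    have "bounded (primitive_from_0 A ` {a..b})"
      by (intro compact_imp_bounded compact_continuous_image antideriv_on_continuous[OF primitive_from_0_antideriv_on[OF A]]) auto
    then obtain L where "\<forall>x\<in>{a..b}. norm (primitive_from_0 A x) \<le> L" unfolding bounded_iff by auto
    then have L: "\<bar>primitive_from_0 A x\<bar> \<le> L" if "x \<in> {a..b}" for x using that by simp
    have "norm (\<Sum>k<n. u k x) \<le> M * exp L \<and> norm (\<Sum>k<n. w k x) \<le> M * exp L" if x: "x \<in> {a..b}" for n x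
    proof -
      have xN: "\<bar>x\<bar> \<le> N" using x by (auto simp: N_def)
      have "(\<Sum>k<n. M * \<bar>primitive_from_0 A x\<bar> ^ k / fact k) \<le> M * exp \<bar>primitive_from_0 A x\<bar>"
        using expsum[of M "\<bar>primitive_from_0 A x\<bar>"] M(1) by (metis (no_types, lifting) sum_le_suminf sums_iff finite_lessThan abs_ge_zero divide_nonneg_pos fact_gt_zero mult_nonneg_nonneg zero_le_power)
      also have "\<dots> \<le> M * exp L" using L[OF x] M(1) by (intro mult_left_mono) auto
      finally have s: "(\<Sum>k<n. M * \<bar>primitive_from_0 A x\<bar> ^ k / fact k) \<le> M * exp L" .
      have "norm (\<Sum>k<n. u k x) \<le> (\<Sum>k<n. M * \<bar>primitive_from_0 A x\<bar> ^ k / fact k)"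
        by (rule sum_norm_le) (use M(2)[OF xN] in blast)
      moreover have "norm (\<Sum>k<n. w k x) \<le> (\<Sum>k<n. M * \<bar>primitive_from_0 A x\<bar> ^ k / fact k)"
        by (rule sum_norm_le) (use M(2)[OF xN] in blast)
      ultimately show ?thesis using s by linarith
    qed
    then show ?thesis by blast
  qed
  \<comment> \<open>dominated convergence turns the recursion for partial sums into the integral equation for the limits\<close>
  have limit: "antideriv_on a b F (\<lambda>t. g t * H t + g' t)"
    if g: "\<And>a b. g absolutely_integrable_on {a..b}" and g': "\<And>a b. g' absolutely_integrable_on {a..b}"
      and S: "\<And>n x y. x \<le> y \<Longrightarrow> Fn (Suc n) y - Fn (Suc n) x = integral {x..y} (\<lambda>t. g t * Hn n t + g' t)"
      and Hc: "\<And>n a b. continuous_on {a..b} (Hn n)"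
      and Hb: "\<And>a b. \<exists>B. \<forall>n x. x \<in> {a..b} \<longrightarrow> norm (Hn n x) \<le> B"
      and Fl: "\<And>x. (\<lambda>n. Fn n x) \<longlonglongrightarrow> F x" and Hl: "\<And>x. (\<lambda>n. Hn n x) \<longlonglongrightarrow> H x"
    for a b and g g' F H :: "real \<Rightarrow> complex" and Fn Hn :: "nat \<Rightarrow> real \<Rightarrow> complex"
  proof -
    have ii: "(\<lambda>t. g t * Hn n t + g' t) absolutely_integrable_on {x..y}" for n x y
      by (intro set_integral_add(1) continuous_times_absolutely_integrable(2) g g' Hc)
    have dc: "(\<lambda>t. g t * H t + g' t) absolutely_integrable_on {x..y} \<and>
       (\<lambda>n. integral {x..y} (\<lambda>t. g t * Hn n t + g' t)) \<longlonglongrightarrow> integral {x..y} (\<lambda>t. g t * H t + g' t)" for x y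
    proof -
      obtain B where B: "\<And>n t. t \<in> {x..y} \<Longrightarrow> norm (Hn n t) \<le> B" using Hb[of x y] by blast
      let ?D = "\<lambda>t. norm (g t) * B + norm (g' t)"
      have "?D absolutely_integrable_on {x..y}"
        by (intro set_integral_add(1) set_integrable_mult_left absolutely_integrable_norm[unfolded o_def] g g')
      then have Di: "?D integrable_on {x..y}" by (rule set_lebesgue_integral_eq_integral(1))
      have le: "norm (g t * Hn n t + g' t) \<le> ?D t" if "t \<in> {x..y}" for n t
        by (rule order_trans[OF norm_triangle_ineq]) (use B[OF that] in \<open>auto simp: norm_mult intro!: mult_left_mono\<close>)
      have li: "(\<lambda>n. g t * Hn n t + g' t) \<longlonglongrightarrow> g t * H t + g' t" for t by (intro tendsto_intros Hl)
      have ni: "(\<lambda>t. g t * Hn n t + g' t) integrable_on {x..y}" for n using ii by (rule set_lebesgue_integral_eq_integral(1))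
      note dom = dominated_convergence[OF ni Di le li]
      have "norm (g t * H t + g' t) \<le> ?D t" if "t \<in> {x..y}" for t
        using le[OF that] by (intro LIMSEQ_le_const2[OF tendsto_norm[OF li]]) auto
      then have "(\<lambda>t. g t * H t + g' t) absolutely_integrable_on {x..y}"
        by (intro absolutely_integrable_integrable_bound[OF _ dom(1) Di]) auto
      then show ?thesis using dom(2) by blast
    qed
    show ?thesis
    proof (rule antideriv_onI)
      show "(\<lambda>t. g t * H t + g' t) absolutely_integrable_on {a..b}" using dc by blast
      fix x y :: real assume "x \<le> y"
      have "(\<lambda>n. Fn (Suc n) y - Fn (Suc n) x) \<longlonglongrightarrow> F y - F x"
        by (intro tendsto_diff LIMSEQ_Suc Fl)
      moreover have "(\<lambda>n. Fn (Suc n) y - Fn (Suc n) x) \<longlonglongrightarrow> integral {x..y} (\<lambda>t. g t * H t + g' t)"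
        unfolding S[OF \<open>x \<le> y\<close>] using dc by blast
      ultimately show "F y - F x = integral {x..y} (\<lambda>t. g t * H t + g' t)" by (rule LIMSEQ_unique)
    qed
  qed
  have cs: "continuous_on {a..b} (\<lambda>x. \<Sum>k<n. u k x)" "continuous_on {a..b} (\<lambda>x. \<Sum>k<n. w k x)" for n a b
    using cont by (auto intro!: continuous_on_sum)
  have "antideriv_on a b f (\<lambda>t. c t * h t + 0)" for a b
  proof (rule limit[where Fn="\<lambda>n x. \<Sum>k<n. u k x" and Hn="\<lambda>n x. \<Sum>k<n. w k x", OF c _ _ cs(2) _ flim hlim])
    show "(\<lambda>t. 0) absolutely_integrable_on {a..b}" for a b :: real by simp
    show "\<exists>B. \<forall>n x. x \<in> {a..b} \<longrightarrow> norm (\<Sum>k<n. w k x) \<le> B" for a b using partial[of a b] by blast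
    fix n and x y :: real assume xy: "x \<le> y"
    have "(\<Sum>k<Suc n. u k y) - (\<Sum>k<Suc n. u k x) = (\<Sum>k<n. u (Suc k) y - u (Suc k) x)"
      unfolding sum.lessThan_Suc_shift by (simp add: u0 sum_subtractf)
    also have "\<dots> = (\<Sum>k<n. integral {x..y} (\<lambda>t. c t * w k t))"
      using antideriv_onD(3)[OF au[of x y] order_refl xy order_refl] by simp
    also have "\<dots> = integral {x..y} (\<lambda>t. \<Sum>k<n. c t * w k t)"
      by (rule integral_sum[symmetric]) (auto intro: set_lebesgue_integral_eq_integral(1) cw)
    finally show "(\<Sum>k<Suc n. u k y) - (\<Sum>k<Suc n. u k x) = integral {x..y} (\<lambda>t. c t * (\<Sum>k<n. w k t) + 0)"
      by (simp add: sum_distrib_left)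
  qed
  moreover have "antideriv_on a b h (\<lambda>t. d t * f t + e t)" for a b
  proof (rule limit[where Fn="\<lambda>n x. \<Sum>k<n. w k x" and Hn="\<lambda>n x. \<Sum>k<n. u k x", OF d e _ cs(1) _ hlim flim])
    show "\<exists>B. \<forall>n x. x \<in> {a..b} \<longrightarrow> norm (\<Sum>k<n. u k x) \<le> B" for a b using partial[of a b] by blast
    fix n and x y :: real assume xy: "x \<le> y"
    have dui: "(\<lambda>t. d t * u k t) integrable_on {x..y}" for k using du by (rule set_lebesgue_integral_eq_integral(1))
    have ei: "e integrable_on {x..y}" using e by (rule set_lebesgue_integral_eq_integral(1))
    have "(\<Sum>k<Suc n. w k y) - (\<Sum>k<Suc n. w k x) = (w 0 y - w 0 x) + (\<Sum>k<n. w (Suc k) y - w (Suc k) x)"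
      unfolding sum.lessThan_Suc_shift by (simp add: sum_subtractf)
    also have "w 0 y - w 0 x = integral {x..y} e"
      using antideriv_onD(3)[OF primitive_from_0_antideriv_on[OF e, of x y] order_refl xy order_refl] by (simp add: w0)
    also have "(\<Sum>k<n. w (Suc k) y - w (Suc k) x) = (\<Sum>k<n. integral {x..y} (\<lambda>t. d t * u k t))"
      using antideriv_onD(3)[OF aw[of x y] order_refl xy order_refl] by simp
    also have "\<dots> = integral {x..y} (\<lambda>t. \<Sum>k<n. d t * u k t)"
      by (rule integral_sum[symmetric]) (auto intro: dui)
    also have "integral {x..y} e + integral {x..y} (\<lambda>t. \<Sum>k<n. d t * u k t) = integral {x..y} (\<lambda>t. e t + (\<Sum>k<n. d t * u k t))"
      by (rule integral_add[symmetric]) (auto intro!: ei integrable_sum dui)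
    finally show "(\<Sum>k<Suc n. w k y) - (\<Sum>k<Suc n. w k x) = integral {x..y} (\<lambda>t. d t * (\<Sum>k<n. u k t) + e t)"
      by (simp add: sum_distrib_left add.commute)
  qed
  moreover have "f 0 = f0"
  proof -
    have "u k 0 = (if k = 0 then f0 else 0)" for k by (cases k) (auto simp: u0 uS)
    then show ?thesis unfolding f_def using sums_unique[OF sums_single[of 0 "\<lambda>_. f0"]] by simp
  qed
  moreover have "h 0 = h0"
  proof -
    have "w k 0 = (if k = 0 then h0 else 0)" for k by (cases k) (auto simp: w0 wS)
    then show ?thesis unfolding h_def using sums_unique[OF sums_single[of 0 "\<lambda>_. h0"]] by simp
  qed
  ultimately show ?thesis by (intro exI[of _ f] exI[of _ h]) simp
qed

section \<open>Lower bounds for the energy form\<close>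

lemma absolutely_integrable_bound_AE:
  fixes f :: "real \<Rightarrow> 'a::euclidean_space" and g :: "real \<Rightarrow> 'b::euclidean_space"
  assumes f: "f absolutely_integrable_on {a..b}" and g: "g \<in> borel_measurable (lebesgue_on {a..b})"
    and le: "AE x in lebesgue. x \<in> {a..b} \<longrightarrow> norm (g x) \<le> norm (f x)"
  shows "g absolutely_integrable_on {a..b}"
proof (rule set_integrable_bound[OF f _ le])
  show "set_borel_measurable lebesgue {a..b} g"
    unfolding set_borel_measurable_def using g by (subst (asm) borel_measurable_restrict_space_iff) auto
qed

lemma integral_mono_AE_interval:
  fixes f g :: "real \<Rightarrow> real"
  assumes f: "f absolutely_integrable_on {a..b}" and g: "g absolutely_integrable_on {a..b}"
    and le: "AE x in lebesgue. x \<in> {a..b} \<longrightarrow> f x \<le> g x"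
  shows "integral {a..b} f \<le> integral {a..b} g"
proof -
  have "(LINT x:{a..b}|lebesgue. f x) \<le> (LINT x:{a..b}|lebesgue. g x)"
    by (rule set_integral_mono_AE[OF f g]) (use le in auto)
  then show ?thesis using set_lebesgue_integral_eq_integral(2)[OF f] set_lebesgue_integral_eq_integral(2)[OF g] by simp
qed

lemma absolutely_integrable_measurable:
  "f absolutely_integrable_on {a..b} \<Longrightarrow> f \<in> borel_measurable (lebesgue_on {a..b})"
  for f :: "real \<Rightarrow> 'a::euclidean_space"
  unfolding set_integrable_def by (subst borel_measurable_restrict_space_iff) (auto dest: borel_measurable_integrable)

lemma absolutely_integrable_mono:
  "f absolutely_integrable_on {a..b} \<Longrightarrow> a \<le> c \<Longrightarrow> d \<le> b \<Longrightarrow> f absolutely_integrable_on {c..d}"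
  for f :: "real \<Rightarrow> 'a::euclidean_space"
  by (rule set_integrable_subset) auto

lemma antideriv_on_norm_square:
  fixes f v :: "real \<Rightarrow> complex"
  assumes "antideriv_on a b f v"
  shows "antideriv_on a b (\<lambda>x. (norm (f x))\<^sup>2) (\<lambda>x. 2 * Re (v x * cnj (f x)))"
proof -
  have "antideriv_on a b (\<lambda>x. Re (f x * cnj (f x))) (\<lambda>x. Re (v x * cnj (f x) + f x * cnj (v x)))"
    by (intro antideriv_on_linear[OF _ bounded_linear_Re] antideriv_on_mult assms antideriv_on_linear[OF _ bounded_linear_cnj])
  then show ?thesis
    by (rule antideriv_on_cong) (auto simp: complex_mult_cnj cmod_power2)
qed

text \<open>Squaring the first inequality and inserting the second one leaves \<open>X\<^bsup>2-\<sigma>\<^esup> \<le> 4PQ N\<^bsup>2-\<sigma>\<^esup>\<close>.\<close>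

lemma sup_bound_from_energy_zero:
  fixes X N E P Q \<sigma> :: real
  assumes "0 < N" "0 \<le> X" "0 \<le> E" "0 < P" "0 < Q" "0 \<le> \<sigma>" "\<sigma> \<le> 1"
    and X: "X \<le> 2 * (sqrt N * sqrt (P * E))" and E: "E \<le> Q * X powr \<sigma> * N powr (1 - \<sigma>)"
  shows "X \<le> (4 * P * Q) powr (1 / (2 - \<sigma>)) * N"
proof (cases "X = 0")
  case True then show ?thesis using assms by simp
next
  case False
  then have X0: "0 < X" using assms by simp
  have "X\<^sup>2 \<le> (2 * (sqrt N * sqrt (P * E)))\<^sup>2" using X assms by (intro power_mono) auto
  also have "\<dots> = 4 * N * (P * E)" using assms by (simp add: power_mult_distrib)
  also have "\<dots> \<le> 4 * N * (P * (Q * X powr \<sigma> * N powr (1 - \<sigma>)))"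
    using E assms by (intro mult_left_mono) auto
  also have "\<dots> = (4 * P * Q) * X powr \<sigma> * N powr (2 - \<sigma>)"
  proof -
    have "N powr (2 - \<sigma>) = N * N powr (1 - \<sigma>)" using assms(1) powr_add[of N 1 "1 - \<sigma>"] by simp
    then show ?thesis by simp
  qed
  finally have "X powr 2 \<le> (4 * P * Q) * X powr \<sigma> * N powr (2 - \<sigma>)" using X0 by simp
  moreover have "X powr 2 = X powr (2 - \<sigma>) * X powr \<sigma>" using X0 by (simp add: powr_add[symmetric])
  ultimately have "X powr (2 - \<sigma>) * X powr \<sigma> \<le> ((4 * P * Q) * N powr (2 - \<sigma>)) * X powr \<sigma>" by (simp add: mult_ac)
  then have "X powr (2 - \<sigma>) \<le> (4 * P * Q) * N powr (2 - \<sigma>)" using X0 by (simp add: mult_le_cancel_right)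
  then have "(X powr (2 - \<sigma>)) powr (1 / (2 - \<sigma>)) \<le> ((4 * P * Q) * N powr (2 - \<sigma>)) powr (1 / (2 - \<sigma>))"
    using assms by (intro powr_mono2) auto
  also have "\<dots> = (4 * P * Q) powr (1 / (2 - \<sigma>)) * N" using assms by (simp add: powr_mult powr_powr)
  finally show ?thesis using X0 assms by (simp add: powr_powr)
qed

text \<open>Without a boundary condition the mean value of \<open>|f|\<^sup>2\<close> has to be added; the square root is then absorbed by the
inequality between arithmetic and geometric mean.\<close>

lemma sup_bound_from_energy_free:
  fixes X N E P Q \<sigma> :: real
  assumes "0 < N" "0 \<le> X" "0 \<le> E" "0 < P" "0 < Q" "0 \<le> \<sigma>" "\<sigma> \<le> 1"
    and X: "X \<le> N + 2 * (sqrt N * sqrt (P * E))" and E: "E \<le> Q * X powr \<sigma> * N powr (1 - \<sigma>)"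
  shows "X \<le> (2 + 4 * P * Q) * N"
proof (cases "X \<le> N")
  case True
  have "N * 1 \<le> N * (2 + 4 * P * Q)" using assms by (intro mult_left_mono) auto
  then show ?thesis using True by (simp add: mult.commute)
next
  case False
  then have XN: "N < X" by simp
  have "X powr \<sigma> * N powr (1 - \<sigma>) \<le> X powr \<sigma> * X powr (1 - \<sigma>)"
    using XN assms by (intro mult_left_mono powr_mono2) auto
  also have "\<dots> = X" using XN assms by (simp add: powr_add[symmetric])
  finally have "Q * (X powr \<sigma> * N powr (1 - \<sigma>)) \<le> Q * X" using assms by (intro mult_left_mono) auto
  then have EX: "E \<le> Q * X" using E by (simp add: mult.assoc)
  have "sqrt N * sqrt (P * E) \<le> sqrt N * sqrt (P * (Q * X))"
    using EX assms by (intro mult_left_mono real_sqrt_le_mono) auto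
  also have "\<dots> = sqrt (2 * P * Q * N) * sqrt (X / 2)" by (simp add: real_sqrt_mult[symmetric] mult_ac)
  finally have le: "sqrt N * sqrt (P * E) \<le> sqrt (2 * P * Q * N) * sqrt (X / 2)" .
  have "2 * (sqrt (2 * P * Q * N) * sqrt (X / 2)) \<le> (sqrt (2 * P * Q * N))\<^sup>2 + (sqrt (X / 2))\<^sup>2"
    using sum_squares_bound[of "sqrt (2 * P * Q * N)" "sqrt (X / 2)"] by (simp add: mult.assoc)
  also have "\<dots> = 2 * P * Q * N + X / 2" using assms by simp
  finally have "X \<le> N + (2 * P * Q * N + X / 2)" using X le by linarith
  then show ?thesis by (simp add: algebra_simps)
qed

lemma sublevel_set_lebesgue:
  fixes h :: "real \<Rightarrow> real"
  assumes "h \<in> borel_measurable lebesgue"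
  shows "{x. h x < c} \<in> sets lebesgue"
proof -
  have "{x. h x < c} = h -` {..<c} \<inter> space lebesgue" by auto
  also have "\<dots> \<in> sets lebesgue" by (rule measurable_sets[OF assms]) auto
  finally show ?thesis .
qed

lemma neg_part_absolutely_integrable:
  assumes "q absolutely_integrable_on {a..b}"
  shows "neg_part q absolutely_integrable_on {a..b}"
proof -
  have "(\<lambda>x. (\<bar>q x\<bar> - q x) / 2) absolutely_integrable_on {a..b}"
    using absolutely_integrable_norm[OF assms]
    by (intro set_integrable_divide set_integral_diff(1) assms) (simp add: o_def)
  then show ?thesis by (simp add: neg_part_def[abs_def])
qed

text \<open>The parameters stand for \<open>P = \<parallel>1/p\<parallel>\<^sub>\<infinity>\<close>, \<open>Q = \<parallel>q\<^sub>-\<parallel>\<^sub>s\<close> and \<open>\<sigma> = 1/s\<close>, with \<open>\<sigma> = 0\<close> for \<open>s = \<infinity>\<close>, so that both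
cases of the exponent are treated together.\<close>

locale sturm_liouville =
  fixes p q r :: "real \<Rightarrow> real" and P Q \<sigma> c0 x0 :: real
  assumes r_meas: "r \<in> borel_measurable lebesgue"
    and p_loc: "\<And>a b. (\<lambda>x. 1 / p x) absolutely_integrable_on {a..b}"
    and q_loc: "\<And>a b. q absolutely_integrable_on {a..b}"
    and r_loc: "\<And>a b. r absolutely_integrable_on {a..b}"
    and p_pos: "AE x in lebesgue. 0 < p x"
    and p_le: "AE x in lebesgue. 1 / p x \<le> P"
    and r_pos: "AE x in lebesgue. 0 < r x"
    and P_pos: "0 < P" and Q_nonneg: "0 \<le> Q" and \<sigma>: "0 \<le> \<sigma>" "\<sigma> \<le> 1"
    and hoelder: "\<And>a b w X. a < b \<Longrightarrow> continuous_on {a..b} w \<Longrightarrow> (\<And>x. x \<in> {a..b} \<Longrightarrow> 0 \<le> w x) \<Longrightarrow>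
        (\<And>x. x \<in> {a..b} \<Longrightarrow> w x \<le> X) \<Longrightarrow>
        integral {a..b} (\<lambda>x. neg_part q x * w x) \<le> Q * X powr \<sigma> * integral {a..b} w powr (1 - \<sigma>)"
    and c0_pos: "0 < c0" and r_tail: "AE x in lebesgue. x0 \<le> \<bar>x\<bar> \<longrightarrow> c0 \<le> r x"
begin

definition energy :: "real \<Rightarrow> real \<Rightarrow> (real \<Rightarrow> complex) \<Rightarrow> (real \<Rightarrow> complex) \<Rightarrow> real" where
  "energy a b f v = integral {a..b} (\<lambda>x. p x * (norm (v x))\<^sup>2 + q x * (norm (f x))\<^sup>2)"

definition mass :: "real \<Rightarrow> real \<Rightarrow> (real \<Rightarrow> complex) \<Rightarrow> real" where
  "mass a b f = integral {a..b} (\<lambda>x. r x * (norm (f x))\<^sup>2)"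

text \<open>The derivative \<open>v\<close> is an explicit argument, since it is determined only almost everywhere.\<close>

definition finite_energy :: "real \<Rightarrow> real \<Rightarrow> (real \<Rightarrow> complex) \<Rightarrow> (real \<Rightarrow> complex) \<Rightarrow> bool" where
  "finite_energy a b f v \<longleftrightarrow> a < b \<and> antideriv_on a b f v \<and>
     (\<lambda>x. p x * (norm (v x))\<^sup>2) absolutely_integrable_on {a..b}"

lemma weight_norm_square_integrable:
  fixes f :: "real \<Rightarrow> complex" and w :: "real \<Rightarrow> real"
  assumes "continuous_on {a..b} f" "w absolutely_integrable_on {a..b}"
  shows "(\<lambda>x. w x * (norm (f x))\<^sup>2) absolutely_integrable_on {a..b}"
  using assms by (intro continuous_times_absolutely_integrable(2)) (auto intro!: continuous_intros)

lemma mass_nonneg: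
  assumes "continuous_on {a..b} f"
  shows "0 \<le> mass a b f"
proof -
  have "integral {a..b} (\<lambda>x. 0::real) \<le> integral {a..b} (\<lambda>x. r x * (norm (f x))\<^sup>2)"
    using r_pos by (intro integral_mono_AE_interval weight_norm_square_integrable assms r_loc) (auto elim: eventually_mono)
  then show ?thesis by (simp add: mass_def)
qed

lemma neg_part_ge: "- q x \<le> neg_part q x"
  by (auto simp: neg_part_def)

text \<open>Here \<open>X\<close> is the maximum of \<open>|f|\<^sup>2\<close>, attained at \<open>x\<close>, and \<open>y\<close> is a point where the minimum is attained, which
is at most the mean value. The increments of \<open>|f|\<^sup>2\<close> are bounded by \<open>2\<integral>|f f'|\<close> and the Cauchy--Schwarz inequality.\<close>

lemma finite_energy_estimates:
  assumes "finite_energy a b f v"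
  shows "\<exists>N E X x y.
      0 \<le> N \<and> 0 \<le> E \<and> x \<in> {a..b} \<and> y \<in> {a..b} \<and> X = (norm (f x))\<^sup>2 \<and> (\<forall>t\<in>{a..b}. (norm (f t))\<^sup>2 \<le> X) \<and>
      (norm (f y))\<^sup>2 * (b - a) \<le> N \<and> N = integral {a..b} (\<lambda>t. (norm (f t))\<^sup>2) \<and>
      (\<forall>t\<in>{a..b}. X \<le> (norm (f t))\<^sup>2 + 2 * (sqrt N * sqrt (P * E))) \<and>
      E - Q * X powr \<sigma> * N powr (1 - \<sigma>) \<le> energy a b f v"
proof -
  have ab: "a < b" and fv: "antideriv_on a b f v" and Ei: "(\<lambda>x. p x * (norm (v x))\<^sup>2) absolutely_integrable_on {a..b}"
    using assms by (auto simp: finite_energy_def)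
  have cf: "continuous_on {a..b} f" by (rule antideriv_on_continuous[OF fv])
  have va: "v absolutely_integrable_on {a..b}" using fv by (simp add: antideriv_on_def)
  have cn: "continuous_on {a..b} (\<lambda>t. (norm (f t))\<^sup>2)" by (intro continuous_intros cf)
  have ne: "{a..b} \<noteq> {}" using ab by auto
  obtain x where x: "x \<in> {a..b}" "\<And>t. t \<in> {a..b} \<Longrightarrow> (norm (f t))\<^sup>2 \<le> (norm (f x))\<^sup>2"
    using continuous_attains_sup[OF _ ne cn] by auto
  obtain y where y: "y \<in> {a..b}" "\<And>t. t \<in> {a..b} \<Longrightarrow> (norm (f y))\<^sup>2 \<le> (norm (f t))\<^sup>2"
    using continuous_attains_inf[OF _ ne cn] by auto
  define N where "N = integral {a..b} (\<lambda>t. (norm (f t))\<^sup>2)"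
  define E where "E = integral {a..b} (\<lambda>x. p x * (norm (v x))\<^sup>2)"
  define X where "X = (norm (f x))\<^sup>2"
  have fna: "(\<lambda>t. (norm (f t))\<^sup>2) absolutely_integrable_on {a..b}"
    by (rule absolutely_integrable_continuous_real[OF cn])
  have fni: "(\<lambda>t. (norm (f t))\<^sup>2) integrable_on {a..b}" using fna by (rule set_lebesgue_integral_eq_integral(1))
  have N0: "0 \<le> N" unfolding N_def by (intro Henstock_Kurzweil_Integration.integral_nonneg fni) auto
  have Nge: "(norm (f y))\<^sup>2 * (b - a) \<le> N"
  proof -
    have "integral {a..b} (\<lambda>t. (norm (f y))\<^sup>2) \<le> N" unfolding N_def
      by (intro integral_le fni y) auto
    then show ?thesis using ab by (simp add: mult.commute)
  qed
  have E0: "0 \<le> E"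
  proof -
    have "integral {a..b} (\<lambda>x. 0::real) \<le> E"
      unfolding E_def using p_pos by (intro integral_mono_AE_interval Ei) (auto elim: eventually_mono)
    then show ?thesis by simp
  qed
  have vm: "v \<in> borel_measurable (lebesgue_on {a..b})" by (rule absolutely_integrable_measurable[OF va])
  have vle: "AE t in lebesgue. (norm (v t))\<^sup>2 \<le> P * (p t * (norm (v t))\<^sup>2)"
    using p_pos p_le
  proof eventually_elim
    case (elim t)
    then have "1 \<le> P * p t" by (simp add: field_simps)
    then have "1 * (norm (v t))\<^sup>2 \<le> (P * p t) * (norm (v t))\<^sup>2" by (intro mult_right_mono) auto
    then show ?case by (simp add: mult.assoc)
  qed
  have PEi: "(\<lambda>t. P * (p t * (norm (v t))\<^sup>2)) absolutely_integrable_on {a..b}"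
    using Ei by simp
  have vna: "(\<lambda>t. (norm (v t))\<^sup>2) absolutely_integrable_on {a..b}"
  proof (rule absolutely_integrable_bound_AE[OF PEi])
    show "(\<lambda>t. (norm (v t))\<^sup>2) \<in> borel_measurable (lebesgue_on {a..b})" using vm by measurable
    show "AE t in lebesgue. t \<in> {a..b} \<longrightarrow> norm ((norm (v t))\<^sup>2) \<le> norm (P * (p t * (norm (v t))\<^sup>2))"
      using vle by eventually_elim (auto intro: order_trans[OF _ abs_ge_self])
  qed
  have "integral {a..b} (\<lambda>t. (norm (v t))\<^sup>2) \<le> integral {a..b} (\<lambda>t. P * (p t * (norm (v t))\<^sup>2))"
    using vle by (intro integral_mono_AE_interval vna PEi) (auto elim: eventually_mono)
  then have Vle: "integral {a..b} (\<lambda>t. (norm (v t))\<^sup>2) \<le> P * E" by (simp add: E_def)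
  have fm: "f \<in> borel_measurable (lebesgue_on {a..b})"
    by (rule continuous_imp_measurable_on_sets_lebesgue[OF cf]) auto
  have fnm: "(\<lambda>t. norm (f t)) \<in> borel_measurable (lebesgue_on {a..b})" using fm by measurable
  have vnm: "(\<lambda>t. norm (v t)) \<in> borel_measurable (lebesgue_on {a..b})" using vm by measurable
  note CS = Cauchy_Schwarz_interval[of "\<lambda>t. norm (f t)" a b "\<lambda>t. norm (v t)"]
  have fvi: "(\<lambda>t. norm (f t) * norm (v t)) absolutely_integrable_on {a..b}"
    by (rule CS(1)[OF fnm vnm fna vna])
  have "\<bar>integral {a..b} (\<lambda>t. norm (f t) * norm (v t))\<bar> \<le> sqrt N * sqrt (integral {a..b} (\<lambda>t. (norm (v t))\<^sup>2))"
    unfolding N_def by (rule CS(2)[OF fnm vnm fna vna])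
  also have "\<dots> \<le> sqrt N * sqrt (P * E)" using Vle N0 by (intro mult_left_mono real_sqrt_le_mono) auto
  finally have fvle: "integral {a..b} (\<lambda>t. norm (f t) * norm (v t)) \<le> sqrt N * sqrt (P * E)" by linarith
  have fvii: "(\<lambda>t. norm (f t) * norm (v t)) integrable_on {c..d}" if "a \<le> c" "d \<le> b" for c d
    using absolutely_integrable_mono[OF fvi that] by (rule set_lebesgue_integral_eq_integral(1))
  have diff: "\<bar>(norm (f t))\<^sup>2 - (norm (f s))\<^sup>2\<bar> \<le> 2 * (sqrt N * sqrt (P * E))" if st: "s \<in> {a..b}" "t \<in> {a..b}" "s \<le> t" for s t
  proof -
    have I: "((\<lambda>x. 2 * Re (v x * cnj (f x))) has_integral (norm (f t))\<^sup>2 - (norm (f s))\<^sup>2) {s..t}"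
      by (rule antideriv_onD(1)[OF antideriv_on_norm_square[OF fv]]) (use st in auto)
    have "norm (integral {s..t} (\<lambda>x. 2 * Re (v x * cnj (f x)))) \<le> integral {s..t} (\<lambda>x. 2 * (norm (f x) * norm (v x)))"
    proof (rule integral_norm_bound_integral)
      show "(\<lambda>x. 2 * Re (v x * cnj (f x))) integrable_on {s..t}" using I by blast
      show "(\<lambda>x. 2 * (norm (f x) * norm (v x))) integrable_on {s..t}"
        by (intro integrable_on_mult_right fvii) (use st in auto)
      fix x
      show "norm (2 * Re (v x * cnj (f x))) \<le> 2 * (norm (f x) * norm (v x))"
        using abs_Re_le_cmod[of "v x * cnj (f x)"] by (simp add: norm_mult abs_mult mult.commute)
    qed
    also have "\<dots> = 2 * integral {s..t} (\<lambda>x. norm (f x) * norm (v x))" by simp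
    also have "\<dots> \<le> 2 * integral {a..b} (\<lambda>x. norm (f x) * norm (v x))"
      by (intro mult_left_mono integral_subset_le fvii) (use st in auto)
    finally show ?thesis using fvle integral_unique[OF I] by simp
  qed
  have Xle: "X \<le> (norm (f t))\<^sup>2 + 2 * (sqrt N * sqrt (P * E))" if t: "t \<in> {a..b}" for t
  proof (cases "x \<le> t")
    case True
    then show ?thesis using diff[OF x(1) t] by (simp add: X_def)
  next
    case False
    then show ?thesis using diff[OF t x(1)] by (simp add: X_def)
  qed
  have Wle: "integral {a..b} (\<lambda>t. neg_part q t * (norm (f t))\<^sup>2) \<le> Q * X powr \<sigma> * N powr (1 - \<sigma>)"
    unfolding N_def X_def by (rule hoelder[OF ab cn]) (use x in auto)
  have qi: "(\<lambda>t. q t * (norm (f t))\<^sup>2) absolutely_integrable_on {a..b}"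
    by (rule weight_norm_square_integrable[OF cf q_loc])
  have ni: "(\<lambda>t. neg_part q t * (norm (f t))\<^sup>2) absolutely_integrable_on {a..b}"
    by (rule weight_norm_square_integrable[OF cf neg_part_absolutely_integrable[OF q_loc]])
  have "energy a b f v = E + integral {a..b} (\<lambda>t. q t * (norm (f t))\<^sup>2)"
    unfolding energy_def E_def by (intro integral_add set_lebesgue_integral_eq_integral(1) Ei qi)
  moreover have "integral {a..b} (\<lambda>t. - (neg_part q t * (norm (f t))\<^sup>2)) \<le> integral {a..b} (\<lambda>t. q t * (norm (f t))\<^sup>2)"
  proof (intro integral_le set_lebesgue_integral_eq_integral(1)[OF qi] integrable_neg set_lebesgue_integral_eq_integral(1)[OF ni])
    fix t
    have "(- q t) * (norm (f t))\<^sup>2 \<le> neg_part q t * (norm (f t))\<^sup>2" by (intro mult_right_mono neg_part_ge) auto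
    then show "- (neg_part q t * (norm (f t))\<^sup>2) \<le> q t * (norm (f t))\<^sup>2" by simp
  qed
  ultimately have en: "E - Q * X powr \<sigma> * N powr (1 - \<sigma>) \<le> energy a b f v" using Wle by simp
  have XT: "(norm (f t))\<^sup>2 \<le> X" if "t \<in> {a..b}" for t unfolding X_def by (rule x(2)[OF that])
  show ?thesis
    by (rule exI[of _ N], rule exI[of _ E], rule exI[of _ X], rule exI[of _ x], rule exI[of _ y])
      (intro conjI ballI N0 E0 x(1) y(1) X_def XT Nge N_def Xle en)
qed

text \<open>The weighted integral controls the unweighted one up to an exceptional set of measure \<open>\<mu>\<close>, on which
only the supremum is available.\<close>

definition weight_bound :: "real \<Rightarrow> real \<Rightarrow> bool" where
  "weight_bound G \<mu> \<longleftrightarrow> 0 \<le> \<mu> \<and> 0 \<le> G \<and> (\<forall>a b (f::real\<Rightarrow>complex) X. a < b \<longrightarrow> continuous_on {a..b} f \<longrightarrow> (\<forall>t\<in>{a..b}. (norm (f t))\<^sup>2 \<le> X) \<longrightarrow>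
     integral {a..b} (\<lambda>t. (norm (f t))\<^sup>2) \<le> G * mass a b f + \<mu> * X)"

text \<open>If the energy is negative, the kinetic part is dominated by \<open>\<integral>q\<^sub>-|f|\<^sup>2\<close>, which is what the hypothesis on \<open>X\<close> requires.
The distinction for \<open>\<sigma> = 0\<close> is due to \<open>0 powr 0 = 0\<close>.\<close>

lemma energy_lower_bound:
  assumes fe: "finite_energy a b f v" and wb: "weight_bound G \<mu>" and B: "0 \<le> B" "\<mu> * B < 1"
    and XB: "\<And>X N E x y. 0 < N \<Longrightarrow> 0 \<le> E \<Longrightarrow> 0 \<le> X \<Longrightarrow> 0 < Q \<Longrightarrow> y \<in> {a..b} \<Longrightarrow> (norm (f y))\<^sup>2 * (b - a) \<le> N \<Longrightarrow>
        (\<And>t. t \<in> {a..b} \<Longrightarrow> X \<le> (norm (f t))\<^sup>2 + 2 * (sqrt N * sqrt (P * E))) \<Longrightarrow>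
        E \<le> Q * X powr \<sigma> * N powr (1 - \<sigma>) \<Longrightarrow> X \<le> B * N"
  shows "- (Q * (if \<sigma> = 0 then 1 else B powr \<sigma>) * G / (1 - \<mu> * B)) * mass a b f \<le> energy a b f v"
proof -
  define B' where "B' = (if \<sigma> = 0 then 1 else B powr \<sigma>)"
  have ab: "a < b" and cf: "continuous_on {a..b} f" using fe antideriv_on_continuous by (auto simp: finite_energy_def)
  have G: "0 \<le> G" "0 \<le> \<mu>" using wb by (auto simp: weight_bound_def)
  have m0: "0 \<le> mass a b f" by (rule mass_nonneg[OF cf])
  have B'0: "0 \<le> B'" by (simp add: B'_def)
  have K0: "0 \<le> Q * B' * G / (1 - \<mu> * B)" using Q_nonneg B'0 G B by auto
  show ?thesis
  proof (cases "0 \<le> energy a b f v")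
    case True
    have "0 \<le> (Q * B' * G / (1 - \<mu> * B)) * mass a b f" using K0 m0 by (rule mult_nonneg_nonneg)
    then show ?thesis using True unfolding B'_def by simp
  next
    case False
    then have neg: "energy a b f v < 0" by simp
    obtain N E X x y where *: "0 \<le> N" "0 \<le> E" "y \<in> {a..b}" "X = (norm (f x))\<^sup>2" "\<forall>t\<in>{a..b}. (norm (f t))\<^sup>2 \<le> X"
      "(norm (f y))\<^sup>2 * (b - a) \<le> N" "N = integral {a..b} (\<lambda>t. (norm (f t))\<^sup>2)"
      "\<forall>t\<in>{a..b}. X \<le> (norm (f t))\<^sup>2 + 2 * (sqrt N * sqrt (P * E))"
      "E - Q * X powr \<sigma> * N powr (1 - \<sigma>) \<le> energy a b f v"
      using finite_energy_estimates[OF fe] by (elim exE conjE)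
    have X0: "0 \<le> X" using * by simp
    have W: "E < Q * X powr \<sigma> * N powr (1 - \<sigma>)" using *(9) neg by linarith
    have Q0: "0 < Q" using W *(2) Q_nonneg by (cases "Q = 0") auto
    have N0: "0 < N"
    proof (rule ccontr)
      assume "\<not> 0 < N"
      then have "N = 0" using *(1) by simp
      then show False using W *(2) by simp
    qed
    have XN: "X \<le> B * N"
      by (rule XB[OF N0 *(2) X0 Q0 *(3,6) _ less_imp_le[OF W]]) (use *(8) in blast)
    have Nle: "N \<le> G * mass a b f + \<mu> * X"
      using wb ab cf *(5) unfolding weight_bound_def *(7) by blast
    have "\<mu> * X \<le> \<mu> * (B * N)" using XN G by (intro mult_left_mono) auto
    then have "N * (1 - \<mu> * B) \<le> G * mass a b f" using Nle by (simp add: algebra_simps)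
    then have Nle2: "N \<le> G * mass a b f / (1 - \<mu> * B)" using B by (simp add: pos_le_divide_eq)
    have "Q * X powr \<sigma> * N powr (1 - \<sigma>) \<le> Q * B' * N"
    proof (cases "\<sigma> = 0")
      case True
      have "X powr 0 \<le> 1" by (cases "X = 0") auto
      then have "Q * X powr 0 * N \<le> Q * 1 * N" using Q0 N0 by (intro mult_right_mono mult_left_mono) auto
      then show ?thesis using True N0 by (simp add: B'_def)
    next
      case False
      have "X powr \<sigma> * N powr (1 - \<sigma>) \<le> (B * N) powr \<sigma> * N powr (1 - \<sigma>)"
        using XN X0 \<sigma> by (intro mult_right_mono powr_mono2) auto
      also have "\<dots> = B powr \<sigma> * N" using N0 B by (simp add: powr_mult powr_add[symmetric] mult.assoc)
      finally have "Q * (X powr \<sigma> * N powr (1 - \<sigma>)) \<le> Q * (B powr \<sigma> * N)" using Q0 by (intro mult_left_mono) auto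
      then show ?thesis using False by (simp add: B'_def mult.assoc)
    qed
    also have "\<dots> \<le> Q * B' * (G * mass a b f / (1 - \<mu> * B))" using Nle2 Q0 B'0 by (intro mult_left_mono) auto
    finally have "- (Q * B' * (G * mass a b f / (1 - \<mu> * B))) \<le> energy a b f v" using *(2,9) by linarith
    then show ?thesis unfolding B'_def by (simp add: mult_ac)
  qed
qed

lemma energy_lower_bound_vanishing:
  assumes fe: "finite_energy a b f v" and fa: "f a = 0" and wb: "weight_bound G \<mu>"
    and B: "\<mu> * (4 * P * Q) powr (1 / (2 - \<sigma>)) < 1"
  shows "- (Q * (if \<sigma> = 0 then 1 else ((4 * P * Q) powr (1 / (2 - \<sigma>))) powr \<sigma>) * G / (1 - \<mu> * (4 * P * Q) powr (1 / (2 - \<sigma>)))) * mass a b f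
     \<le> energy a b f v"
proof (rule energy_lower_bound[OF fe wb _ B])
  have ab: "a \<in> {a..b}" using fe by (auto simp: finite_energy_def)
  fix X N E :: real
  assume *: "0 < N" "0 \<le> E" "0 \<le> X" "0 < Q"
    "\<And>t. t \<in> {a..b} \<Longrightarrow> X \<le> (norm (f t))\<^sup>2 + 2 * (sqrt N * sqrt (P * E))" "E \<le> Q * X powr \<sigma> * N powr (1 - \<sigma>)"
  have "X \<le> 2 * (sqrt N * sqrt (P * E))" using *(5)[OF ab] fa by simp
  then show "X \<le> (4 * P * Q) powr (1 / (2 - \<sigma>)) * N"
    using sup_bound_from_energy_zero[OF *(1,3,2) P_pos *(4) \<sigma>] *(6) by blast
qed auto

lemma energy_lower_bound_free:
  assumes fe: "finite_energy a b f v" and ab: "1 \<le> b - a" and wb: "weight_bound G \<mu>"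
    and B: "\<mu> * (2 + 4 * P * Q) < 1"
  shows "- (Q * (if \<sigma> = 0 then 1 else (2 + 4 * P * Q) powr \<sigma>) * G / (1 - \<mu> * (2 + 4 * P * Q))) * mass a b f \<le> energy a b f v"
proof (rule energy_lower_bound[OF fe wb _ B])
  show "0 \<le> 2 + 4 * P * Q" using P_pos Q_nonneg by simp
  fix X N E :: real and y
  assume *: "0 < N" "0 \<le> E" "0 \<le> X" "0 < Q" "y \<in> {a..b}" "(norm (f y))\<^sup>2 * (b - a) \<le> N"
    "\<And>t. t \<in> {a..b} \<Longrightarrow> X \<le> (norm (f t))\<^sup>2 + 2 * (sqrt N * sqrt (P * E))" "E \<le> Q * X powr \<sigma> * N powr (1 - \<sigma>)"
  have "(norm (f y))\<^sup>2 * 1 \<le> (norm (f y))\<^sup>2 * (b - a)" using ab by (intro mult_left_mono) auto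
  then have "X \<le> N + 2 * (sqrt N * sqrt (P * E))" using *(7)[OF *(5)] *(6) by linarith
  then show "X \<le> (2 + 4 * P * Q) * N"
    using sup_bound_from_energy_free[OF *(1,3,2) P_pos *(4) \<sigma>] *(8) by blast
qed

lemma weight_bound_Omega_set:
  assumes g: "g \<in> borel_measurable lebesgue" "AE x in lebesgue. 0 \<le> g x" "AE x in lebesgue. g x \<le> G" and G: "0 \<le> G"
    and fin: "emeasure lebesgue (Omega_set r g) < \<infinity>"
  shows "weight_bound G (measure lebesgue (Omega_set r g))"
  unfolding weight_bound_def
proof (intro conjI allI impI G)
  let ?O = "Omega_set r g"
  fix a b X and f :: "real \<Rightarrow> complex"
  assume ab: "a < b" and cf: "continuous_on {a..b} f" and X: "\<forall>t\<in>{a..b}. (norm (f t))\<^sup>2 \<le> X"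
  have X0: "0 \<le> X" using X[rule_format, of a] ab by (meson atLeastAtMost_iff less_imp_le order_refl order_trans zero_le_power2)
  have Om: "?O \<in> sets lebesgue"
  proof -
    have "(\<lambda>x. r x * g x) \<in> borel_measurable lebesgue" using r_meas g(1) by simp
    from sublevel_set_lebesgue[OF this, of 1] show ?thesis by (simp add: Omega_set_def)
  qed
  have ra: "(\<lambda>x. r x * (norm (f x))\<^sup>2) absolutely_integrable_on {a..b}"
    by (rule weight_norm_square_integrable[OF cf r_loc])
  have ind: "integrable lebesgue (indicator ?O :: real \<Rightarrow> real)" using Om fin by simp
  have inda: "(indicator ?O :: real \<Rightarrow> real) absolutely_integrable_on {a..b}"
    unfolding set_integrable_def using ind by (intro integrable_mult_indicator) auto
  have "integral {a..b} (indicator ?O :: real \<Rightarrow> real) = (LINT x:{a..b}|lebesgue. indicator ?O x)"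
    using set_lebesgue_integral_eq_integral(2)[OF inda] by simp
  also have "\<dots> \<le> (LINT x|lebesgue. indicator ?O x)"
    unfolding set_lebesgue_integral_def by (intro Bochner_Integration.integral_mono ind integrable_mult_indicator) (auto simp: indicator_def)
  also have "\<dots> = measure lebesgue ?O" by simp
  finally have mle: "integral {a..b} (indicator ?O :: real \<Rightarrow> real) \<le> measure lebesgue ?O" .
  have "integral {a..b} (\<lambda>t. (norm (f t))\<^sup>2) \<le> integral {a..b} (\<lambda>t. G * (r t * (norm (f t))\<^sup>2) + X * indicator ?O t)"
  proof (rule integral_mono_AE_interval)
    show "(\<lambda>t. (norm (f t))\<^sup>2) absolutely_integrable_on {a..b}"
      by (intro absolutely_integrable_continuous_real continuous_intros cf)
    show "(\<lambda>t. G * (r t * (norm (f t))\<^sup>2) + X * indicator ?O t) absolutely_integrable_on {a..b}"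
      using ra inda by (intro set_integral_add(1)) auto
    show "AE x in lebesgue. x \<in> {a..b} \<longrightarrow> (norm (f x))\<^sup>2 \<le> G * (r x * (norm (f x))\<^sup>2) + X * indicator ?O x"
      using g(2,3) r_pos
    proof eventually_elim
      case (elim x)
      show ?case
      proof (intro impI)
        assume x: "x \<in> {a..b}"
        show "(norm (f x))\<^sup>2 \<le> G * (r x * (norm (f x))\<^sup>2) + X * indicator ?O x"
        proof (cases "x \<in> ?O")
          case True
          have "0 \<le> G * (r x * (norm (f x))\<^sup>2)" using G elim by simp
          then show ?thesis using True X x by (auto intro: add_increasing)
        next
          case False
          then have "1 \<le> r x * g x" by (simp add: Omega_set_def)
          also have "\<dots> \<le> r x * G" using elim by (intro mult_left_mono) auto
          finally have "1 * (norm (f x))\<^sup>2 \<le> (r x * G) * (norm (f x))\<^sup>2" by (intro mult_right_mono) auto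
          then show ?thesis using False by (simp add: mult_ac)
        qed
      qed
    qed
  qed
  also have "\<dots> = integral {a..b} (\<lambda>t. G * (r t * (norm (f t))\<^sup>2)) + integral {a..b} (\<lambda>t. X * indicator ?O t)"
    by (intro integral_add integrable_on_mult_right set_lebesgue_integral_eq_integral(1) ra inda)
  also have "\<dots> = G * mass a b f + X * integral {a..b} (indicator ?O)"
    by (simp add: mass_def)
  also have "\<dots> \<le> G * mass a b f + measure lebesgue ?O * X"
    using mle X0 by (simp add: mult.commute mult_left_mono)
  finally show "integral {a..b} (\<lambda>t. (norm (f t))\<^sup>2) \<le> G * mass a b f + measure lebesgue ?O * X" .
qed auto

text \<open>Take \<open>g\<close> constant and large. The exceptional sets then lie in a fixed bounded interval, where \<open>r\<close> may be small,
and decrease to a null set because \<open>r > 0\<close> almost everywhere.\<close>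

lemma weight_bound_small:
  assumes "0 < \<epsilon>"
  shows "\<exists>G \<mu>. weight_bound G \<mu> \<and> \<mu> < \<epsilon>"
proof -
  let ?A = "\<lambda>n::nat. Omega_set r (\<lambda>x. real n + (1 + 1 / c0))"
  have A: "?A n = {x. r x * (real n + (1 + 1 / c0)) < 1}" for n by (simp add: Omega_set_def)
  have Om: "?A n \<in> sets lebesgue" for n
  proof -
    have "(\<lambda>x. r x * (real n + (1 + 1 / c0))) \<in> borel_measurable lebesgue" using r_meas by simp
    from sublevel_set_lebesgue[OF this, of 1] show ?thesis by (simp add: Omega_set_def)
  qed
  have out: "AE x in lebesgue. x \<in> ?A n \<longrightarrow> x \<in> {-\<bar>x0\<bar>..\<bar>x0\<bar>}" for n
    using r_tail
  proof eventually_elim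
    case (elim x)
    show ?case
    proof (intro impI, rule ccontr)
      assume x: "x \<in> ?A n" and "x \<notin> {-\<bar>x0\<bar>..\<bar>x0\<bar>}"
      then have "c0 \<le> r x" using elim by auto
      then have "c0 * (1 / c0) \<le> r x * (real n + (1 + 1 / c0))" using c0_pos by (intro mult_mono) auto
      then show False using x c0_pos by (simp add: A)
    qed
  qed
  have fin: "emeasure lebesgue (?A n) < \<infinity>" for n
  proof -
    have "emeasure lebesgue (?A n) \<le> emeasure lebesgue {-\<bar>x0\<bar>..\<bar>x0\<bar>}"
      by (rule emeasure_mono_AE[OF out]) auto
    also have "\<dots> < \<infinity>" by simp
    finally show ?thesis .
  qed
  have "(\<lambda>n. emeasure lebesgue (?A n)) \<longlonglongrightarrow> emeasure lebesgue (\<Inter>n. ?A n)"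
  proof (rule Lim_emeasure_decseq)
    show "range ?A \<subseteq> sets lebesgue" using Om by auto
    have "x \<in> ?A n" if x: "x \<in> ?A m" and nm: "n \<le> m" for x n m
    proof (cases "0 \<le> r x")
      case True
      then have "r x * (real n + (1 + 1 / c0)) \<le> r x * (real m + (1 + 1 / c0))"
        using nm by (intro mult_left_mono) auto
      then show ?thesis using x by (simp add: A)
    next
      case False
      then have "r x * (real n + (1 + 1 / c0)) \<le> 0" using c0_pos by (intro mult_nonpos_nonneg) auto
      then show ?thesis by (simp add: A)
    qed
    then show "decseq ?A" unfolding decseq_def by blast
    show "emeasure lebesgue (?A n) \<noteq> \<infinity>" for n using fin[of n] by simp
  qed
  moreover have "emeasure lebesgue (\<Inter>n. ?A n) = 0"
  proof -
    have "AE x in lebesgue. x \<notin> (\<Inter>n. ?A n)"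
      using r_pos
    proof eventually_elim
      case (elim x)
      obtain n :: nat where "1 / r x \<le> real n" using real_arch_simple by blast
      then have "1 \<le> r x * real n" using elim by (simp add: field_simps)
      also have "\<dots> \<le> r x * (real n + (1 + 1 / c0))" using elim c0_pos by (intro mult_left_mono) auto
      finally have "x \<notin> ?A n" by (simp add: A)
      then show ?case by blast
    qed
    moreover have "(\<Inter>n. ?A n) \<in> sets lebesgue" using Om by blast
    ultimately show ?thesis using AE_iff_null_sets by blast
  qed
  ultimately have "(\<lambda>n. emeasure lebesgue (?A n)) \<longlonglongrightarrow> 0" by simp
  then have "eventually (\<lambda>n. emeasure lebesgue (?A n) < ennreal \<epsilon>) sequentially"
    using assms by (intro order_tendstoD) auto
  then obtain n where n: "emeasure lebesgue (?A n) < ennreal \<epsilon>" by (auto simp: eventually_sequentially)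
  then have "measure lebesgue (?A n) < \<epsilon>"
    using fin[of n] assms by (simp add: emeasure_eq_ennreal_measure ennreal_less_iff)
  moreover have "weight_bound (real n + (1 + 1 / c0)) (measure lebesgue (?A n))"
    using c0_pos fin[of n] by (intro weight_bound_Omega_set) auto
  ultimately show ?thesis by blast
qed

lemma energy_coercive:
  "\<exists>K\<ge>0. \<forall>a b f v. finite_energy a b f v \<longrightarrow> 1 \<le> b - a \<longrightarrow> - K * mass a b f \<le> energy a b f v"
proof -
  have c: "0 < 1 / (2 + 4 * P * Q)" using P_pos Q_nonneg by (simp add: add_pos_nonneg)
  obtain G \<mu> where wb: "weight_bound G \<mu>" and mu: "\<mu> < 1 / (2 + 4 * P * Q)" using weight_bound_small[OF c] by blast
  have B: "\<mu> * (2 + 4 * P * Q) < 1" using mu c by (simp add: field_simps)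
  have "0 \<le> Q * (if \<sigma> = 0 then 1 else (2 + 4 * P * Q) powr \<sigma>) * G / (1 - \<mu> * (2 + 4 * P * Q))"
    using B wb Q_nonneg by (auto simp: weight_bound_def)
  then show ?thesis using energy_lower_bound_free[OF _ _ wb B] by blast
qed

end

section \<open>Green formula and the limit-point property\<close>

text \<open>The step from vanishing mass or kinetic energy to pointwise vanishing: the integrand is zero almost everywhere,
hence \<open>g\<close> is, and \<open>g\<close> is continuous.\<close>

lemma weighted_integral_zero:
  fixes w g :: "real \<Rightarrow> real"
  assumes ab: "a < b" and w: "w absolutely_integrable_on {a..b}" "AE x in lebesgue. 0 < w x"
    and g: "continuous_on {a..b} g" "\<And>x. x \<in> {a..b} \<Longrightarrow> 0 \<le> g x"
    and z: "integral {a..b} (\<lambda>x. w x * g x) = 0" and x: "x \<in> {a..b}"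
  shows "g x = 0"
proof -
  have wg: "(\<lambda>x. w x * g x) absolutely_integrable_on {a..b}"
    by (rule continuous_times_absolutely_integrable(2)[OF g(1) w(1)])
  have int: "integrable lebesgue (\<lambda>x. indicator {a..b} x *\<^sub>R (w x * g x))"
    using wg by (simp only: set_integrable_def)
  have "(LINT x|lebesgue. indicator {a..b} x *\<^sub>R (w x * g x)) = 0"
    using set_lebesgue_integral_eq_integral(2)[OF wg] z by (simp add: set_lebesgue_integral_def)
  moreover have "AE x in lebesgue. 0 \<le> indicator {a..b} x *\<^sub>R (w x * g x)"
    using w(2) by eventually_elim (use g(2) in \<open>auto simp: indicator_def\<close>)
  ultimately have "AE x in lebesgue. indicator {a..b} x *\<^sub>R (w x * g x) = 0"
    using integral_nonneg_eq_0_iff_AE[OF int] by blast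
  then have "AE x in lebesgue. x \<in> {a..b} \<longrightarrow> g x \<le> 0"
    using w(2) by eventually_elim auto
  then have "integral {a..b} g \<le> integral {a..b} (\<lambda>x. 0)"
    by (intro integral_mono_AE_interval absolutely_integrable_continuous_real g(1)) auto
  moreover have "0 \<le> integral {a..b} g"
    by (intro Henstock_Kurzweil_Integration.integral_nonneg integrable_continuous_interval g)
  ultimately have "integral {a..b} g = 0" by simp
  then have "(g has_integral 0) (cbox a b)"
    using integrable_continuous_interval[OF g(1)] by (simp add: has_integral_integrable_integral)
  then show ?thesis using has_integral_0_cbox_imp_0[of a b g x] g x ab by auto
qed

lemma continuous_on_UNIV_if_intervals:
  fixes f :: "real \<Rightarrow> 'a::topological_space"
  assumes "\<And>a b. continuous_on {a..b} f"
  shows "continuous_on UNIV f"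
proof -
  have "isCont f x" for x
    by (rule continuous_on_interior[OF assms[of "x - 1" "x + 1"]]) (simp add: interior_atLeastAtMost_real)
  then show ?thesis by (simp add: continuous_at_imp_continuous_on)
qed

lemma of_real_norm_square: "(complex_of_real (norm z))\<^sup>2 = z * cnj z"
  by (simp add: complex_norm_square flip: of_real_power)

context sturm_liouville
begin

definition velocity :: "(real \<Rightarrow> complex) \<Rightarrow> real \<Rightarrow> complex" where
  "velocity h = (\<lambda>x. complex_of_real (1 / p x) * h x)"

text \<open>The equation \<open>\<tau>f = k\<close> as a first order system for \<open>f\<close> and its quasi-derivative \<open>h = pf'\<close>.\<close>

definition solves :: "(real \<Rightarrow> complex) \<Rightarrow> (real \<Rightarrow> complex) \<Rightarrow> (real \<Rightarrow> complex) \<Rightarrow> bool" where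
  "solves f h k \<longleftrightarrow> (\<forall>a b. antideriv_on a b f (velocity h)) \<and>
     (\<forall>a b. antideriv_on a b h (\<lambda>x. complex_of_real (q x) * f x - complex_of_real (r x) * k x))"

definition source :: "real \<Rightarrow> real \<Rightarrow> (real \<Rightarrow> complex) \<Rightarrow> (real \<Rightarrow> complex) \<Rightarrow> complex" where
  "source a b k f = integral {a..b} (\<lambda>x. complex_of_real (r x) * k x * cnj (f x))"

text \<open>The sesquilinear form belonging to the energy. Here \<open>h\<close> is the quasi-derivative of \<open>u\<close> and \<open>v\<close> the derivative
of \<open>f\<close>, so that \<open>h cnj v\<close> stands for \<open>pu' cnj f'\<close>.\<close>

definition form :: "real \<Rightarrow> real \<Rightarrow> (real \<Rightarrow> complex) \<Rightarrow> (real \<Rightarrow> complex) \<Rightarrow> (real \<Rightarrow> complex) \<Rightarrow> (real \<Rightarrow> complex) \<Rightarrow> complex" where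
  "form a b u h f v = integral {a..b} (\<lambda>x. h x * cnj (v x) + complex_of_real (q x) * u x * cnj (f x))"

lemma solves_add_scaled:
  assumes "solves f h k" "solves f' h' k'"
  shows "solves (\<lambda>x. f x + c * f' x) (\<lambda>x. h x + c * h' x) (\<lambda>x. k x + c * k' x)"
proof -
  have "antideriv_on a b (\<lambda>x. f x + c * f' x) (velocity (\<lambda>x. h x + c * h' x))" for a b
  proof (rule antideriv_on_cong)
    show "antideriv_on a b (\<lambda>x. f x + c * f' x) (\<lambda>x. velocity h x + c * velocity h' x)"
      using assms unfolding solves_def
      by (intro antideriv_on_add antideriv_on_linear[OF _ bounded_linear_mult_right]) auto
  qed (auto simp: velocity_def algebra_simps)
  moreover have "antideriv_on a b (\<lambda>x. h x + c * h' x) (\<lambda>x. complex_of_real (q x) * (f x + c * f' x) - complex_of_real (r x) * (k x + c * k' x))" for a b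
  proof (rule antideriv_on_cong)
    show "antideriv_on a b (\<lambda>x. h x + c * h' x) (\<lambda>x. (complex_of_real (q x) * f x - complex_of_real (r x) * k x) + c * (complex_of_real (q x) * f' x - complex_of_real (r x) * k' x))"
      using assms unfolding solves_def
      by (intro antideriv_on_add antideriv_on_linear[OF _ bounded_linear_mult_right]) auto
  qed (auto simp: algebra_simps)
  ultimately show ?thesis by (simp add: solves_def)
qed

lemma solves_continuous:
  assumes "solves f h k"
  shows "continuous_on S f" "continuous_on S h"
proof -
  have "continuous_on UNIV f" "continuous_on UNIV h"
    using assms by (auto intro!: continuous_on_UNIV_if_intervals antideriv_on_continuous simp: solves_def)
  then show "continuous_on S f" "continuous_on S h" by (auto intro: continuous_on_subset)
qed

lemma of_real_absolutely_integrable: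
  "w absolutely_integrable_on {a..b} \<Longrightarrow> (\<lambda>x. complex_of_real (w x)) absolutely_integrable_on {a..b}"
  for w :: "real \<Rightarrow> real"
  using absolutely_integrable_linear[OF _ bounded_linear_of_real] by (auto simp: o_def)

lemma solves_source_integrable:
  assumes "solves f h k"
  shows "(\<lambda>x. complex_of_real (r x) * k x) absolutely_integrable_on {a..b}"
proof -
  have 1: "(\<lambda>x. complex_of_real (q x) * f x) absolutely_integrable_on {a..b}"
    by (intro continuous_times_absolutely_integrable(2) solves_continuous(1)[OF assms] of_real_absolutely_integrable q_loc)
  have 2: "(\<lambda>x. complex_of_real (q x) * f x - complex_of_real (r x) * k x) absolutely_integrable_on {a..b}"
    using assms by (simp add: solves_def antideriv_on_def)
  from set_integral_diff(1)[OF 1 2] show ?thesis by simp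
qed

lemma Green_formula:
  assumes u: "solves u h k" and f: "antideriv_on a b f v" and ab: "a \<le> b"
  shows "form a b u h f v = h b * cnj (f b) - h a * cnj (f a) + source a b k f"
proof -
  have cf: "continuous_on {a..b} f" by (rule antideriv_on_continuous[OF f])
  have ccf: "continuous_on {a..b} (\<lambda>x. cnj (f x))" by (intro continuous_intros cf)
  have "antideriv_on a b h (\<lambda>x. complex_of_real (q x) * u x - complex_of_real (r x) * k x)"
    using u by (simp add: solves_def)
  from antideriv_on_mult[OF this antideriv_on_linear[OF f bounded_linear_cnj]]
  have "((\<lambda>x. (complex_of_real (q x) * u x - complex_of_real (r x) * k x) * cnj (f x) + h x * cnj (v x)) has_integral
      h b * cnj (f b) - h a * cnj (f a)) {a..b}"
    by (rule antideriv_onD(1)) (use ab in auto)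
  moreover have "((\<lambda>x. complex_of_real (r x) * k x * cnj (f x)) has_integral source a b k f) {a..b}"
    unfolding source_def using continuous_times_absolutely_integrable(2)[OF ccf solves_source_integrable[OF u]]
    by (intro integrable_integral) (auto dest: set_lebesgue_integral_eq_integral(1))
  ultimately have "((\<lambda>x. ((complex_of_real (q x) * u x - complex_of_real (r x) * k x) * cnj (f x) + h x * cnj (v x)) + complex_of_real (r x) * k x * cnj (f x)) has_integral
      (h b * cnj (f b) - h a * cnj (f a)) + source a b k f) {a..b}" by (rule has_integral_add)
  then have "((\<lambda>x. h x * cnj (v x) + complex_of_real (q x) * u x * cnj (f x)) has_integral
      (h b * cnj (f b) - h a * cnj (f a)) + source a b k f) {a..b}"
    by (rule has_integral_eq[rotated]) (simp add: algebra_simps)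
  then show ?thesis unfolding form_def by (rule integral_unique)
qed

text \<open>At points with \<open>p x = 0\<close> both sides vanish by the convention for division by zero.\<close>

lemma kinetic_eq: "p x * (norm (velocity h x))\<^sup>2 = (1 / p x) * (norm (h x))\<^sup>2"
  by (cases "p x = 0") (auto simp: velocity_def norm_mult norm_divide power_mult_distrib power2_eq_square divide_simps)

lemma solves_finite_energy:
  assumes "solves u h k" "a < b"
  shows "finite_energy a b u (velocity h)"
  unfolding finite_energy_def kinetic_eq
  using assms weight_norm_square_integrable[OF solves_continuous(2)[OF assms(1)] p_loc] by (simp add: solves_def)

lemma energy_eq_form:
  assumes "solves u h k" "a < b"
  shows "complex_of_real (energy a b u (velocity h)) = form a b u h u (velocity h)"
proof -
  have pt: "h x * cnj (velocity h x) + complex_of_real (q x) * u x * cnj (u x) =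
     complex_of_real (p x * (norm (velocity h x))\<^sup>2 + q x * (norm (u x))\<^sup>2)" for x
  proof -
    have "h x * cnj (velocity h x) = complex_of_real ((1 / p x) * (norm (h x))\<^sup>2)"
      by (simp add: velocity_def of_real_norm_square)
    then show ?thesis unfolding kinetic_eq by (simp add: of_real_norm_square)
  qed
  have "(\<lambda>x. p x * (norm (velocity h x))\<^sup>2 + q x * (norm (u x))\<^sup>2) integrable_on {a..b}"
  proof (rule integrable_add)
    show "(\<lambda>x. p x * (norm (velocity h x))\<^sup>2) integrable_on {a..b}"
      using solves_finite_energy[OF assms] by (simp add: finite_energy_def set_lebesgue_integral_eq_integral(1))
    show "(\<lambda>x. q x * (norm (u x))\<^sup>2) integrable_on {a..b}"
      by (intro set_lebesgue_integral_eq_integral(1) weight_norm_square_integrable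
        solves_continuous(1)[OF assms(1)] q_loc)
  qed
  from has_integral_of_real[OF integrable_integral[OF this], where 'b=complex]
  show ?thesis unfolding form_def energy_def pt by (simp add: integral_unique)
qed

lemma energy_Green:
  assumes u: "solves u h k" and ab: "a < b"
  shows "complex_of_real (energy a b u (velocity h)) = h b * cnj (u b) - h a * cnj (u a) + source a b k u"
  unfolding energy_eq_form[OF u ab] using u ab by (intro Green_formula[OF u]) (auto simp: solves_def)

lemma source_scaled:
  assumes "continuous_on {a..b} u"
  shows "source a b (\<lambda>x. z * u x) u = z * complex_of_real (mass a b u)"
proof -
  have i: "(\<lambda>x. r x * (norm (u x))\<^sup>2) integrable_on {a..b}"
    using weight_norm_square_integrable[OF assms r_loc] by (rule set_lebesgue_integral_eq_integral(1))
  have "((\<lambda>x. complex_of_real (r x * (norm (u x))\<^sup>2)) has_integral complex_of_real (mass a b u)) {a..b}"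
    unfolding mass_def using i by (intro has_integral_of_real integrable_integral)
  from has_integral_mult_right[OF this, of z]
  have "((\<lambda>x. complex_of_real (r x) * (z * u x) * cnj (u x)) has_integral z * complex_of_real (mass a b u)) {a..b}"
    by (rule has_integral_eq[rotated]) (simp add: of_real_norm_square mult_ac)
  then show ?thesis unfolding source_def by (rule integral_unique)
qed

lemma mass_zero_imp:
  assumes "a < b" "continuous_on {a..b} f" "mass a b f = 0" "x \<in> {a..b}"
  shows "f x = 0"
proof -
  have "(norm (f x))\<^sup>2 = 0"
    using assms(3) unfolding mass_def
    by (intro weighted_integral_zero[OF assms(1) r_loc r_pos _ _ _ assms(4), of "\<lambda>x. (norm (f x))\<^sup>2"])
       (auto intro!: continuous_intros assms(2))
  then show ?thesis by simp
qed

lemma solves_zero_imp_momentum_zero: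
  assumes u: "solves u h k" and ab: "a < b" and z: "\<And>x. x \<in> {a..b} \<Longrightarrow> u x = 0" and x: "x \<in> {a..b}"
  shows "h x = 0"
proof -
  have "source a b k u = integral {a..b} (\<lambda>x. 0)"
    unfolding source_def by (rule integral_cong) (simp add: z)
  then have "energy a b u (velocity h) = 0"
    using energy_Green[OF u ab] z[of a] z[of b] ab by simp
  moreover have "energy a b u (velocity h) = integral {a..b} (\<lambda>x. (1 / p x) * (norm (h x))\<^sup>2)"
    unfolding energy_def kinetic_eq by (rule integral_cong) (simp add: z)
  ultimately have e0: "integral {a..b} (\<lambda>x. (1 / p x) * (norm (h x))\<^sup>2) = 0" by simp
  have pos: "AE x in lebesgue. 0 < 1 / p x" using p_pos by eventually_elim simp
  have "(norm (h x))\<^sup>2 = 0"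
    using e0 by (intro weighted_integral_zero[OF ab p_loc pos _ _ _ x, of "\<lambda>x. (norm (h x))\<^sup>2"])
       (auto intro!: continuous_intros solves_continuous(2)[OF u])
  then show ?thesis by simp
qed

lemma mass_le_total:
  assumes u: "continuous_on {a..b} u" and i: "integrable lebesgue (\<lambda>x. r x * (norm (u x))\<^sup>2)"
  shows "mass a b u \<le> (LINT x|lebesgue. r x * (norm (u x))\<^sup>2)"
proof -
  have ra: "(\<lambda>x. r x * (norm (u x))\<^sup>2) absolutely_integrable_on {a..b}" by (rule weight_norm_square_integrable[OF u r_loc])
  have "mass a b u = (LINT x:{a..b}|lebesgue. r x * (norm (u x))\<^sup>2)"
    unfolding mass_def using set_lebesgue_integral_eq_integral(2)[OF ra] by simp
  also have "\<dots> \<le> (LINT x|lebesgue. r x * (norm (u x))\<^sup>2)"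
    unfolding set_lebesgue_integral_def
  proof (rule integral_mono_AE)
    show "integrable lebesgue (\<lambda>x. indicator {a..b} x *\<^sub>R (r x * (norm (u x))\<^sup>2))"
      using ra by (simp only: set_integrable_def)
    show "AE x in lebesgue. indicator {a..b} x *\<^sub>R (r x * (norm (u x))\<^sup>2) \<le> r x * (norm (u x))\<^sup>2"
      using r_pos by eventually_elim (auto simp: indicator_def)
  qed (rule i)
  finally show ?thesis .
qed

lemma norm_square_increment:
  assumes u: "solves u h k" and st: "s \<le> t"
  shows "(norm (u t))\<^sup>2 - (norm (u s))\<^sup>2 = integral {s..t} (\<lambda>x. (1 / p x) * (2 * Re (h x * cnj (u x))))"
    and "(\<lambda>x. (1 / p x) * (2 * Re (h x * cnj (u x)))) absolutely_integrable_on {s..t}"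
proof -
  have e: "2 * Re (velocity h x * cnj (u x)) = (1 / p x) * (2 * Re (h x * cnj (u x)))" for x
  proof -
    have "velocity h x * cnj (u x) = complex_of_real (1 / p x) * (h x * cnj (u x))"
      by (simp add: velocity_def mult.assoc)
    then have "Re (velocity h x * cnj (u x)) = (1 / p x) * Re (h x * cnj (u x))"
      by (simp only: Re_complex_of_real Im_complex_of_real times_complex.simps)
    then show ?thesis by simp
  qed
  have "antideriv_on s t u (velocity h)" using u by (simp add: solves_def)
  note A = antideriv_on_norm_square[OF this, unfolded e]
  show "(norm (u t))\<^sup>2 - (norm (u s))\<^sup>2 = integral {s..t} (\<lambda>x. (1 / p x) * (2 * Re (h x * cnj (u x))))"
    using antideriv_onD(3)[OF A order_refl st order_refl] by simp
  show "(\<lambda>x. (1 / p x) * (2 * Re (h x * cnj (u x)))) absolutely_integrable_on {s..t}"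
    using A by (simp add: antideriv_on_def)
qed

lemma mass_tail_ge:
  assumes u: "continuous_on {s..t} u" and st: "s \<le> t" and m: "\<And>x. x \<in> {s..t} \<Longrightarrow> m \<le> (norm (u x))\<^sup>2" and m0: "0 \<le> m"
    and far: "\<And>x. x \<in> {s..t} \<Longrightarrow> x0 \<le> \<bar>x\<bar>"
  shows "c0 * m * (t - s) \<le> mass s t u"
proof -
  have "integral {s..t} (\<lambda>x. c0 * m) \<le> integral {s..t} (\<lambda>x. r x * (norm (u x))\<^sup>2)"
  proof (rule integral_mono_AE_interval)
    show "AE x in lebesgue. x \<in> {s..t} \<longrightarrow> c0 * m \<le> r x * (norm (u x))\<^sup>2"
      using r_tail
    proof eventually_elim
      case (elim x)
      show ?case
      proof
        assume x: "x \<in> {s..t}"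
        then have "c0 \<le> r x" using elim far by blast
        then show "c0 * m \<le> r x * (norm (u x))\<^sup>2" using m[OF x] m0 c0_pos by (intro mult_mono) auto
      qed
    qed
  qed (auto intro!: weight_norm_square_integrable u r_loc)
  then show ?thesis using st by (simp add: mass_def mult_ac)
qed

text \<open>Injectivity of \<open>T - l\<close> for one \<open>l\<close> far to the left. The coercivity constant \<open>K\<close> is valid for intervals of length
at least one without boundary conditions, so the boundary term \<open>F\<close> of the Green formula increases over
such intervals. Since \<open>(|u|\<^sup>2)' = 2F/p\<close>, a positive value of \<open>F\<close> makes \<open>|u|\<^sup>2\<close> increasing towards \<open>+\<infinity>\<close>, a
negative one makes it decreasing from \<open>-\<infinity>\<close>; neither is square integrable, because \<open>r\<close> is bounded below near infinity.
Once \<open>F = 0\<close>, the Green formula leaves no mass for \<open>u\<close>.\<close>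

theorem limit_point:
  assumes K: "\<And>a b f v. finite_energy a b f v \<Longrightarrow> 1 \<le> b - a \<Longrightarrow> - K * mass a b f \<le> energy a b f v"
    and l: "l < - K" and u: "solves u h (\<lambda>x. complex_of_real l * u x)"
    and i: "integrable lebesgue (\<lambda>x. r x * (norm (u x))\<^sup>2)"
  shows "u x = 0"
proof -
  define F where "F t = Re (h t * cnj (u t))" for t
  let ?T = "LINT x|lebesgue. r x * (norm (u x))\<^sup>2"
  have cu: "continuous_on S u" for S by (rule solves_continuous(1)[OF u])
  have inc: "(- K - l) * mass a b u \<le> F b - F a" if ab: "1 \<le> b - a" for a b
  proof -
    have lt: "a < b" using ab by simp
    have "complex_of_real (energy a b u (velocity h)) = h b * cnj (u b) - h a * cnj (u a) + complex_of_real (l * mass a b u)"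
      using energy_Green[OF u lt] source_scaled[OF cu] by simp
    from arg_cong[OF this, of Re] have "energy a b u (velocity h) = F b - F a + l * mass a b u"
      by (simp add: F_def)
    then show ?thesis using K[OF solves_finite_energy[OF u lt] ab] by (simp add: algebra_simps)
  qed
  have Fmono: "F a \<le> F b" if "1 \<le> b - a" for a b
  proof -
    have "0 \<le> (- K - l) * mass a b u" using l mass_nonneg[OF cu] by (intro mult_nonneg_nonneg) auto
    then show ?thesis using inc[OF that] by simp
  qed
  have grow: False if m: "0 < m" and far: "\<And>L. 0 \<le> L \<Longrightarrow> c0 * m * L \<le> ?T" for m
  proof -
    have T0: "0 \<le> ?T" using far[of 0] by simp
    have "c0 * m * ((?T + 1) / (c0 * m)) \<le> ?T" using m c0_pos T0 by (intro far) auto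
    then show False using m c0_pos by simp
  qed
  have pos: "AE x in lebesgue. 0 < 1 / p x" using p_pos by eventually_elim simp
  have "F y \<le> 0" for y
  proof (rule ccontr)
    assume "\<not> F y \<le> 0"
    then have Fy: "0 < F y" by simp
    define s where "s = max (y + 1) \<bar>x0\<bar>"
    have Fs: "0 < F t" if "s \<le> t" for t
    proof -
      have "F y \<le> F t" by (rule Fmono) (use that in \<open>auto simp: s_def\<close>)
      then show ?thesis using Fy by linarith
    qed
    have us: "(norm (u s))\<^sup>2 \<le> (norm (u t))\<^sup>2" if st: "s \<le> t" for t
    proof -
      have "integral {s..t} (\<lambda>x. 0) \<le> integral {s..t} (\<lambda>x. (1 / p x) * (2 * Re (h x * cnj (u x))))"
      proof (rule integral_mono_AE_interval[OF _ norm_square_increment(2)[OF u st]])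
        show "AE x in lebesgue. x \<in> {s..t} \<longrightarrow> 0 \<le> (1 / p x) * (2 * Re (h x * cnj (u x)))"
          using pos
        proof eventually_elim
          case (elim x)
          show ?case
          proof
            assume "x \<in> {s..t}"
            then have "0 < F x" using Fs by simp
            then have "0 \<le> (1 / p x) * (2 * F x)" using elim by (intro mult_nonneg_nonneg) auto
            then show "0 \<le> (1 / p x) * (2 * Re (h x * cnj (u x)))" by (simp only: F_def)
          qed
        qed
      qed auto
      then have "0 \<le> (norm (u t))\<^sup>2 - (norm (u s))\<^sup>2"
        unfolding norm_square_increment(1)[OF u st] by (simp only: integral_0)
      then show ?thesis by linarith
    qed
    have "u s \<noteq> 0" using Fs[of s] by (auto simp: F_def)
    then have m: "0 < (norm (u s))\<^sup>2" by simp
    show False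
    proof (rule grow[OF m])
      fix L :: real assume L: "0 \<le> L"
      have "c0 * (norm (u s))\<^sup>2 * (s + L - s) \<le> mass s (s + L) u"
        using us L by (intro mass_tail_ge cu) (auto simp: s_def)
      then show "c0 * (norm (u s))\<^sup>2 * L \<le> ?T" using mass_le_total[OF cu i, of s "s + L"] by simp
    qed
  qed
  moreover have "0 \<le> F y" for y
  proof (rule ccontr)
    assume "\<not> 0 \<le> F y"
    then have Fy: "F y < 0" by simp
    define s where "s = min (y - 1) (- \<bar>x0\<bar>)"
    have Fs: "F t < 0" if "t \<le> s" for t
    proof -
      have "F t \<le> F y" by (rule Fmono) (use that in \<open>auto simp: s_def\<close>)
      then show ?thesis using Fy by linarith
    qed
    have us: "(norm (u s))\<^sup>2 \<le> (norm (u t))\<^sup>2" if st: "t \<le> s" for t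
    proof -
      have "integral {t..s} (\<lambda>x. (1 / p x) * (2 * Re (h x * cnj (u x)))) \<le> integral {t..s} (\<lambda>x. 0)"
      proof (rule integral_mono_AE_interval[OF norm_square_increment(2)[OF u st]])
        show "AE x in lebesgue. x \<in> {t..s} \<longrightarrow> (1 / p x) * (2 * Re (h x * cnj (u x))) \<le> 0"
          using pos
        proof eventually_elim
          case (elim x)
          show ?case
          proof
            assume "x \<in> {t..s}"
            then have "F x < 0" using Fs by simp
            then have "(1 / p x) * (2 * F x) \<le> 0" using elim by (intro mult_nonneg_nonpos) auto
            then show "(1 / p x) * (2 * Re (h x * cnj (u x))) \<le> 0" by (simp only: F_def)
          qed
        qed
      qed auto
      then have "(norm (u s))\<^sup>2 - (norm (u t))\<^sup>2 \<le> 0"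
        unfolding norm_square_increment(1)[OF u st] by (simp only: integral_0)
      then show ?thesis by linarith
    qed
    have "u s \<noteq> 0" using Fs[of s] by (auto simp: F_def)
    then have m: "0 < (norm (u s))\<^sup>2" by simp
    show False
    proof (rule grow[OF m])
      fix L :: real assume L: "0 \<le> L"
      have "c0 * (norm (u s))\<^sup>2 * (s - (s - L)) \<le> mass (s - L) s u"
        using us L by (intro mass_tail_ge cu) (auto simp: s_def)
      then show "c0 * (norm (u s))\<^sup>2 * L \<le> ?T" using mass_le_total[OF cu i, of "s - L" s] by simp
    qed
  qed
  ultimately have F0: "F y = 0" for y by (meson order_antisym)
  have "(- K - l) * mass (x - 1) (x + 1) u \<le> 0" using inc[where a="x - 1" and b="x + 1"] F0 by simp
  then have "mass (x - 1) (x + 1) u \<le> 0" using l by (simp add: mult_le_0_iff)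
  then have "mass (x - 1) (x + 1) u = 0" using mass_nonneg[OF cu, of "x - 1" "x + 1"] by simp
  then show "u x = 0" by (intro mass_zero_imp[OF _ cu, of "x - 1" "x + 1"]) auto
qed

end

section \<open>The weighted Hilbert space\<close>

lemma solve_two_by_two:
  fixes a b c d e g :: complex
  assumes inj: "\<And>A B. A * a + B * b = 0 \<Longrightarrow> A * c + B * d = 0 \<Longrightarrow> A = 0 \<and> B = 0"
  shows "\<exists>A B. A * a + B * b = e \<and> A * c + B * d = g"
proof -
  have D: "a * d - b * c \<noteq> 0"
  proof
    assume D0: "a * d - b * c = 0"
    have 1: "b = 0 \<and> - a = 0" by (rule inj) (use D0 in \<open>auto simp: algebra_simps\<close>)
    have 2: "d = 0 \<and> - c = 0" by (rule inj) (use D0 in \<open>auto simp: algebra_simps\<close>)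
    have "(1::complex) = 0 \<and> (0::complex) = 0" by (rule inj) (use 1 2 in auto)
    then show False by simp
  qed
  show ?thesis
  proof (intro exI conjI)
    show "((e * d - b * g) / (a * d - b * c)) * a + ((a * g - e * c) / (a * d - b * c)) * b = e"
      using D by (simp add: divide_simps) (simp add: algebra_simps)
    show "((e * d - b * g) / (a * d - b * c)) * c + ((a * g - e * c) / (a * d - b * c)) * d = g"
      using D by (simp add: divide_simps) (simp add: algebra_simps)
  qed
qed

lemma norm_square_add_le: "(norm (x + y))\<^sup>2 \<le> 2 * (norm x)\<^sup>2 + 2 * (norm y)\<^sup>2"
  for x y :: "'a::real_normed_vector"
proof -
  have "(norm (x + y))\<^sup>2 \<le> (norm x + norm y)\<^sup>2" by (intro power_mono norm_triangle_ineq) auto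
  also have "\<dots> \<le> 2 * (norm x)\<^sup>2 + 2 * (norm y)\<^sup>2"
    using sum_squares_bound[of "norm x" "norm y"] by (simp add: power2_sum)
  finally show ?thesis .
qed

context sturm_liouville
begin

abbreviation M :: "real measure" where "M \<equiv> weighted_measure r"

abbreviation L2 :: "(real \<Rightarrow> complex) set" where "L2 \<equiv> L2_space M"

definition norm_sq :: "(real \<Rightarrow> complex) \<Rightarrow> real" where
  "norm_sq f = (LINT x|M. (norm (f x))\<^sup>2)"

definition inner_r :: "(real \<Rightarrow> complex) \<Rightarrow> (real \<Rightarrow> complex) \<Rightarrow> complex" where
  "inner_r k f = (LINT x|M. k x * cnj (f x))"

definition cut :: "real \<Rightarrow> real \<Rightarrow> (real \<Rightarrow> complex) \<Rightarrow> real \<Rightarrow> complex" where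
  "cut a b f = (\<lambda>x. indicator {a..b} x *\<^sub>R f x)"

lemma measurable_M: "borel_measurable M = borel_measurable lebesgue"
  by (intro measurable_cong_sets) (auto simp: weighted_measure_def)

lemma space_M [simp]: "space M = UNIV" by (simp add: weighted_measure_def)

lemma sets_M: "sets M = sets lebesgue" by (simp add: weighted_measure_def)

lemma AE_M: "(AE x in M. R x) \<longleftrightarrow> (AE x in lebesgue. R x)"
proof -
  have "(AE x in M. R x) \<longleftrightarrow> (AE x in lebesgue. 0 < ennreal (r x) \<longrightarrow> R x)"
    unfolding weighted_measure_def using r_meas by (intro AE_density) simp
  also have "\<dots> \<longleftrightarrow> (AE x in lebesgue. R x)"
  proof
    assume "AE x in lebesgue. 0 < ennreal (r x) \<longrightarrow> R x"
    then show "AE x in lebesgue. R x" using r_pos by eventually_elim auto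
  qed (auto elim: eventually_mono)
  finally show ?thesis .
qed

lemma r_nonneg: "AE x in lebesgue. 0 \<le> r x" using r_pos by eventually_elim simp

lemma integrable_M:
  fixes g :: "real \<Rightarrow> 'a::{banach,second_countable_topology}"
  assumes "g \<in> borel_measurable lebesgue"
  shows "integrable M g \<longleftrightarrow> integrable lebesgue (\<lambda>x. r x *\<^sub>R g x)"
  unfolding weighted_measure_def by (rule integrable_density[OF assms r_meas r_nonneg])

lemma integral_M:
  fixes g :: "real \<Rightarrow> 'a::{banach,second_countable_topology}"
  assumes "g \<in> borel_measurable lebesgue"
  shows "(LINT x|M. g x) = (LINT x|lebesgue. r x *\<^sub>R g x)"
  unfolding weighted_measure_def by (rule integral_density[OF assms r_meas r_nonneg])

lemma L2D:
  assumes "f \<in> L2"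
  shows "f \<in> borel_measurable M" "integrable M (\<lambda>x. (norm (f x))\<^sup>2)"
  using assms by (auto simp: L2_space_def)

lemma L2_mult:
  assumes k: "k \<in> L2" and f: "f \<in> L2"
  shows "integrable M (\<lambda>x. k x * cnj (f x))" "norm (inner_r k f) \<le> sqrt (norm_sq k) * sqrt (norm_sq f)"
    "integrable M (\<lambda>x. norm (k x) * norm (f x))"
proof -
  note [measurable] = L2D(1)[OF k] L2D(1)[OF f]
  have nk: "(\<lambda>x. norm (k x)) \<in> borel_measurable M" and nf: "(\<lambda>x. norm (f x)) \<in> borel_measurable M" by measurable
  note CS = Cauchy_Schwarz_integral[OF nk nf L2D(2)[OF k] L2D(2)[OF f]]
  show "integrable M (\<lambda>x. norm (k x) * norm (f x))" by (rule CS(1))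
  have cm: "(\<lambda>x. k x * cnj (f x)) \<in> borel_measurable M"
  proof -
    have "(\<lambda>x. cnj (f x)) \<in> borel_measurable M"
      using L2D(1)[OF f] by (intro borel_measurable_continuous_on[OF continuous_on_cnj[OF continuous_on_id]])
    then show ?thesis by measurable
  qed
  show i: "integrable M (\<lambda>x. k x * cnj (f x))"
    by (rule Bochner_Integration.integrable_bound[OF CS(1) cm]) (simp add: norm_mult)
  have "norm (inner_r k f) \<le> (LINT x|M. norm (k x * cnj (f x)))"
    unfolding inner_r_def by (rule integral_norm_bound)
  also have "\<dots> = (LINT x|M. norm (k x) * norm (f x))" by (simp add: norm_mult)
  also have "\<dots> \<le> sqrt (norm_sq k) * sqrt (norm_sq f)" using CS(2) unfolding norm_sq_def by linarith
  finally show "norm (inner_r k f) \<le> sqrt (norm_sq k) * sqrt (norm_sq f)" .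
qed

lemma norm_sq_nonneg: "0 \<le> norm_sq f" unfolding norm_sq_def by (intro Bochner_Integration.integral_nonneg) simp

lemma L2_add_scaled:
  assumes f: "f \<in> L2" and g: "g \<in> L2"
  shows "(\<lambda>x. f x + c * g x) \<in> L2"
proof -
  note [measurable] = L2D(1)[OF f] L2D(1)[OF g]
  have m: "(\<lambda>x. f x + c * g x) \<in> borel_measurable M" by measurable
  have "integrable M (\<lambda>x. 2 * (norm (f x))\<^sup>2 + 2 * (norm c)\<^sup>2 * (norm (g x))\<^sup>2)"
    using L2D(2)[OF f] L2D(2)[OF g] by simp
  then have "integrable M (\<lambda>x. (norm (f x + c * g x))\<^sup>2)"
  proof (rule Bochner_Integration.integrable_bound)
    show "(\<lambda>x. (norm (f x + c * g x))\<^sup>2) \<in> borel_measurable M" using m by measurable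
    show "AE x in M. norm ((norm (f x + c * g x))\<^sup>2) \<le> norm (2 * (norm (f x))\<^sup>2 + 2 * (norm c)\<^sup>2 * (norm (g x))\<^sup>2)"
    proof (rule AE_I2)
      fix x
      show "norm ((norm (f x + c * g x))\<^sup>2) \<le> norm (2 * (norm (f x))\<^sup>2 + 2 * (norm c)\<^sup>2 * (norm (g x))\<^sup>2)"
        using norm_square_add_le[of "f x" "c * g x"] by (simp add: norm_mult power_mult_distrib)
    qed
  qed
  then show ?thesis using m by (simp add: L2_space_def)
qed

lemma inner_r_add_scaled:
  assumes "k \<in> L2" "k' \<in> L2" "f \<in> L2"
  shows "inner_r (\<lambda>x. k x + c * k' x) f = inner_r k f + c * inner_r k' f"
proof -
  have "inner_r (\<lambda>x. k x + c * k' x) f = (LINT x|M. k x * cnj (f x) + c * (k' x * cnj (f x)))"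
    unfolding inner_r_def by (intro Bochner_Integration.integral_cong) (auto simp: algebra_simps)
  also have "\<dots> = inner_r k f + c * inner_r k' f"
    unfolding inner_r_def using L2_mult(1)[OF assms(1,3)] L2_mult(1)[OF assms(2,3)] by simp
  finally show ?thesis .
qed

lemma inner_r_self: "inner_r f f = complex_of_real (norm_sq f)"
  unfolding inner_r_def norm_sq_def integral_complex_of_real[symmetric]
  by (intro Bochner_Integration.integral_cong) (auto simp: of_real_norm_square)

lemma L2_restrict:
  assumes g: "g \<in> L2" and A: "A \<in> sets lebesgue"
  shows "(\<lambda>x. indicator A x *\<^sub>R g x) \<in> L2"
proof -
  have A': "A \<in> sets M" using A by (simp add: sets_M)
  have "integrable M (\<lambda>x. indicator A x *\<^sub>R (norm (g x))\<^sup>2)" by (rule integrable_mult_indicator[OF A' L2D(2)[OF g]])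
  also have "(\<lambda>x. indicator A x *\<^sub>R (norm (g x))\<^sup>2) = (\<lambda>x. (norm (indicator A x *\<^sub>R g x))\<^sup>2)"
    by (auto simp: indicator_def)
  finally show ?thesis using L2D(1)[OF g] A' by (simp add: L2_space_def)
qed

lemma cut_L2:
  assumes f: "continuous_on {a..b} f"
  shows "cut a b f \<in> L2" "norm_sq (cut a b f) = mass a b f"
proof -
  have "f \<in> borel_measurable (lebesgue_on {a..b})"
    by (rule continuous_imp_measurable_on_sets_lebesgue[OF f]) auto
  then have m: "cut a b f \<in> borel_measurable lebesgue"
    unfolding cut_def by (subst (asm) borel_measurable_restrict_space_iff) auto
  have m2: "(\<lambda>x. (norm (cut a b f x))\<^sup>2) \<in> borel_measurable lebesgue" using m by measurable
  have eq: "(\<lambda>x. r x *\<^sub>R (norm (cut a b f x))\<^sup>2) = (\<lambda>x. indicator {a..b} x *\<^sub>R (r x * (norm (f x))\<^sup>2))"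
    by (auto simp: cut_def indicator_def)
  have ra: "(\<lambda>x. r x * (norm (f x))\<^sup>2) absolutely_integrable_on {a..b}" by (rule weight_norm_square_integrable[OF f r_loc])
  have "integrable M (\<lambda>x. (norm (cut a b f x))\<^sup>2)"
    unfolding integrable_M[OF m2] eq using ra by (simp only: set_integrable_def)
  then show "cut a b f \<in> L2" using m by (simp add: L2_space_def measurable_M)
  show "norm_sq (cut a b f) = mass a b f"
    unfolding norm_sq_def integral_M[OF m2] eq mass_def
    using set_lebesgue_integral_eq_integral(2)[OF ra] by (simp only: set_lebesgue_integral_def)
qed

lemma source_eq_inner:
  assumes k: "k \<in> L2" and f: "continuous_on {a..b} f"
  shows "source a b k f = inner_r k (cut a b f)"
    and "(\<lambda>x. complex_of_real (r x) * k x * cnj (f x)) absolutely_integrable_on {a..b}"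
proof -
  have i: "integrable M (\<lambda>x. k x * cnj (cut a b f x))" by (rule L2_mult(1)[OF k cut_L2(1)[OF f]])
  then have m: "(\<lambda>x. k x * cnj (cut a b f x)) \<in> borel_measurable lebesgue"
    using measurable_M by (metis borel_measurable_integrable)
  have eq: "(\<lambda>x. r x *\<^sub>R (k x * cnj (cut a b f x))) = (\<lambda>x. indicator {a..b} x *\<^sub>R (complex_of_real (r x) * k x * cnj (f x)))"
    by (auto simp: cut_def indicator_def scaleR_conv_of_real)
  show a: "(\<lambda>x. complex_of_real (r x) * k x * cnj (f x)) absolutely_integrable_on {a..b}"
    using i unfolding integrable_M[OF m] eq set_integrable_def .
  show "source a b k f = inner_r k (cut a b f)"
    unfolding inner_r_def integral_M[OF m] eq source_def
    using set_lebesgue_integral_eq_integral(2)[OF a] by (simp only: set_lebesgue_integral_def)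
qed

lemma L2_weighted_loc:
  assumes "k \<in> L2"
  shows "(\<lambda>x. complex_of_real (r x) * k x) absolutely_integrable_on {a..b}"
  using source_eq_inner(2)[OF assms, of a b "\<lambda>x. 1"] by simp

text \<open>Fatou's lemma bounds the limit. For the convergence of inner products, \<open>g\<close> is split at a large interval: inside,
convergence is dominated, outside \<open>g\<close> has small norm.\<close>

lemma weak_limit:
  assumes g: "g \<in> L2" and F: "\<And>j. F j \<in> L2" and S: "\<And>j. norm_sq (F j) \<le> S"
    and lim: "\<And>x. (\<lambda>j. F j x) \<longlonglongrightarrow> f x"
    and loc: "\<And>L. \<exists>C. \<forall>j x. \<bar>x\<bar> \<le> L \<longrightarrow> norm (F j x) \<le> C"
  shows "f \<in> L2" "norm_sq f \<le> S" "(\<lambda>j. inner_r g (F j)) \<longlonglongrightarrow> inner_r g f"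
proof -
  note [measurable] = L2D(1)[OF F] L2D(1)[OF g]
  have S0: "0 \<le> S" using S[of 0] norm_sq_nonneg[of "F 0"] by linarith
  have fm[measurable]: "f \<in> borel_measurable M"
    by (rule borel_measurable_LIMSEQ_metric[OF L2D(1)[OF F] lim])
  have nnF: "(\<integral>\<^sup>+x. ennreal ((norm (F j x))\<^sup>2) \<partial>M) = ennreal (norm_sq (F j))" for j
    unfolding norm_sq_def by (rule nn_integral_eq_integral[OF L2D(2)[OF F]]) simp
  have "(\<integral>\<^sup>+x. ennreal ((norm (f x))\<^sup>2) \<partial>M) = (\<integral>\<^sup>+x. liminf (\<lambda>j. ennreal ((norm (F j x))\<^sup>2)) \<partial>M)"
  proof (rule nn_integral_cong)
    fix x
    have "(\<lambda>j. ennreal ((norm (F j x))\<^sup>2)) \<longlonglongrightarrow> ennreal ((norm (f x))\<^sup>2)" by (intro tendsto_intros lim)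
    from lim_imp_Liminf[OF _ this] show "ennreal ((norm (f x))\<^sup>2) = liminf (\<lambda>j. ennreal ((norm (F j x))\<^sup>2))" by simp
  qed
  also have "\<dots> \<le> liminf (\<lambda>j. \<integral>\<^sup>+x. ennreal ((norm (F j x))\<^sup>2) \<partial>M)" by (rule nn_integral_liminf) measurable
  also have "\<dots> \<le> limsup (\<lambda>j. \<integral>\<^sup>+x. ennreal ((norm (F j x))\<^sup>2) \<partial>M)" by (rule Liminf_le_Limsup) simp
  also have "\<dots> \<le> ennreal S" unfolding nnF by (intro Limsup_bounded always_eventually allI ennreal_leI S)
  finally have nnf: "(\<integral>\<^sup>+x. ennreal ((norm (f x))\<^sup>2) \<partial>M) \<le> ennreal S" .
  have fi: "integrable M (\<lambda>x. (norm (f x))\<^sup>2)"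
  proof (rule integrableI_bounded)
    show "(\<integral>\<^sup>+x. ennreal (norm ((norm (f x))\<^sup>2)) \<partial>M) < \<infinity>" using nnf by (simp add: le_less_trans[OF _ ennreal_less_top])
  qed measurable
  show fL: "f \<in> L2" using fi fm by (simp add: L2_space_def)
  have "ennreal (norm_sq f) \<le> ennreal S"
    using nnf nn_integral_eq_integral[OF fi] by (simp add: norm_sq_def)
  then show fS: "norm_sq f \<le> S" using S0 by simp
  have sqS: "sqrt (norm_sq (F j)) \<le> sqrt S" "sqrt (norm_sq f) \<le> sqrt S" for j using S fS by (auto intro: real_sqrt_le_mono)
  let ?I = "\<lambda>n::nat. {-real n..real n}"
  have Ic: "- ?I n \<in> sets lebesgue" for n using Compl_in_sets_lebesgue[of "?I n"] by simp
  have tail: "(\<lambda>n. norm_sq (\<lambda>x. indicator (- ?I n) x *\<^sub>R g x)) \<longlonglongrightarrow> (LINT x|M. 0)"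
    unfolding norm_sq_def
  proof (rule integral_dominated_convergence[where w="\<lambda>x. (norm (g x))\<^sup>2", OF _ _ L2D(2)[OF g]])
    have Im: "?I n \<in> sets M" for n by (simp add: sets_M)
    show "(\<lambda>x. (norm (indicator (- ?I n) x *\<^sub>R g x))\<^sup>2) \<in> borel_measurable M" for n
      using L2D(1)[OF L2_restrict[OF g Ic[of n]]] by measurable
    show "AE x in M. (\<lambda>n. (norm (indicator (- ?I n) x *\<^sub>R g x))\<^sup>2) \<longlonglongrightarrow> 0"
    proof (rule AE_I2)
      fix x
      obtain N :: nat where "\<bar>x\<bar> \<le> real N" using real_arch_simple by blast
      then have "eventually (\<lambda>n. (norm (indicator (- ?I n) x *\<^sub>R g x))\<^sup>2 = 0) sequentially"
        by (intro eventually_sequentiallyI[of N]) (auto simp: indicator_def)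
      then show "(\<lambda>n. (norm (indicator (- ?I n) x *\<^sub>R g x))\<^sup>2) \<longlonglongrightarrow> 0" by (rule tendsto_eventually)
    qed
  qed (auto simp: indicator_def)
  show "(\<lambda>j. inner_r g (F j)) \<longlonglongrightarrow> inner_r g f"
  proof (rule LIMSEQ_I)
    fix e :: real assume e: "0 < e"
    have "(\<lambda>n. sqrt (norm_sq (\<lambda>x. indicator (- ?I n) x *\<^sub>R g x))) \<longlonglongrightarrow> 0"
      using tendsto_real_sqrt[OF tail] by simp
    then have "eventually (\<lambda>n. sqrt (norm_sq (\<lambda>x. indicator (- ?I n) x *\<^sub>R g x)) < e / (4 * (sqrt S + 1))) sequentially"
      using e S0 by (intro order_tendstoD) (auto intro!: divide_pos_pos add_nonneg_pos)
    then obtain n where n: "sqrt (norm_sq (\<lambda>x. indicator (- ?I n) x *\<^sub>R g x)) < e / (4 * (sqrt S + 1))"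
      by (auto simp: eventually_sequentially)
    let ?gi = "\<lambda>x. indicator (?I n) x *\<^sub>R g x" and ?go = "\<lambda>x. indicator (- ?I n) x *\<^sub>R g x"
    have gi: "?gi \<in> L2" and go: "?go \<in> L2" by (auto intro!: L2_restrict g Ic)
    have split: "inner_r g G = inner_r ?gi G + inner_r ?go G" if "G \<in> L2" for G
    proof -
      have "g = (\<lambda>x. ?gi x + 1 * ?go x)" by (auto simp: indicator_def)
      then have "inner_r g G = inner_r (\<lambda>x. ?gi x + 1 * ?go x) G" by simp
      also have "\<dots> = inner_r ?gi G + 1 * inner_r ?go G" by (rule inner_r_add_scaled[OF gi go that])
      finally show ?thesis by simp
    qed
    have small: "norm (inner_r ?go G) \<le> e / 4" if "G \<in> L2" "sqrt (norm_sq G) \<le> sqrt S" for G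
    proof -
      have "norm (inner_r ?go G) \<le> sqrt (norm_sq ?go) * sqrt (norm_sq G)" by (rule L2_mult(2)[OF go that(1)])
      also have "\<dots> \<le> e / (4 * (sqrt S + 1)) * (sqrt S + 1)"
      proof (rule mult_mono)
        show "sqrt (norm_sq G) \<le> sqrt S + 1" using that(2) by linarith
        show "0 \<le> e / (4 * (sqrt S + 1))" using e S0 by (intro divide_nonneg_nonneg) auto
      qed (use n norm_sq_nonneg in auto)
      also have "\<dots> = e / 4" using S0 by (simp add: field_simps add_nonneg_eq_0_iff)
      finally show ?thesis .
    qed
    obtain C where C: "\<And>j x. \<bar>x\<bar> \<le> real n \<Longrightarrow> norm (F j x) \<le> C" using loc[of "real n"] by blast
    have one: "(\<lambda>x. indicator (?I n) x *\<^sub>R 1) \<in> L2"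
      using cut_L2(1)[of "- real n" "real n" "\<lambda>x. 1"] by (simp add: cut_def)
    have "(\<lambda>j. inner_r ?gi (F j)) \<longlonglongrightarrow> inner_r ?gi f"
      unfolding inner_r_def
    proof (rule integral_dominated_convergence[where w="\<lambda>x. C * (norm (g x) * norm (indicator (?I n) x *\<^sub>R (1::complex)))"])
      show "(\<lambda>x. ?gi x * cnj (f x)) \<in> borel_measurable M" by (rule borel_measurable_integrable[OF L2_mult(1)[OF gi fL]])
      show "(\<lambda>x. ?gi x * cnj (F j x)) \<in> borel_measurable M" for j by (rule borel_measurable_integrable[OF L2_mult(1)[OF gi F]])
      show "integrable M (\<lambda>x. C * (norm (g x) * norm (indicator (?I n) x *\<^sub>R (1::complex))))"
        by (intro integrable_mult_right L2_mult(3)[OF g one])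
      show "AE x in M. (\<lambda>j. ?gi x * cnj (F j x)) \<longlonglongrightarrow> ?gi x * cnj (f x)"
        by (intro AE_I2 tendsto_intros lim)
      show "AE x in M. norm (?gi x * cnj (F j x)) \<le> C * (norm (g x) * norm (indicator (?I n) x *\<^sub>R (1::complex)))" for j
      proof (rule AE_I2)
        fix x
        show "norm (?gi x * cnj (F j x)) \<le> C * (norm (g x) * norm (indicator (?I n) x *\<^sub>R (1::complex)))"
        proof (cases "x \<in> ?I n")
          case True
          then have "norm (F j x) \<le> C" by (intro C) auto
          then have "norm (g x) * norm (F j x) \<le> norm (g x) * C" by (intro mult_left_mono) auto
          then show ?thesis using True by (simp add: norm_mult mult.commute)
        qed simp
      qed
    qed
    from LIMSEQ_D[OF this, of "e / 4"] e
    obtain J where J: "\<And>j. j \<ge> J \<Longrightarrow> norm (inner_r ?gi (F j) - inner_r ?gi f) < e / 4" by auto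
    show "\<exists>no. \<forall>j\<ge>no. norm (inner_r g (F j) - inner_r g f) < e"
    proof (intro exI[of _ J] allI impI)
      fix j assume "J \<le> j"
      have eq: "inner_r g (F j) - inner_r g f = (inner_r ?gi (F j) - inner_r ?gi f) + inner_r ?go (F j) - inner_r ?go f"
        unfolding split[OF F] split[OF fL] by simp
      have "norm (inner_r g (F j) - inner_r g f) \<le>
          norm (inner_r ?gi (F j) - inner_r ?gi f) + norm (inner_r ?go (F j)) + norm (inner_r ?go f)"
        unfolding eq by (intro order_trans[OF norm_triangle_ineq4] add_mono norm_triangle_ineq order_refl)
      also have "\<dots> < e / 4 + e / 4 + e / 4"
        by (intro add_less_le_mono J[OF \<open>J \<le> j\<close>] small[OF F sqS(1)] small[OF fL sqS(2)])
      also have "e / 4 + e / 4 + e / 4 < e" using e by simp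
      finally show "norm (inner_r g (F j) - inner_r g f) < e" .
    qed
  qed
qed

lemma mass_combination:
  assumes f: "continuous_on {a..b} f" and g: "continuous_on {a..b} g"
  shows "mass a b (\<lambda>x. A * f x + B * g x) =
     (norm A)\<^sup>2 * mass a b f + (norm B)\<^sup>2 * mass a b g + 2 * Re (A * cnj B * source a b f g)"
proof -
  have 1: "((\<lambda>x. r x * (norm (f x))\<^sup>2) has_integral mass a b f) {a..b}" "((\<lambda>x. r x * (norm (g x))\<^sup>2) has_integral mass a b g) {a..b}"
    unfolding mass_def by (intro integrable_integral set_lebesgue_integral_eq_integral(1) weight_norm_square_integrable f g r_loc)+
  have "(\<lambda>x. complex_of_real (r x) * (f x * cnj (g x))) absolutely_integrable_on {a..b}"
    by (intro continuous_times_absolutely_integrable(2) of_real_absolutely_integrable r_loc continuous_intros f g)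
  then have "(\<lambda>x. complex_of_real (r x) * f x * cnj (g x)) integrable_on {a..b}"
    by (simp add: mult.assoc set_lebesgue_integral_eq_integral(1))
  then have "((\<lambda>x. complex_of_real (r x) * f x * cnj (g x)) has_integral source a b f g) {a..b}"
    unfolding source_def by (rule integrable_integral)
  from has_integral_linear[OF has_integral_mult_right[OF this, of "A * cnj B"] bounded_linear_Re]
  have 2: "((\<lambda>x. Re (A * cnj B * (complex_of_real (r x) * f x * cnj (g x)))) has_integral Re (A * cnj B * source a b f g)) {a..b}"
    by (simp add: o_def)
  have "((\<lambda>x. (norm A)\<^sup>2 * (r x * (norm (f x))\<^sup>2) + (norm B)\<^sup>2 * (r x * (norm (g x))\<^sup>2) + 2 * Re (A * cnj B * (complex_of_real (r x) * f x * cnj (g x)))) has_integral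
     (norm A)\<^sup>2 * mass a b f + (norm B)\<^sup>2 * mass a b g + 2 * Re (A * cnj B * source a b f g)) {a..b}"
    by (intro has_integral_add has_integral_mult_right 1 2)
  moreover have "(norm A)\<^sup>2 * (r x * (norm (f x))\<^sup>2) + (norm B)\<^sup>2 * (r x * (norm (g x))\<^sup>2) + 2 * Re (A * cnj B * (complex_of_real (r x) * f x * cnj (g x)))
     = r x * (norm (A * f x + B * g x))\<^sup>2" for x
    unfolding cmod_power2 by (simp add: power2_eq_square algebra_simps)
  ultimately show ?thesis unfolding mass_def by (simp add: integral_unique)
qed

end

section \<open>Dirichlet problems and exhaustion\<close>

context sturm_liouville
begin

text \<open>A positive continuous function on the compact unit sphere of \<open>\<complex>\<^sup>2\<close> has a positive minimum.\<close>

lemma Gram_lower_bound: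
  assumes f: "continuous_on {-1..1} f" and g: "continuous_on {-1..1} g"
    and indep: "\<And>A B. (\<And>x. x \<in> {-1..1} \<Longrightarrow> A * f x + B * g x = 0) \<Longrightarrow> A = 0 \<and> B = 0"
  shows "\<exists>\<epsilon>>0. \<forall>A B. \<epsilon> * ((norm A)\<^sup>2 + (norm B)\<^sup>2) \<le> mass (-1) 1 (\<lambda>x. A * f x + B * g x)"
proof -
  define m where "m z = (norm (fst z))\<^sup>2 * mass (-1) 1 f + (norm (snd z))\<^sup>2 * mass (-1) 1 g
      + 2 * Re (fst z * cnj (snd z) * source (-1) 1 f g)" for z :: "complex \<times> complex"
  have m: "mass (-1) 1 (\<lambda>x. A * f x + B * g x) = m (A, B)" for A B
    unfolding m_def using mass_combination[OF f g] by simp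
  have cm: "continuous_on (sphere 0 1) m" unfolding m_def by (intro continuous_intros)
  have "(1::complex, 0::complex) \<in> sphere 0 1" by (simp add: norm_Pair)
  then have ne: "sphere (0::complex \<times> complex) 1 \<noteq> {}" by blast
  obtain z where z: "z \<in> sphere 0 1" "\<And>y. y \<in> sphere 0 1 \<Longrightarrow> m z \<le> m y"
    using continuous_attains_inf[OF compact_sphere ne cm] by auto
  have cz: "continuous_on {-1..1} (\<lambda>x. fst z * f x + snd z * g x)" by (intro continuous_intros f g)
  have "m z \<noteq> 0"
  proof
    assume "m z = 0"
    then have "mass (-1) 1 (\<lambda>x. fst z * f x + snd z * g x) = 0" using m[of "fst z" "snd z"] by simp
    then have "fst z = 0 \<and> snd z = 0" by (intro indep mass_zero_imp[OF _ cz]) auto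
    then have "z = 0" by (simp add: prod_eq_iff)
    then show False using z(1) by simp
  qed
  moreover have "0 \<le> m z" using mass_nonneg[OF cz] m[of "fst z" "snd z"] by simp
  ultimately have pos: "0 < m z" by simp
  have "m z * ((norm A)\<^sup>2 + (norm B)\<^sup>2) \<le> m (A, B)" for A B
  proof (cases "(A, B) = 0")
    case True
    then show ?thesis by (simp add: m_def zero_prod_def)
  next
    case False
    define t where "t = norm (A, B)"
    have t: "0 < t" using False by (simp add: t_def)
    have t2: "t\<^sup>2 = (norm A)\<^sup>2 + (norm B)\<^sup>2" by (simp add: t_def norm_Pair)
    let ?y = "(A / of_real t, B / of_real t)"
    have "?y = (1 / t) *\<^sub>R (A, B)" by (simp add: scaleR_conv_of_real)
    then have "norm ?y = 1" using t by (simp only: norm_scaleR) (simp add: t_def)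
    then have "m z \<le> m ?y" by (intro z(2)) simp
    also have "m ?y = m (A, B) / t\<^sup>2"
    proof -
      have "Re (A / of_real t * cnj (B / of_real t) * w) = Re (A * cnj B * w) / t\<^sup>2" for w
      proof -
        have "A / of_real t * cnj (B / of_real t) * w = (A * cnj B * w) / of_real (t\<^sup>2)"
          by (simp add: power2_eq_square)
        then show ?thesis by (simp only: Re_divide_of_real)
      qed
      then show ?thesis
        unfolding m_def using t by (simp add: norm_divide power_divide add_divide_distrib)
    qed
    finally show ?thesis using t unfolding t2[symmetric] by (simp add: field_simps)
  qed
  then show ?thesis using pos m by auto
qed

lemma solves_exists:
  assumes k: "\<And>a b. (\<lambda>x. complex_of_real (r x) * k x) absolutely_integrable_on {a..b}"
  shows "\<exists>f h. f 0 = f0 \<and> h 0 = h0 \<and> solves f h (\<lambda>x. l * f x + k x)"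
proof -
  let ?c = "\<lambda>x. complex_of_real (1 / p x)" and ?d = "\<lambda>x. complex_of_real (q x) - complex_of_real (r x) * l"
    and ?e = "\<lambda>x. (-1) * (complex_of_real (r x) * k x)"
  have c: "?c absolutely_integrable_on {a..b}" for a b by (rule of_real_absolutely_integrable[OF p_loc])
  have d: "?d absolutely_integrable_on {a..b}" for a b
    by (intro set_integral_diff(1) set_integrable_mult_left of_real_absolutely_integrable q_loc r_loc)
  have e: "?e absolutely_integrable_on {a..b}" for a b
    by (intro set_integrable_mult_right k)
  obtain f h where fh: "f 0 = f0" "h 0 = h0" "\<And>a b. antideriv_on a b f (\<lambda>t. ?c t * h t)"
     "\<And>a b. antideriv_on a b h (\<lambda>t. ?d t * f t + ?e t)"
    using linear_system_solution_exists[OF c d e, of f0 h0] by auto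
  have "solves f h (\<lambda>x. l * f x + k x)"
    unfolding solves_def
  proof (intro conjI allI)
    fix a b
    show "antideriv_on a b f (velocity h)" using fh(3) by (simp add: velocity_def)
    show "antideriv_on a b h (\<lambda>x. complex_of_real (q x) * f x - complex_of_real (r x) * (l * f x + k x))"
      by (rule antideriv_on_cong[OF fh(4)]) (auto simp: algebra_simps)
  qed
  then show ?thesis using fh(1,2) by blast
qed

definition dirichlet :: "real \<Rightarrow> (real \<Rightarrow> complex) \<Rightarrow> (real \<Rightarrow> complex) \<Rightarrow> bool" where
  "dirichlet a f v \<longleftrightarrow> finite_energy (-a) a f v \<and> f (-a) = 0 \<and> f a = 0"

text \<open>The lower bound for \<open>|\<langle>(T - l)f,f\<rangle>|\<close> that makes all Dirichlet problems at \<open>l\<close> uniformly solvable.\<close>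

definition coercive_at :: "complex \<Rightarrow> real \<Rightarrow> bool" where
  "coercive_at l d \<longleftrightarrow> 0 < d \<and> (\<forall>a f v. 1 \<le> a \<longrightarrow> dirichlet a f v \<longrightarrow>
     d * mass (-a) a f \<le> norm (complex_of_real (energy (-a) a f v) - l * complex_of_real (mass (-a) a f)))"

lemma solves_dirichlet:
  assumes "solves f h k" "0 < a" "f (-a) = 0" "f a = 0"
  shows "dirichlet a f (velocity h)"
  using assms solves_finite_energy[of f h k "-a" a] by (simp add: dirichlet_def)

lemma source_add:
  assumes f: "continuous_on {a..b} f" and g: "continuous_on {a..b} g" and k: "k \<in> L2"
  shows "source a b (\<lambda>x. l * f x + k x) g = l * source a b f g + source a b k g"
proof -
  have "(\<lambda>x. complex_of_real (r x) * (f x * cnj (g x))) absolutely_integrable_on {a..b}"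
    by (intro continuous_times_absolutely_integrable(2) of_real_absolutely_integrable r_loc continuous_intros f g)
  then have "(\<lambda>x. complex_of_real (r x) * f x * cnj (g x)) integrable_on {a..b}"
    by (simp add: mult.assoc set_lebesgue_integral_eq_integral(1))
  then have 1: "((\<lambda>x. complex_of_real (r x) * f x * cnj (g x)) has_integral source a b f g) {a..b}"
    unfolding source_def by (rule integrable_integral)
  have 2: "((\<lambda>x. complex_of_real (r x) * k x * cnj (g x)) has_integral source a b k g) {a..b}"
    unfolding source_def using source_eq_inner(2)[OF k g]
    by (intro integrable_integral set_lebesgue_integral_eq_integral(1))
  have "((\<lambda>x. l * (complex_of_real (r x) * f x * cnj (g x)) + complex_of_real (r x) * k x * cnj (g x)) has_integral
     l * source a b f g + source a b k g) {a..b}"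
    by (intro has_integral_add has_integral_mult_right 1 2)
  then have "((\<lambda>x. complex_of_real (r x) * (l * f x + k x) * cnj (g x)) has_integral
     l * source a b f g + source a b k g) {a..b}"
    by (rule has_integral_eq[rotated]) (simp add: algebra_simps)
  then show ?thesis unfolding source_def by (rule integral_unique)
qed

lemma source_self:
  assumes "continuous_on {a..b} f"
  shows "source a b f f = complex_of_real (mass a b f)"
  using source_scaled[OF assms, of 1] by simp

lemma dirichlet_energy_identity:
  assumes f: "solves f h (\<lambda>x. l * f x + k x)" and k: "k \<in> L2" and a: "0 < a" and z: "f (-a) = 0" "f a = 0"
  shows "complex_of_real (energy (-a) a f (velocity h)) - l * complex_of_real (mass (-a) a f) = inner_r k (cut (-a) a f)"
proof -
  have c: "continuous_on {-a..a} f" by (rule solves_continuous(1)[OF f])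
  have "complex_of_real (energy (-a) a f (velocity h)) = source (-a) a (\<lambda>x. l * f x + k x) f"
    using energy_Green[OF f, of "-a" a] a z by simp
  also have "\<dots> = l * complex_of_real (mass (-a) a f) + inner_r k (cut (-a) a f)"
    unfolding source_add[OF c c k] source_self[OF c] source_eq_inner(1)[OF k c] ..
  finally show ?thesis by simp
qed

lemma dirichlet_solution_bound:
  assumes l: "coercive_at l d" and f: "solves f h (\<lambda>x. l * f x + k x)" and k: "k \<in> L2"
    and a: "1 \<le> a" and z: "f (-a) = 0" "f a = 0"
  shows "mass (-a) a f \<le> norm_sq k / d\<^sup>2"
proof -
  have c: "continuous_on {-a..a} f" by (rule solves_continuous(1)[OF f])
  have d: "0 < d" using l by (simp add: coercive_at_def)
  have a0: "0 < a" using a by simp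
  let ?m = "mass (-a) a f"
  have m0: "0 \<le> ?m" by (rule mass_nonneg[OF c])
  have "d * ?m \<le> norm (inner_r k (cut (-a) a f))"
    using l a solves_dirichlet[OF f a0 z] unfolding coercive_at_def dirichlet_energy_identity[OF f k a0 z, symmetric] by blast
  also have "\<dots> \<le> sqrt (norm_sq k) * sqrt ?m"
    using L2_mult(2)[OF k cut_L2(1)[OF c]] cut_L2(2)[OF c] by simp
  finally have le: "d * ?m \<le> sqrt (norm_sq k) * sqrt ?m" .
  show ?thesis
  proof (cases "?m = 0")
    case True
    then show ?thesis using norm_sq_nonneg by simp
  next
    case False
    then have m: "0 < sqrt ?m" using m0 by simp
    have "(d * sqrt ?m) * sqrt ?m \<le> sqrt (norm_sq k) * sqrt ?m" using le m0 by (simp add: mult.assoc)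
    then have "d * sqrt ?m \<le> sqrt (norm_sq k)" using m by (simp add: mult_le_cancel_right)
    then have "(d * sqrt ?m)\<^sup>2 \<le> (sqrt (norm_sq k))\<^sup>2" using d m0 by (intro power_mono) auto
    then have "d\<^sup>2 * ?m \<le> norm_sq k" using m0 norm_sq_nonneg by (simp add: power_mult_distrib)
    then show ?thesis using d by (simp add: field_simps)
  qed
qed

lemma zero_in_L2: "(\<lambda>x. 0) \<in> L2" and norm_sq_zero: "norm_sq (\<lambda>x. 0) = 0"
  by (auto simp: L2_space_def norm_sq_def)

lemma solves_add_homogeneous:
  assumes w: "solves w hw (\<lambda>x. l * w x + k x)" and \<phi>: "solves \<phi> h\<phi> (\<lambda>x. l * \<phi> x)" and \<psi>: "solves \<psi> h\<psi> (\<lambda>x. l * \<psi> x)"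
  shows "solves (\<lambda>x. w x + A * \<phi> x + B * \<psi> x) (\<lambda>x. hw x + A * h\<phi> x + B * h\<psi> x)
     (\<lambda>x. l * (w x + A * \<phi> x + B * \<psi> x) + k x)"
proof -
  have "(\<lambda>x. l * (w x + A * \<phi> x + B * \<psi> x) + k x) = (\<lambda>x. (l * w x + k x + A * (l * \<phi> x)) + B * (l * \<psi> x))"
    by (auto simp: algebra_simps)
  then show ?thesis using solves_add_scaled[OF solves_add_scaled[OF w \<phi>, of A] \<psi>, of B] by simp
qed

text \<open>A solution that vanishes on an interval has vanishing quasi-derivative there, so its initial data at \<open>0\<close> vanish.\<close>

lemma homogeneous_independent:
  assumes \<phi>: "solves \<phi> h\<phi> (\<lambda>x. l * \<phi> x)" "\<phi> 0 = 1" "h\<phi> 0 = 0" and \<psi>: "solves \<psi> h\<psi> (\<lambda>x. l * \<psi> x)" "\<psi> 0 = 0" "h\<psi> 0 = 1"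
    and a: "0 < a" and z: "\<And>x. x \<in> {-a..a} \<Longrightarrow> A * \<phi> x + B * \<psi> x = 0"
  shows "A = 0 \<and> B = 0"
proof -
  have w: "solves (\<lambda>x. 0) (\<lambda>x. 0) (\<lambda>x. l * 0 + 0)"
    by (simp add: solves_def velocity_def antideriv_on_def)
  have s: "solves (\<lambda>x. A * \<phi> x + B * \<psi> x) (\<lambda>x. A * h\<phi> x + B * h\<psi> x) (\<lambda>x. l * (A * \<phi> x + B * \<psi> x))"
    using solves_add_homogeneous[OF w \<phi>(1) \<psi>(1), of A B] by simp
  have "A * h\<phi> 0 + B * h\<psi> 0 = 0"
    by (rule solves_zero_imp_momentum_zero[OF s, of "-a" a]) (use a z in auto)
  moreover have "A * \<phi> 0 + B * \<psi> 0 = 0" using z[of 0] a by simp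
  ultimately show ?thesis using \<phi> \<psi> by simp
qed

text \<open>Shooting: by linear algebra it suffices that the homogeneous problem has only the trivial solution, and this is
coercivity.\<close>

lemma dirichlet_solution_exists:
  assumes l: "coercive_at l d" and k: "k \<in> L2" and a: "1 \<le> a"
    and w: "solves w hw (\<lambda>x. l * w x + k x)"
    and \<phi>: "solves \<phi> h\<phi> (\<lambda>x. l * \<phi> x)" "\<phi> 0 = 1" "h\<phi> 0 = 0" and \<psi>: "solves \<psi> h\<psi> (\<lambda>x. l * \<psi> x)" "\<psi> 0 = 0" "h\<psi> 0 = 1"
  shows "\<exists>A B. w (-a) + A * \<phi> (-a) + B * \<psi> (-a) = 0 \<and> w a + A * \<phi> a + B * \<psi> a = 0"
proof -
  have "\<exists>A B. A * \<phi> (-a) + B * \<psi> (-a) = - w (-a) \<and> A * \<phi> a + B * \<psi> a = - w a"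
  proof (rule solve_two_by_two)
    fix A B assume z: "A * \<phi> (-a) + B * \<psi> (-a) = 0" "A * \<phi> a + B * \<psi> a = 0"
    let ?u = "\<lambda>x. A * \<phi> x + B * \<psi> x"
    have w0: "solves (\<lambda>x. 0) (\<lambda>x. 0) (\<lambda>x. l * 0 + 0)"
      by (simp add: solves_def velocity_def antideriv_on_def)
    have s: "solves ?u (\<lambda>x. A * h\<phi> x + B * h\<psi> x) (\<lambda>x. l * ?u x + 0)"
      using solves_add_homogeneous[OF w0 \<phi>(1) \<psi>(1), of A B] by simp
    have c: "continuous_on {-a..a} ?u" by (rule solves_continuous(1)[OF s])
    have "mass (-a) a ?u \<le> 0"
      using dirichlet_solution_bound[OF l s zero_in_L2 a] z norm_sq_zero by simp
    then have m: "mass (-a) a ?u = 0" using mass_nonneg[OF c] by simp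
    show "A = 0 \<and> B = 0"
      by (rule homogeneous_independent[OF \<phi> \<psi>, of a]) (use a mass_zero_imp[OF _ c m] in auto)
  qed
  then show ?thesis by (metis add.assoc add.right_inverse)
qed

text \<open>The functions \<open>F j\<close> solve Dirichlet problems on growing intervals with the same right-hand side; extended by zero
they converge weakly to \<open>f\<close>.\<close>

definition dirichlet_approximation ::
  "complex \<Rightarrow> (real \<Rightarrow> complex) \<Rightarrow> (real \<Rightarrow> complex) \<Rightarrow> (nat \<Rightarrow> real) \<Rightarrow> (nat \<Rightarrow> real \<Rightarrow> complex) \<Rightarrow> (nat \<Rightarrow> real \<Rightarrow> complex) \<Rightarrow> bool" where
  "dirichlet_approximation l k f N F H \<longleftrightarrow>
     (\<forall>j. 1 \<le> N j \<and> real j \<le> N j \<and> solves (F j) (H j) (\<lambda>x. l * F j x + k x) \<and> F j (- N j) = 0 \<and> F j (N j) = 0) \<and>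
     (\<forall>g\<in>L2. (\<lambda>j. inner_r g (cut (- N j) (N j) (F j))) \<longlonglongrightarrow> inner_r g f)"

lemma mass_mono:
  assumes f: "continuous_on {a..b} f" and "a \<le> c" "d \<le> b"
  shows "mass c d f \<le> mass a b f"
proof (cases "c \<le> d")
  case True
  have ra: "(\<lambda>x. r x * (norm (f x))\<^sup>2) absolutely_integrable_on {a..b}" by (rule weight_norm_square_integrable[OF f r_loc])
  have rc: "(\<lambda>x. r x * (norm (f x))\<^sup>2) absolutely_integrable_on {c..d}" by (rule absolutely_integrable_mono[OF ra assms(2,3)])
  have "(LINT x:{c..d}|lebesgue. r x * (norm (f x))\<^sup>2) \<le> (LINT x:{a..b}|lebesgue. r x * (norm (f x))\<^sup>2)"
    unfolding set_lebesgue_integral_def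
  proof (rule integral_mono_AE)
    show "integrable lebesgue (\<lambda>x. indicator {c..d} x *\<^sub>R (r x * (norm (f x))\<^sup>2))" using rc by (simp only: set_integrable_def)
    show "integrable lebesgue (\<lambda>x. indicator {a..b} x *\<^sub>R (r x * (norm (f x))\<^sup>2))" using ra by (simp only: set_integrable_def)
    show "AE x in lebesgue. indicator {c..d} x *\<^sub>R (r x * (norm (f x))\<^sup>2) \<le> indicator {a..b} x *\<^sub>R (r x * (norm (f x))\<^sup>2)"
      using r_pos by eventually_elim (use assms(2,3) in \<open>auto simp: indicator_def\<close>)
  qed
  then show ?thesis unfolding mass_def
    using set_lebesgue_integral_eq_integral(2)[OF ra] set_lebesgue_integral_eq_integral(2)[OF rc] by simp
next
  case False
  then have "mass c d f = 0" by (simp add: mass_def)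
  then show ?thesis using mass_nonneg[OF f] by simp
qed

lemma mass_add_le:
  assumes f: "continuous_on {a..b} f" and g: "continuous_on {a..b} g"
  shows "mass a b (\<lambda>x. f x + g x) \<le> 2 * mass a b f + 2 * mass a b g"
proof -
  have "mass a b (\<lambda>x. f x + g x) \<le> integral {a..b} (\<lambda>x. 2 * (r x * (norm (f x))\<^sup>2) + 2 * (r x * (norm (g x))\<^sup>2))"
    unfolding mass_def
  proof (rule integral_mono_AE_interval)
    show "(\<lambda>x. r x * (norm (f x + g x))\<^sup>2) absolutely_integrable_on {a..b}"
      by (intro weight_norm_square_integrable continuous_intros f g r_loc)
    show "(\<lambda>x. 2 * (r x * (norm (f x))\<^sup>2) + 2 * (r x * (norm (g x))\<^sup>2)) absolutely_integrable_on {a..b}"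
      by (intro set_integral_add(1) set_integrable_mult_right weight_norm_square_integrable f g r_loc)
    show "AE x in lebesgue. x \<in> {a..b} \<longrightarrow> r x * (norm (f x + g x))\<^sup>2 \<le> 2 * (r x * (norm (f x))\<^sup>2) + 2 * (r x * (norm (g x))\<^sup>2)"
      using r_pos
    proof eventually_elim
      case (elim x)
      have "r x * (norm (f x + g x))\<^sup>2 \<le> r x * (2 * (norm (f x))\<^sup>2 + 2 * (norm (g x))\<^sup>2)"
        using elim by (intro mult_left_mono norm_square_add_le) auto
      then show ?case by (simp add: algebra_simps)
    qed
  qed
  also have "\<dots> = integral {a..b} (\<lambda>x. 2 * (r x * (norm (f x))\<^sup>2)) + integral {a..b} (\<lambda>x. 2 * (r x * (norm (g x))\<^sup>2))"
    by (intro integral_add integrable_on_mult_right set_lebesgue_integral_eq_integral(1) weight_norm_square_integrable f g r_loc)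
  finally show ?thesis by (simp add: mass_def)
qed

text \<open>All Dirichlet solutions are of the form \<open>w + A\<phi> + B\<psi>\<close> with fixed \<open>w, \<phi>, \<psi>\<close>. Their masses on \<open>[-1,1]\<close> are
bounded, so the coefficients are bounded by the Gram inequality, and a convergent subsequence of
coefficients gives locally uniform convergence.\<close>

theorem exhaustion:
  assumes l: "coercive_at l d" and k: "k \<in> L2"
  shows "\<exists>f h N F H. solves f h (\<lambda>x. l * f x + k x) \<and> f \<in> L2 \<and> norm_sq f \<le> norm_sq k / d\<^sup>2 \<and>
     dirichlet_approximation l k f N F H"
proof -
  have z: "(\<lambda>x. complex_of_real (r x) * 0) absolutely_integrable_on {a..b}" for a b by simp
  obtain w hw where w: "solves w hw (\<lambda>x. l * w x + k x)"
    using solves_exists[OF L2_weighted_loc[OF k], of 0 0 l] by blast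
  obtain \<phi> h\<phi> where \<phi>: "solves \<phi> h\<phi> (\<lambda>x. l * \<phi> x)" "\<phi> 0 = 1" "h\<phi> 0 = 0"
    using solves_exists[OF z, of 1 0 l] by auto
  obtain \<psi> h\<psi> where \<psi>: "solves \<psi> h\<psi> (\<lambda>x. l * \<psi> x)" "\<psi> 0 = 0" "h\<psi> 0 = 1"
    using solves_exists[OF z, of 0 1 l] by auto
  define f where "f A B x = w x + A * \<phi> x + B * \<psi> x" for A B x
  define h where "h A B x = hw x + A * h\<phi> x + B * h\<psi> x" for A B x
  have fs: "solves (f A B) (h A B) (\<lambda>x. l * f A B x + k x)" for A B
    unfolding f_def[abs_def] h_def[abs_def] by (rule solves_add_homogeneous[OF w \<phi>(1) \<psi>(1)])
  have fc: "continuous_on S (f A B)" for A B S by (rule solves_continuous(1)[OF fs])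
  have cw: "continuous_on S w" and c\<phi>: "continuous_on S \<phi>" and c\<psi>: "continuous_on S \<psi>" for S
    using solves_continuous(1)[OF w] solves_continuous(1)[OF \<phi>(1)] solves_continuous(1)[OF \<psi>(1)] by auto
  have "\<forall>n. \<exists>c. f (fst c) (snd c) (- real (Suc n)) = 0 \<and> f (fst c) (snd c) (real (Suc n)) = 0"
  proof
    fix n
    obtain A B where "w (- real (Suc n)) + A * \<phi> (- real (Suc n)) + B * \<psi> (- real (Suc n)) = 0"
        "w (real (Suc n)) + A * \<phi> (real (Suc n)) + B * \<psi> (real (Suc n)) = 0"
      using dirichlet_solution_exists[OF l k _ w \<phi> \<psi>, of "real (Suc n)"] by auto
    then show "\<exists>c. f (fst c) (snd c) (- real (Suc n)) = 0 \<and> f (fst c) (snd c) (real (Suc n)) = 0"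
      by (intro exI[of _ "(A, B)"]) (simp add: f_def)
  qed
  from choice[OF this] obtain c where c: "\<And>n. f (fst (c n)) (snd (c n)) (- real (Suc n)) = 0"
    "\<And>n. f (fst (c n)) (snd (c n)) (real (Suc n)) = 0" by blast
  let ?g = "\<lambda>n. f (fst (c n)) (snd (c n))"
  let ?S = "norm_sq k / d\<^sup>2"
  have bound: "mass (- real (Suc n)) (real (Suc n)) (?g n) \<le> ?S" for n
    by (rule dirichlet_solution_bound[OF l fs k _ c]) simp
  obtain \<epsilon> where \<epsilon>: "0 < \<epsilon>" "\<And>A B. \<epsilon> * ((norm A)\<^sup>2 + (norm B)\<^sup>2) \<le> mass (-1) 1 (\<lambda>x. A * \<phi> x + B * \<psi> x)"
    using Gram_lower_bound[OF c\<phi> c\<psi> homogeneous_independent[OF \<phi> \<psi>, of 1]] by auto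
  have cb: "(norm (c n))\<^sup>2 \<le> (2 * ?S + 2 * mass (-1) 1 (\<lambda>x. - w x)) / \<epsilon>" for n
  proof -
    have "\<epsilon> * (norm (c n))\<^sup>2 = \<epsilon> * ((norm (fst (c n)))\<^sup>2 + (norm (snd (c n)))\<^sup>2)"
      by (cases "c n") (simp add: norm_Pair)
    also have "\<dots> \<le> mass (-1) 1 (\<lambda>x. fst (c n) * \<phi> x + snd (c n) * \<psi> x)" by (rule \<epsilon>(2))
    also have "(\<lambda>x. fst (c n) * \<phi> x + snd (c n) * \<psi> x) = (\<lambda>x. ?g n x + - w x)" by (auto simp: f_def)
    also have "mass (-1) 1 (\<lambda>x. ?g n x + - w x) \<le> 2 * mass (-1) 1 (?g n) + 2 * mass (-1) 1 (\<lambda>x. - w x)"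
      by (intro mass_add_le fc continuous_intros cw)
    also have "mass (-1) 1 (?g n) \<le> ?S"
      by (rule order_trans[OF mass_mono[OF fc] bound]) auto
    finally show ?thesis using \<epsilon>(1) by (simp add: field_simps)
  qed
  have "bounded (range c)"
    unfolding bounded_iff
  proof (intro exI ballI)
    fix y assume "y \<in> range c"
    then show "norm y \<le> sqrt ((2 * ?S + 2 * mass (-1) 1 (\<lambda>x. - w x)) / \<epsilon>)"
      using cb by (auto intro: real_le_rsqrt)
  qed
  then obtain c' s where s: "strict_mono (s :: nat \<Rightarrow> nat)" "(c \<circ> s) \<longlonglongrightarrow> c'"
    using bounded_imp_convergent_subsequence by blast
  define A where "A j = fst (c (s j))" for j
  define B where "B j = snd (c (s j))" for j
  have AB: "A \<longlonglongrightarrow> fst c'" "B \<longlonglongrightarrow> snd c'"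
    using tendsto_fst[OF s(2)] tendsto_snd[OF s(2)] unfolding A_def[abs_def] B_def[abs_def] o_def by auto
  define N where "N j = real (Suc (s j))" for j
  have N: "1 \<le> N j" "real j \<le> N j" for j
    using strict_mono_imp_increasing[OF s(1), of j] by (auto simp: N_def)
  define F where "F j = f (A j) (B j)" for j
  define G where "G j = cut (- N j) (N j) (F j)" for j
  have Fz: "F j (- N j) = 0" "F j (N j) = 0" for j using c[of "s j"] by (simp_all add: F_def A_def B_def N_def)
  have Gn: "norm_sq (G j) \<le> ?S" for j
    using cut_L2(2)[OF fc[of "{- N j..N j}"]] bound[of "s j"] by (simp add: G_def F_def A_def B_def N_def)
  have GL: "G j \<in> L2" for j unfolding G_def F_def by (rule cut_L2(1)[OF fc])
  let ?f = "f (fst c') (snd c')"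
  have Flim: "(\<lambda>j. F j x) \<longlonglongrightarrow> ?f x" for x unfolding F_def f_def by (intro tendsto_intros AB)
  have Glim: "(\<lambda>j. G j x) \<longlonglongrightarrow> ?f x" for x
  proof (rule Lim_transform_eventually[OF Flim])
    obtain J :: nat where J: "\<bar>x\<bar> \<le> real J" using real_arch_simple by blast
    show "eventually (\<lambda>j. F j x = G j x) sequentially"
    proof (rule eventually_sequentiallyI[of J])
      fix j assume "J \<le> j"
      then have "\<bar>x\<bar> \<le> N j" using J N(2)[of j] by linarith
      then show "F j x = G j x" by (simp add: G_def cut_def indicator_def abs_le_iff)
    qed
  qed
  have loc: "\<exists>C. \<forall>j x. \<bar>x\<bar> \<le> L \<longrightarrow> norm (G j x) \<le> C" for L
  proof -
    have bd: "\<exists>C. \<forall>x. \<bar>x\<bar> \<le> L \<longrightarrow> norm (g x) \<le> C" if "continuous_on {-L..L} g" for g :: "real \<Rightarrow> complex"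
    proof -
      have "bounded (g ` {-L..L})" using that by (intro compact_imp_bounded compact_continuous_image) auto
      then obtain C where "\<forall>x\<in>{-L..L}. norm (g x) \<le> C" unfolding bounded_iff by auto
      then show ?thesis by (intro exI[of _ C]) (simp add: abs_le_iff)
    qed
    obtain Cw where Cw: "\<And>x. \<bar>x\<bar> \<le> L \<Longrightarrow> norm (w x) \<le> Cw" using bd[OF cw] by blast
    obtain C\<phi> where C\<phi>: "\<And>x. \<bar>x\<bar> \<le> L \<Longrightarrow> norm (\<phi> x) \<le> C\<phi>" using bd[OF c\<phi>] by blast
    obtain C\<psi> where C\<psi>: "\<And>x. \<bar>x\<bar> \<le> L \<Longrightarrow> norm (\<psi> x) \<le> C\<psi>" using bd[OF c\<psi>] by blast
    obtain CA where CA: "\<And>j. norm (A j) \<le> CA" using convergent_imp_Bseq[OF convergentI[OF AB(1)]] by (auto simp: Bseq_def)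
    obtain CB where CB: "\<And>j. norm (B j) \<le> CB" using convergent_imp_Bseq[OF convergentI[OF AB(2)]] by (auto simp: Bseq_def)
    have "norm (G j x) \<le> Cw + CA * C\<phi> + CB * C\<psi>" if x: "\<bar>x\<bar> \<le> L" for j x
    proof -
      have "norm (G j x) \<le> norm (F j x)" by (simp add: G_def cut_def indicator_def)
      also have "\<dots> \<le> norm (w x) + norm (A j * \<phi> x) + norm (B j * \<psi> x)"
        unfolding F_def f_def by (intro order_trans[OF norm_triangle_ineq] add_mono norm_triangle_ineq order_refl)
      also have "\<dots> \<le> Cw + CA * C\<phi> + CB * C\<psi>"
        unfolding norm_mult
        by (intro add_mono mult_mono Cw[OF x] CA C\<phi>[OF x] CB C\<psi>[OF x] norm_ge_zero order_trans[OF norm_ge_zero CA] order_trans[OF norm_ge_zero CB])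
      finally show ?thesis .
    qed
    then show ?thesis by blast
  qed
  have fL: "?f \<in> L2" "norm_sq ?f \<le> ?S" using weak_limit(1,2)[OF k GL Gn Glim loc] by auto
  have "dirichlet_approximation l k ?f N F (\<lambda>j. h (A j) (B j))"
    unfolding dirichlet_approximation_def
  proof (intro conjI allI ballI N Fz)
    show "solves (F j) (h (A j) (B j)) (\<lambda>x. l * F j x + k x)" for j unfolding F_def by (rule fs)
    fix g assume "g \<in> L2"
    from weak_limit(3)[OF this GL Gn Glim loc]
    show "(\<lambda>j. inner_r g (cut (- N j) (N j) (F j))) \<longlonglongrightarrow> inner_r g ?f" by (simp add: G_def)
  qed
  then show ?thesis using fs fL by blast
qed

end

section \<open>The maximal operator\<close>

lemma antideriv_on_cong_AE:
  assumes F: "antideriv_on a b F v" and eq: "AE x in lebesgue. w x = v x"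
  shows "antideriv_on a b F w"
proof -
  obtain N where N: "N \<in> null_sets lebesgue" "\<And>x. x \<notin> N \<Longrightarrow> w x = v x"
    using eq unfolding completion.AE_iff_null_sets by auto
  have neg: "negligible N" using N(1) by (simp add: negligible_iff_null_sets)
  show ?thesis
    unfolding antideriv_on_def
  proof (intro conjI allI impI)
    show "w absolutely_integrable_on {a..b}"
      by (rule absolutely_integrable_spike[where f=v, OF _ neg]) (use F N(2) in \<open>auto simp: antideriv_on_def\<close>)
    fix x y assume "a \<le> x" "x \<le> y" "y \<le> b"
    then have i: "(v has_integral F y - F x) {x..y}" by (rule antideriv_onD(1)[OF F])
    show "(w has_integral F y - F x) {x..y}"
      by (rule has_integral_spike[OF neg _ i]) (use N(2) in auto)
  qed
qed

lemma AC_loc_antideriv_on: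
  assumes "f \<in> AC_loc"
  shows "antideriv_on a b f (\<lambda>t. vector_derivative f (at t))"
proof (rule antideriv_onI)
  show "(\<lambda>t. vector_derivative f (at t)) absolutely_integrable_on {a..b}"
    using AC_loc_is_integral[OF assms, of a b] by (cases "a \<le> b") auto
  show "f y - f x = integral {x..y} (\<lambda>t. vector_derivative f (at t))" if "x \<le> y" for x y
    using AC_loc_is_integral[OF assms that] by simp
qed

lemma antideriv_on_AC_loc:
  fixes F v :: "real \<Rightarrow> complex"
  assumes F: "\<And>a b. antideriv_on a b F v"
  shows "F \<in> AC_loc" "AE x in lebesgue. vector_derivative F (at x) = v x"
proof -
  have va: "v absolutely_integrable_on {a..b}" for a b using F by (simp add: antideriv_on_def)
  have "AE x in lebesgue. (F has_vector_derivative v x) (at x)"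
    using antideriv_onD(3)[OF F order_refl _ order_refl] by (intro AE_has_vector_derivative_integral va) auto
  then show "AE x in lebesgue. vector_derivative F (at x) = v x"
    by eventually_elim (rule vector_derivative_at)
  show "F \<in> AC_loc"
    unfolding AC_loc_def mem_Collect_eq abs_cont_on_def
  proof (intro allI impI)
    fix a b e :: real assume e: "0 < e"
    define k where "k = (\<lambda>x. indicator {a..b} x *\<^sub>R norm (v x))"
    have k: "integrable lebesgue k" using absolutely_integrable_norm[OF va[of a b]]
      by (simp add: k_def set_integrable_def o_def)
    have k0: "0 \<le> k x" for x by (simp add: k_def indicator_def)
    have "0 < e / 2" using e by simp
    from integrable_small_on_small_sets[OF k k0 this] obtain m where
      m: "\<And>A. A\<in>sets lebesgue \<Longrightarrow> emeasure lebesgue A < \<infinity> \<Longrightarrow> (LINT x:A|lebesgue. k x) \<le> e / 2 + real m * measure lebesgue A"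
      by blast
    show "\<exists>d>0. \<forall>(n::nat) (u::nat \<Rightarrow> real) (w::nat \<Rightarrow> real).
        (\<forall>i<n. a \<le> u i \<and> u i \<le> w i \<and> w i \<le> b) \<longrightarrow>
        (\<forall>i<n. \<forall>j<n. i \<noteq> j \<longrightarrow> {u i<..<w i} \<inter> {u j<..<w j} = {}) \<longrightarrow>
        (\<Sum>i<n. w i - u i) < d \<longrightarrow>
        (\<Sum>i<n. norm (F (w i) - F (u i))) < e"
    proof (intro exI[of _ "e / (2 * (real m + 1))"] conjI allI impI)
      show "0 < e / (2 * (real m + 1))" using e by simp
      fix n :: nat and u w :: "nat \<Rightarrow> real"
      assume uw: "\<forall>i<n. a \<le> u i \<and> u i \<le> w i \<and> w i \<le> b"
        and dj: "\<forall>i<n. \<forall>j<n. i \<noteq> j \<longrightarrow> {u i<..<w i} \<inter> {u j<..<w j} = {}"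
        and d: "(\<Sum>i<n. w i - u i) < e / (2 * (real m + 1))"
      let ?U = "\<Union>i<n. {u i<..<w i}"
      have df: "disjoint_family_on (\<lambda>i. {u i<..<w i}) {..<n}"
        using dj by (auto simp: disjoint_family_on_def)
      have Us: "?U \<in> sets lebesgue" by (intro sets.finite_UN) auto
      have mU: "measure lebesgue ?U = (\<Sum>i<n. w i - u i)"
      proof -
        have "measure lebesgue ?U = (\<Sum>i<n. measure lebesgue {u i<..<w i})"
          using uw by (intro measure_finite_Union df) auto
        also have "\<dots> = (\<Sum>i<n. w i - u i)" using uw by (intro sum.cong) (auto simp: measure_def)
        finally show ?thesis .
      qed
      have eU: "emeasure lebesgue ?U < \<infinity>"
      proof -
        have "emeasure lebesgue ?U \<le> emeasure lebesgue {a..b}"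
        proof (intro emeasure_mono UN_least)
          fix i assume "i \<in> {..<n}"
          then have "a \<le> u i" "w i \<le> b" using uw by auto
          then show "{u i<..<w i} \<subseteq> {a..b}" by auto
        qed auto
        also have "\<dots> < \<infinity>" by (cases "a \<le> b") auto
        finally show ?thesis .
      qed
      have kI: "integrable lebesgue (\<lambda>x. indicator {u i<..<w i} x *\<^sub>R k x)" for i
        by (intro integrable_mult_indicator k) auto
      have inc: "norm (F (w i) - F (u i)) \<le> (LINT x|lebesgue. indicator {u i<..<w i} x *\<^sub>R k x)" if i: "i < n" for i
      proof -
        have le: "u i \<le> w i" "a \<le> u i" "w i \<le> b" using uw i by auto
        have vn: "(\<lambda>x. norm (v x)) absolutely_integrable_on {u i..w i}"
          using absolutely_integrable_norm[OF va[of "u i" "w i"]] by (simp add: o_def)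
        have "norm (F (w i) - F (u i)) = norm (integral {u i..w i} v)"
          using antideriv_onD(3)[OF F order_refl le(1) order_refl] by simp
        also have "\<dots> \<le> integral {u i..w i} (\<lambda>x. norm (v x))"
          using va vn by (intro integral_norm_bound_integral set_lebesgue_integral_eq_integral(1)) auto
        also have "\<dots> = (LINT x|lebesgue. indicator {u i..w i} x *\<^sub>R norm (v x))"
          using set_lebesgue_integral_eq_integral(2)[OF vn] by (simp add: set_lebesgue_integral_def)
        also have "\<dots> = (LINT x|lebesgue. indicator {u i<..<w i} x *\<^sub>R k x)"
        proof (rule integral_cong_AE)
          show "(\<lambda>x. indicator {u i..w i} x *\<^sub>R norm (v x)) \<in> borel_measurable lebesgue"
            using vn unfolding set_integrable_def by (rule borel_measurable_integrable)
          show "(\<lambda>x. indicator {u i<..<w i} x *\<^sub>R k x) \<in> borel_measurable lebesgue"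
            by (rule borel_measurable_integrable[OF kI])
          have "{u i, w i} \<in> null_sets lebesgue" by (simp add: negligible_iff_null_sets[symmetric])
          then have "AE x in lebesgue. x \<notin> {u i, w i}" by (rule AE_not_in)
          then show "AE x in lebesgue. indicator {u i..w i} x *\<^sub>R norm (v x) = indicator {u i<..<w i} x *\<^sub>R k x"
            by eventually_elim (use le in \<open>auto simp: k_def indicator_def\<close>)
        qed
        finally show ?thesis .
      qed
      have "(\<Sum>i<n. norm (F (w i) - F (u i))) \<le> (\<Sum>i<n. LINT x|lebesgue. indicator {u i<..<w i} x *\<^sub>R k x)"
        by (intro sum_mono inc) auto
      also have "\<dots> = (LINT x|lebesgue. (\<Sum>i<n. indicator {u i<..<w i} x *\<^sub>R k x))"
        using kI by (intro Bochner_Integration.integral_sum[symmetric]) auto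
      also have "\<dots> = (LINT x:?U|lebesgue. k x)"
        unfolding set_lebesgue_integral_def
        by (intro Bochner_Integration.integral_cong refl)
          (simp add: indicator_UN_disjoint[OF finite_lessThan df] scaleR_sum_left[symmetric] sum_distrib_right)
      also have "\<dots> \<le> e / 2 + real m * measure lebesgue ?U" by (rule m[OF Us eU])
      also have "real m * measure lebesgue ?U \<le> real m * (e / (2 * (real m + 1)))"
        using d by (intro mult_left_mono) (auto simp: mU)
      also have "e / 2 + real m * (e / (2 * (real m + 1))) < e" using e by (simp add: field_simps)
      finally show "(\<Sum>i<n. norm (F (w i) - F (u i))) < e" by simp
    qed
  qed
qed

lemma AC_loc_continuous: "f \<in> AC_loc \<Longrightarrow> continuous_on UNIV f"
  by (intro continuous_on_UNIV_if_intervals antideriv_on_continuous[OF AC_loc_antideriv_on])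

lemma continuous_AE_eq:
  fixes f g :: "real \<Rightarrow> complex"
  assumes f: "continuous_on UNIV f" and g: "continuous_on UNIV g" and eq: "AE x in lebesgue. f x = g x"
  shows "f = g"
proof
  fix x :: real
  have c: "continuous_on {x-1..x+1} (\<lambda>t. (norm (f t - g t))\<^sup>2)"
    by (intro continuous_intros continuous_on_subset[OF f] continuous_on_subset[OF g]) auto
  have "integral {x-1..x+1} (\<lambda>t. 1 * (norm (f t - g t))\<^sup>2) \<le> integral {x-1..x+1} (\<lambda>t. 0)"
    using c eq by (intro integral_mono_AE_interval) (auto intro: absolutely_integrable_continuous_real elim: eventually_mono)
  moreover have "0 \<le> integral {x-1..x+1} (\<lambda>t. 1 * (norm (f t - g t))\<^sup>2)"
    using c by (intro Henstock_Kurzweil_Integration.integral_nonneg) (auto intro: integrable_continuous_interval)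
  ultimately have "integral {x-1..x+1} (\<lambda>t. 1 * (norm (f t - g t))\<^sup>2) = 0" by simp
  then have "(norm (f x - g x))\<^sup>2 = 0"
    by (intro weighted_integral_zero[where w="\<lambda>_. 1" and g="\<lambda>t. (norm (f t - g t))\<^sup>2" and a="x-1" and b="x+1"] c) auto
  then show "f x = g x" by simp
qed

context sturm_liouville
begin

text \<open>Two continuous functions that agree almost everywhere are equal.\<close>

lemma quasi_deriv_eq:
  assumes "is_quasi_deriv p f h"
  shows "quasi_deriv p f = h"
  unfolding quasi_deriv_def
proof (rule the_equality[of "is_quasi_deriv p f", OF assms])
  fix h' assume h': "is_quasi_deriv p f h'"
  have "AE x in lebesgue. h' x = h x"
  proof -
    have "AE x in lebesgue. h' x = p x *\<^sub>R vector_derivative f (at x)" "AE x in lebesgue. h x = p x *\<^sub>R vector_derivative f (at x)"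
      using assms h' by (auto simp: is_quasi_deriv_def)
    then show ?thesis by eventually_elim simp
  qed
  then show "h' = h"
    using assms h' by (intro continuous_AE_eq AC_loc_continuous) (auto simp: is_quasi_deriv_def)
qed

lemma SL_domain_solves:
  assumes "f \<in> SL_domain p q r"
  shows "f \<in> L2" "SL_expr p q r f \<in> L2" "\<exists>h. solves f h (SL_expr p q r f)"
proof -
  show "f \<in> L2" "SL_expr p q r f \<in> L2" using assms by (auto simp: SL_domain_def)
  obtain h where h: "is_quasi_deriv p f h" and f: "f \<in> AC_loc" using assms by (auto simp: SL_domain_def)
  have hAC: "h \<in> AC_loc" and hp: "AE x in lebesgue. h x = p x *\<^sub>R vector_derivative f (at x)"
    using h by (auto simp: is_quasi_deriv_def)
  have "antideriv_on a b f (velocity h)" for a b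
  proof (rule antideriv_on_cong_AE[OF AC_loc_antideriv_on[OF f]])
    show "AE x in lebesgue. velocity h x = vector_derivative f (at x)"
      using hp p_pos by eventually_elim (simp add: velocity_def scaleR_conv_of_real)
  qed
  moreover have "antideriv_on a b h (\<lambda>x. complex_of_real (q x) * f x - complex_of_real (r x) * SL_expr p q r f x)" for a b
  proof (rule antideriv_on_cong_AE[OF AC_loc_antideriv_on[OF hAC]])
    show "AE x in lebesgue. complex_of_real (q x) * f x - complex_of_real (r x) * SL_expr p q r f x = vector_derivative h (at x)"
      using r_pos by eventually_elim (simp add: SL_expr_def quasi_deriv_eq[OF h] scaleR_conv_of_real)
  qed
  ultimately show "\<exists>h. solves f h (SL_expr p q r f)" by (auto simp: solves_def)
qed

lemma solves_SL_domain:
  assumes s: "solves f h k" and f: "f \<in> L2" and k: "k \<in> L2"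
  shows "f \<in> SL_domain p q r" "AE x in M. SL_expr p q r f x = k x"
proof -
  have fa: "f \<in> AC_loc" "AE x in lebesgue. vector_derivative f (at x) = velocity h x"
    using s by (auto intro!: antideriv_on_AC_loc simp: solves_def)
  have ha: "h \<in> AC_loc" "AE x in lebesgue. vector_derivative h (at x) = complex_of_real (q x) * f x - complex_of_real (r x) * k x"
    using s antideriv_on_AC_loc[of h] by (auto simp: solves_def)
  have h: "is_quasi_deriv p f h"
    unfolding is_quasi_deriv_def
  proof (intro conjI ha(1))
    show "AE x in lebesgue. h x = p x *\<^sub>R vector_derivative f (at x)"
      using fa(2) p_pos by eventually_elim (simp add: velocity_def scaleR_conv_of_real)
  qed
  have eq: "AE x in lebesgue. SL_expr p q r f x = k x"
    using ha(2) r_pos by eventually_elim (simp add: SL_expr_def quasi_deriv_eq[OF h] scaleR_conv_of_real)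
  then show eqM: "AE x in M. SL_expr p q r f x = k x" by (simp add: AE_M)
  have eq': "AE x in lebesgue. k x = SL_expr p q r f x" using eq by eventually_elim simp
  have m: "SL_expr p q r f \<in> borel_measurable M"
    unfolding measurable_M by (rule borel_measurable_AE[OF L2D(1)[OF k, unfolded measurable_M] eq'])
  have "integrable M (\<lambda>x. (norm (SL_expr p q r f x))\<^sup>2)"
    using L2D(2)[OF k]
  proof (rule integrable_cong_AE_imp)
    show "(\<lambda>x. (norm (SL_expr p q r f x))\<^sup>2) \<in> borel_measurable M" using m by measurable
    show "AE x in M. (norm (k x))\<^sup>2 = (norm (SL_expr p q r f x))\<^sup>2" using eqM by eventually_elim simp
  qed
  then show "f \<in> SL_domain p q r" using f fa(1) h m by (auto simp: SL_domain_def L2_space_def)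
qed

lemma solves_cong_AE:
  assumes "solves f h k" "AE x in lebesgue. k' x = k x"
  shows "solves f h k'"
  unfolding solves_def
proof (intro conjI allI)
  fix a b
  show "antideriv_on a b f (velocity h)" using assms by (simp add: solves_def)
  show "antideriv_on a b h (\<lambda>x. complex_of_real (q x) * f x - complex_of_real (r x) * k' x)"
    by (rule antideriv_on_cong_AE[of a b h "\<lambda>x. complex_of_real (q x) * f x - complex_of_real (r x) * k x"])
      (use assms in \<open>auto simp: solves_def elim: eventually_mono\<close>)
qed

definition quotients :: "real set" where
  "quotients = {energy (-a) a f v / mass (-a) a f | a f v. 1 \<le> a \<and> dirichlet a f v \<and> 0 < mass (-a) a f}"

definition bottom :: real where "bottom = Inf quotients"

lemma dirichlet_continuous: "dirichlet a f v \<Longrightarrow> continuous_on {-a..a} f"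
  by (auto simp: dirichlet_def finite_energy_def intro: antideriv_on_continuous)

lemma quotients_bounded_below: "\<exists>K. \<forall>x\<in>quotients. - K \<le> x"
proof -
  obtain K where K: "\<And>a b f v. finite_energy a b f v \<Longrightarrow> 1 \<le> b - a \<Longrightarrow> - K * mass a b f \<le> energy a b f v"
    using energy_coercive by blast
  have "- K \<le> energy (-a) a f v / mass (-a) a f" if "1 \<le> a" "dirichlet a f v" "0 < mass (-a) a f" for a f v
    using K[of "-a" a f v] that by (simp add: dirichlet_def pos_le_divide_eq)
  then show ?thesis by (intro exI[of _ K]) (auto simp: quotients_def)
qed

text \<open>For functions of zero mass the assertion is that the energy is nonnegative, which follows from coercivity.\<close>

lemma bottom_le:
  assumes a: "1 \<le> a" and f: "dirichlet a f v"
  shows "bottom * mass (-a) a f \<le> energy (-a) a f v"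
proof -
  have m0: "0 \<le> mass (-a) a f" by (rule mass_nonneg[OF dirichlet_continuous[OF f]])
  show ?thesis
  proof (cases "mass (-a) a f = 0")
    case True
    obtain K where K: "\<And>a b f v. finite_energy a b f v \<Longrightarrow> 1 \<le> b - a \<Longrightarrow> - K * mass a b f \<le> energy a b f v"
      using energy_coercive by blast
    have "- K * mass (-a) a f \<le> energy (-a) a f v" by (rule K) (use f a in \<open>auto simp: dirichlet_def\<close>)
    then show ?thesis using True by simp
  next
    case False
    then have m: "0 < mass (-a) a f" using m0 by simp
    have "bottom \<le> energy (-a) a f v / mass (-a) a f"
      unfolding bottom_def
    proof (rule cInf_lower)
      show "energy (-a) a f v / mass (-a) a f \<in> quotients" using a f m by (auto simp: quotients_def)
      show "bdd_below quotients" using quotients_bounded_below by (auto simp: bdd_below_def)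
    qed
    then show ?thesis using m by (simp add: pos_le_divide_eq)
  qed
qed

text \<open>The imaginary part of \<open>\<langle>(T - z)f,f\<rangle>\<close> is \<open>-Im z\<close> times the mass; for real \<open>z\<close> the lower bound of the form is used.\<close>

lemma coercive_at_if:
  assumes m: "\<And>a f v. 1 \<le> a \<Longrightarrow> dirichlet a f v \<Longrightarrow> m * mass (-a) a f \<le> energy (-a) a f v"
    and z: "Im z \<noteq> 0 \<or> Re z < m"
  shows "\<exists>d. coercive_at z d"
proof (intro exI)
  let ?d = "if Im z \<noteq> 0 then \<bar>Im z\<bar> else m - Re z"
  show "coercive_at z ?d"
    unfolding coercive_at_def
  proof (intro conjI allI impI)
    show "0 < ?d" using z by auto
    fix a f v assume a: "1 \<le> a" and f: "dirichlet a f v"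
    let ?E = "energy (-a) a f v" and ?m = "mass (-a) a f"
    have m0: "0 \<le> ?m" by (rule mass_nonneg[OF dirichlet_continuous[OF f]])
    let ?w = "complex_of_real ?E - z * complex_of_real ?m"
    show "?d * ?m \<le> norm ?w"
    proof (cases "Im z = 0")
      case False
      have "\<bar>Im ?w\<bar> = \<bar>Im z\<bar> * ?m" using m0 by (simp add: abs_mult)
      then show ?thesis using abs_Im_le_cmod[of ?w] False by simp
    next
      case True
      have "(m - Re z) * ?m \<le> Re ?w" using m[OF a f] by (simp add: algebra_simps)
      then show ?thesis using abs_Re_le_cmod[of ?w] True by simp
    qed
  qed
qed

text \<open>A Dirichlet solution on \<open>[-1,1]\<close> for a right-hand side that equals one there cannot vanish identically.\<close>

lemma quotients_nonempty: "quotients \<noteq> {}"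
proof -
  obtain K where K: "\<And>a b f v. finite_energy a b f v \<Longrightarrow> 1 \<le> b - a \<Longrightarrow> - K * mass a b f \<le> energy a b f v"
    using energy_coercive by blast
  have Kd: "- K * mass (-a) a f \<le> energy (-a) a f v" if "1 \<le> a" "dirichlet a f v" for a f v
    by (rule K) (use that in \<open>auto simp: dirichlet_def\<close>)
  obtain d where d: "coercive_at (complex_of_real (- K - 1)) d"
    using coercive_at_if[of "- K" "complex_of_real (- K - 1)"] Kd by auto
  let ?l = "complex_of_real (- K - 1)"
  let ?k = "cut (-1) 1 (\<lambda>x. 1)"
  have k: "?k \<in> L2" by (intro cut_L2(1)) auto
  have z: "(\<lambda>x. complex_of_real (r x) * 0) absolutely_integrable_on {a..b}" for a b by simp
  obtain w hw where w: "solves w hw (\<lambda>x. ?l * w x + ?k x)"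
    using solves_exists[OF L2_weighted_loc[OF k], of 0 0 ?l] by blast
  obtain \<phi> h\<phi> where \<phi>: "solves \<phi> h\<phi> (\<lambda>x. ?l * \<phi> x)" "\<phi> 0 = 1" "h\<phi> 0 = 0"
    using solves_exists[OF z, of 1 0 ?l] by auto
  obtain \<psi> h\<psi> where \<psi>: "solves \<psi> h\<psi> (\<lambda>x. ?l * \<psi> x)" "\<psi> 0 = 0" "h\<psi> 0 = 1"
    using solves_exists[OF z, of 0 1 ?l] by auto
  obtain A B where AB: "w (-1) + A * \<phi> (-1) + B * \<psi> (-1) = 0" "w 1 + A * \<phi> 1 + B * \<psi> 1 = 0"
    using dirichlet_solution_exists[OF d k order_refl w \<phi> \<psi>] by blast
  let ?f = "\<lambda>x. w x + A * \<phi> x + B * \<psi> x" and ?h = "\<lambda>x. hw x + A * h\<phi> x + B * h\<psi> x"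
  have f: "solves ?f ?h (\<lambda>x. ?l * ?f x + ?k x)" by (rule solves_add_homogeneous[OF w \<phi>(1) \<psi>(1)])
  have dir: "dirichlet 1 ?f (velocity ?h)" by (rule solves_dirichlet[OF f]) (use AB in auto)
  have c: "continuous_on {-1..1} ?f" by (rule solves_continuous(1)[OF f])
  have "mass (-1) 1 ?f \<noteq> 0"
  proof
    assume m: "mass (-1) 1 ?f = 0"
    have f0: "?f x = 0" if "x \<in> {-1..1}" for x by (rule mass_zero_imp[OF _ c m that]) simp
    have h0: "?h x = 0" if "x \<in> {-1..1}" for x
      by (rule solves_zero_imp_momentum_zero[OF f, of "-1" 1]) (use f0 that in auto)
    have "antideriv_on (-1) 1 ?h (\<lambda>x. complex_of_real (q x) * ?f x - complex_of_real (r x) * (?l * ?f x + ?k x))"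
      using f unfolding solves_def by blast
    then have "((\<lambda>x. complex_of_real (q x) * ?f x - complex_of_real (r x) * (?l * ?f x + ?k x)) has_integral ?h 1 - ?h (-1)) {-1..1}"
      by (rule antideriv_onD(1)) auto
    then have "((\<lambda>x. - complex_of_real (r x)) has_integral ?h 1 - ?h (-1)) {-1..1}"
      by (rule has_integral_eq[rotated]) (simp add: f0 cut_def)
    then have "((\<lambda>x. - complex_of_real (r x)) has_integral 0) {-1..1}" using h0[of 1] h0[of "-1"] by simp
    from has_integral_linear[OF this bounded_linear_Re]
    have "((\<lambda>x. - r x) has_integral 0) {-1..1}" by (simp add: o_def)
    from has_integral_neg[OF this] have "(r has_integral 0) {-1..1}" by simp
    then have "integral {-1..1} (\<lambda>x. r x * 1) = 0" by (simp add: integral_unique)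
    then have "(1::real) = 0"
      by (intro weighted_integral_zero[OF _ r_loc r_pos, where g="\<lambda>x. 1" and a="-1" and b=1 and x=0]) auto
    then show False by simp
  qed
  then have "0 < mass (-1) 1 ?f" using mass_nonneg[OF c] by simp
  then show ?thesis using dir by (auto simp: quotients_def)
qed

lemma bottom_ge:
  assumes "\<And>a f v. 1 \<le> a \<Longrightarrow> dirichlet a f v \<Longrightarrow> c * mass (-a) a f \<le> energy (-a) a f v"
  shows "c \<le> bottom"
  unfolding bottom_def
proof (rule cInf_greatest[OF quotients_nonempty])
  fix x assume "x \<in> quotients"
  then show "c \<le> x" using assms by (auto simp: quotients_def pos_le_divide_eq)
qed

text \<open>The limit of the exhaustion at \<open>l0\<close> solves the same equation as \<open>f\<close>, hence equals \<open>f\<close> by the limit-point property.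
Thus information about Dirichlet problems passes to the whole maximal domain.\<close>

lemma solves_L2_approximation:
  "\<exists>l0 d. l0 < bottom \<and> coercive_at (complex_of_real l0) d \<and>
     (\<forall>f h k. solves f h k \<longrightarrow> f \<in> L2 \<longrightarrow> k \<in> L2 \<longrightarrow>
        (\<exists>N F H. dirichlet_approximation (complex_of_real l0) (\<lambda>x. k x + (- complex_of_real l0) * f x) f N F H))"
proof -
  obtain K where K: "\<And>a b f v. finite_energy a b f v \<Longrightarrow> 1 \<le> b - a \<Longrightarrow> - K * mass a b f \<le> energy a b f v"
    using energy_coercive by blast
  define l0 where "l0 = min (bottom - 1) (- K - 1)"
  have l0: "l0 < bottom" "l0 < - K" by (auto simp: l0_def)
  obtain d where d: "coercive_at (complex_of_real l0) d"
    using coercive_at_if[OF bottom_le, of "complex_of_real l0"] l0 by auto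
  have "\<exists>N F H. dirichlet_approximation (complex_of_real l0) (\<lambda>x. k x + (- complex_of_real l0) * f x) f N F H"
    if s: "solves f h k" and f: "f \<in> L2" and k: "k \<in> L2" for f h k
  proof -
    let ?g = "\<lambda>x. k x + (- complex_of_real l0) * f x"
    have g: "?g \<in> L2" by (rule L2_add_scaled[OF k f])
    obtain f' h' N F H where *: "solves f' h' (\<lambda>x. complex_of_real l0 * f' x + ?g x)" "f' \<in> L2"
      "dirichlet_approximation (complex_of_real l0) ?g f' N F H"
      using exhaustion[OF d g] by blast
    let ?u = "\<lambda>x. f' x + (-1) * f x"
    have "solves ?u (\<lambda>x. h' x + (-1) * h x) (\<lambda>x. (complex_of_real l0 * f' x + ?g x) + (-1) * k x)"
      by (rule solves_add_scaled[OF *(1) s])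
    also have "(\<lambda>x. (complex_of_real l0 * f' x + ?g x) + (-1) * k x) = (\<lambda>x. complex_of_real l0 * ?u x)"
      by (auto simp: algebra_simps)
    finally have us: "solves ?u (\<lambda>x. h' x + (-1) * h x) (\<lambda>x. complex_of_real l0 * ?u x)" .
    have uL: "?u \<in> L2" by (rule L2_add_scaled[OF *(2) f])
    have um: "(\<lambda>x. (norm (?u x))\<^sup>2) \<in> borel_measurable lebesgue"
      using L2D(1)[OF uL] unfolding measurable_M by measurable
    have ui: "integrable lebesgue (\<lambda>x. r x * (norm (?u x))\<^sup>2)"
      using L2D(2)[OF uL] unfolding integrable_M[OF um] by simp
    have "?u x = 0" for x by (rule limit_point[OF K l0(2) us ui])
    then have "f' = f" by auto
    then show ?thesis using *(3) by blast
  qed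
  then show ?thesis using l0 d by blast
qed

text \<open>Weak lower semicontinuity of the norm in the form in which it survives multiplication by constants.\<close>

lemma norm_sq_lower:
  assumes f: "f \<in> L2" and g: "g \<in> L2"
  shows "2 * Re (inner_r f g) - norm_sq f \<le> norm_sq g"
proof -
  define c where "c x = Re (f x * cnj (g x))" for x
  have ci: "integrable M c" and cI: "(LINT x|M. c x) = Re (inner_r f g)"
    unfolding c_def[abs_def] inner_r_def by (intro integrable_Re integral_Re L2_mult(1) f g)+
  have "0 \<le> (LINT x|M. (norm (f x))\<^sup>2 - 2 * c x + (norm (g x))\<^sup>2)"
  proof (intro Bochner_Integration.integral_nonneg)
    fix x
    have "(norm (f x))\<^sup>2 - 2 * Re (f x * cnj (g x)) + (norm (g x))\<^sup>2 = (norm (f x - g x))\<^sup>2"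
      unfolding cmod_power2 by (simp add: power2_eq_square algebra_simps)
    then show "0 \<le> (norm (f x))\<^sup>2 - 2 * c x + (norm (g x))\<^sup>2" by (simp add: c_def)
  qed
  also have "\<dots> = norm_sq f - 2 * Re (inner_r f g) + norm_sq g"
    unfolding norm_sq_def cI[symmetric] using L2D(2)[OF f] L2D(2)[OF g] ci by simp
  finally show ?thesis by simp
qed

text \<open>For the Dirichlet approximants, \<open>\<langle>k - l\<^sub>0f, f\<^sub>j\<rangle>\<close> is the energy of \<open>f\<^sub>j\<close> minus \<open>l\<^sub>0\<close> times its mass: a real number
bounded below by \<open>(bottom - l\<^sub>0)\<parallel>f\<^sub>j\<parallel>\<^sup>2\<close>. Both properties pass to the weak limit.\<close>

lemma numerical_range:
  assumes s: "solves f h k" and f: "f \<in> L2" and k: "k \<in> L2"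
  shows "Im (inner_r k f) = 0" "bottom * norm_sq f \<le> Re (inner_r k f)"
proof -
  obtain l0 d N F H where l0: "l0 < bottom"
    and A: "dirichlet_approximation (complex_of_real l0) (\<lambda>x. k x + (- complex_of_real l0) * f x) f N F H"
    using solves_L2_approximation s f k by blast
  let ?g = "\<lambda>x. k x + (- complex_of_real l0) * f x"
  have g: "?g \<in> L2" by (rule L2_add_scaled[OF k f])
  let ?G = "\<lambda>j. cut (- N j) (N j) (F j)"
  have N: "1 \<le> N j" and Fs: "solves (F j) (H j) (\<lambda>x. complex_of_real l0 * F j x + ?g x)"
    and Fz: "F j (- N j) = 0" "F j (N j) = 0" for j
    using A by (auto simp: dirichlet_approximation_def)
  have lim: "(\<lambda>j. inner_r u (?G j)) \<longlonglongrightarrow> inner_r u f" if "u \<in> L2" for u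
    using A that by (auto simp: dirichlet_approximation_def)
  have N0: "0 < N j" for j using N[of j] by simp
  have c: "continuous_on S (F j)" for j S by (rule solves_continuous(1)[OF Fs])
  have GL: "?G j \<in> L2" and Gn: "norm_sq (?G j) = mass (- N j) (N j) (F j)" for j by (rule cut_L2[OF c])+
  let ?E = "\<lambda>j. energy (- N j) (N j) (F j) (velocity (H j))"
  have id: "inner_r ?g (?G j) = complex_of_real (?E j - l0 * norm_sq (?G j))" for j
    using dirichlet_energy_identity[OF Fs g N0 Fz] by (simp add: Gn)
  have lower: "(bottom - l0) * (2 * Re (inner_r f (?G j)) - norm_sq f) \<le> Re (inner_r ?g (?G j))" for j
  proof -
    have "(bottom - l0) * (2 * Re (inner_r f (?G j)) - norm_sq f) \<le> (bottom - l0) * norm_sq (?G j)"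
      using l0 norm_sq_lower[OF f GL] by (intro mult_left_mono) auto
    also have "\<dots> \<le> ?E j - l0 * norm_sq (?G j)"
      using bottom_le[OF N solves_dirichlet[OF Fs N0 Fz]] by (simp add: Gn algebra_simps)
    finally show ?thesis unfolding id by simp
  qed
  have expand: "inner_r ?g f = inner_r k f - complex_of_real (l0 * norm_sq f)"
    unfolding inner_r_add_scaled[OF k f f] inner_r_self by simp
  have "(\<lambda>j. Im (inner_r ?g (?G j))) \<longlonglongrightarrow> Im (inner_r ?g f)" by (intro tendsto_Im lim g)
  then have "(\<lambda>j. 0::real) \<longlonglongrightarrow> Im (inner_r ?g f)" unfolding id by simp
  then have "Im (inner_r ?g f) = 0" using LIMSEQ_unique tendsto_const by metis
  then show "Im (inner_r k f) = 0" unfolding expand by simp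
  have 1: "(\<lambda>j. (bottom - l0) * (2 * Re (inner_r f (?G j)) - norm_sq f)) \<longlonglongrightarrow> (bottom - l0) * (2 * Re (inner_r f f) - norm_sq f)"
    by (intro tendsto_intros lim f)
  have 2: "(\<lambda>j. Re (inner_r ?g (?G j))) \<longlonglongrightarrow> Re (inner_r ?g f)" by (intro tendsto_Re lim g)
  have "(bottom - l0) * (2 * Re (inner_r f f) - norm_sq f) \<le> Re (inner_r ?g f)"
    by (rule LIMSEQ_le[OF 1 2]) (use lower in blast)
  then show "bottom * norm_sq f \<le> Re (inner_r k f)"
    unfolding expand inner_r_self by (simp add: algebra_simps)
qed

lemma norm_sq_zero_iff:
  assumes "f \<in> L2"
  shows "norm_sq f = 0 \<longleftrightarrow> (AE x in M. f x = 0)"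
  unfolding norm_sq_def using integral_nonneg_eq_0_iff_AE[OF L2D(2)[OF assms]] by simp

lemma inner_r_cong_AE:
  assumes "AE x in M. k x = k' x" "k \<in> L2" "k' \<in> L2" "f \<in> L2"
  shows "inner_r k f = inner_r k' f"
  unfolding inner_r_def
  using assms(1) L2_mult(1)[OF assms(2,4)] L2_mult(1)[OF assms(3,4)]
  by (intro integral_cong_AE) (auto elim: eventually_mono)

lemma L2_norm_eq: "L2_norm M f = sqrt (norm_sq f)" by (simp add: L2_norm_def norm_sq_def)

text \<open>Surjectivity and the bound for the inverse come from the exhaustion at \<open>z\<close>, injectivity from the numerical range.\<close>

lemma resolvent_if:
  assumes z: "Im z \<noteq> 0 \<or> Re z < bottom"
  shows "z \<in> resolvent_set M (SL_domain p q r) (SL_expr p q r)"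
proof -
  obtain d where d: "coercive_at z d" using coercive_at_if[OF bottom_le z] by blast
  have d0: "0 < d" using d by (simp add: coercive_at_def)
  have inj: "AE x in M. u x = 0" if s: "solves u h (\<lambda>x. z * u x)" and u: "u \<in> L2" for u h
  proof -
    have zu: "(\<lambda>x. 0 + z * u x) \<in> L2" by (rule L2_add_scaled[OF zero_in_L2 u])
    have e: "inner_r (\<lambda>x. z * u x) u = z * complex_of_real (norm_sq u)"
      using inner_r_add_scaled[OF zero_in_L2 u u, of z] inner_r_self[of u] by (simp add: inner_r_def)
    have "Im z * norm_sq u = 0" "bottom * norm_sq u \<le> Re z * norm_sq u"
      using numerical_range[OF s u] zu e by auto
    then have "norm_sq u = 0"
      using z norm_sq_nonneg[of u] by (auto simp: mult_le_cancel_right)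
    then show ?thesis using norm_sq_zero_iff[OF u] by simp
  qed
  let ?A = "SL_expr p q r" and ?D = "SL_domain p q r"
  have residual: "(\<lambda>x. ?A f x - z * f x) \<in> L2" if "f \<in> ?D" for f
    using L2_add_scaled[OF SL_domain_solves(2,1)[OF that], of "- z"] by simp
  show ?thesis
    unfolding resolvent_set_def mem_Collect_eq
  proof (intro conjI ballI impI)
    fix f assume f: "f \<in> ?D" and ae: "AE x in M. ?A f x - z * f x = 0"
    obtain h where "solves f h (?A f)" using SL_domain_solves(3)[OF f] by blast
    moreover have "AE x in lebesgue. z * f x = ?A f x" using ae unfolding AE_M by eventually_elim simp
    ultimately have "solves f h (\<lambda>x. z * f x)" by (rule solves_cong_AE)
    then show "AE x in M. f x = 0" by (rule inj[OF _ SL_domain_solves(1)[OF f]])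
  next
    fix k assume k: "k \<in> L2"
    obtain f h where f: "solves f h (\<lambda>x. z * f x + k x)" "f \<in> L2" using exhaustion[OF d k] by blast
    have "(\<lambda>x. k x + z * f x) \<in> L2" by (rule L2_add_scaled[OF k f(2)])
    then have "(\<lambda>x. z * f x + k x) \<in> L2" by (simp add: add.commute)
    note dom = solves_SL_domain[OF f this]
    have "AE x in M. ?A f x - z * f x = k x" using dom(2) by eventually_elim simp
    then show "\<exists>f\<in>?D. AE x in M. ?A f x - z * f x = k x" using dom(1) by blast
  next
    show "\<exists>C. \<forall>f\<in>?D. L2_norm M f \<le> C * L2_norm M (\<lambda>x. ?A f x - z * f x)"
    proof (intro exI ballI)
      fix f assume f: "f \<in> ?D"
      let ?k = "\<lambda>x. ?A f x - z * f x"
      obtain h where h: "solves f h (?A f)" using SL_domain_solves(3)[OF f] by blast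
      have fL: "f \<in> L2" by (rule SL_domain_solves(1)[OF f])
      obtain f' h' where f': "solves f' h' (\<lambda>x. z * f' x + ?k x)" "f' \<in> L2" "norm_sq f' \<le> norm_sq ?k / d\<^sup>2"
        using exhaustion[OF d residual[OF f]] by blast
      have uL: "(\<lambda>x. f' x + (-1) * f x) \<in> L2" by (rule L2_add_scaled[OF f'(2) fL])
      have "solves (\<lambda>x. f' x + (-1) * f x) (\<lambda>x. h' x + (-1) * h x) (\<lambda>x. (z * f' x + ?k x) + (-1) * ?A f x)"
        by (rule solves_add_scaled[OF f'(1) h])
      also have "(\<lambda>x. (z * f' x + ?k x) + (-1) * ?A f x) = (\<lambda>x. z * (f' x + (-1) * f x))"
        by (auto simp: algebra_simps)
      finally have "AE x in M. f' x + (-1) * f x = 0" by (rule inj[OF _ uL])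
      then have "AE x in M. (norm (f x))\<^sup>2 = (norm (f' x))\<^sup>2" by eventually_elim simp
      then have "norm_sq f = norm_sq f'"
        unfolding norm_sq_def using L2D(2)[OF fL] L2D(2)[OF f'(2)] by (intro integral_cong_AE) auto
      then have "sqrt (norm_sq f) \<le> sqrt (norm_sq ?k / d\<^sup>2)" using f'(3) by simp
      also have "\<dots> = (1 / d) * sqrt (norm_sq ?k)" using d0 by (simp add: real_sqrt_divide)
      finally show "L2_norm M f \<le> (1 / d) * L2_norm M ?k" by (simp add: L2_norm_eq)
    qed
  qed
qed

lemma dirichlet_extension:
  assumes f: "dirichlet a f v" and ab: "a \<le> b"
  shows "antideriv_on (-b) b (cut (-a) a f) (cut (-a) a v)"
proof -
  have fa: "antideriv_on (-a) a f v" and a: "-a < a" and z: "f (-a) = 0" "f a = 0"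
    using f by (auto simp: dirichlet_def finite_energy_def)
  have a0: "0 < a" using a by simp
  have cva: "cut (-a) a v absolutely_integrable_on {x..y}" for x y
  proof -
    have "integrable lebesgue (cut (-a) a v)" using fa by (simp add: antideriv_on_def set_integrable_def cut_def)
    then show ?thesis unfolding set_integrable_def by (intro integrable_mult_indicator) auto
  qed
  show ?thesis
  proof (rule antideriv_onI[OF cva])
    fix x y assume xy: "-b \<le> x" "x \<le> y" "y \<le> b"
    have "integral {x..y} (cut (-a) a v) = integral {x..y} (\<lambda>t. if t \<in> {-a..a} then v t else 0)"
      by (intro integral_cong) (simp add: cut_def)
    also have "\<dots> = integral ({x..y} \<inter> {-a..a}) v" by (simp only: integral_restrict_Int Int_commute)
    also have "{x..y} \<inter> {-a..a} = {max x (-a)..min y a}" by auto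
    also have "integral {max x (-a)..min y a} v = cut (-a) a f y - cut (-a) a f x"
    proof (cases "max x (-a) \<le> min y a")
      case True
      have "integral {max x (-a)..min y a} v = f (min y a) - f (max x (-a))"
        by (rule antideriv_onD(3)[OF fa]) (use True in auto)
      also have "f (min y a) = cut (-a) a f y" using True z a0 by (cases "y \<le> a") (auto simp: cut_def indicator_def min_def)
      also have "f (max x (-a)) = cut (-a) a f x" using True z a0 by (cases "-a \<le> x") (auto simp: cut_def indicator_def max_def)
      finally show ?thesis .
    next
      case False
      then have "cut (-a) a f y = 0" "cut (-a) a f x = 0" using xy a0 by (auto simp: cut_def indicator_def)
      then show ?thesis using False by simp
    qed
    finally show "cut (-a) a f y - cut (-a) a f x = integral {x..y} (cut (-a) a v)" by simp
  qed
qed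

end

section \<open>The bottom of the spectrum\<close>

context sturm_liouville
begin

lemma finite_energy_extension:
  assumes f: "dirichlet a f v" and ab: "a \<le> b"
  shows "finite_energy (-b) b (cut (-a) a f) (cut (-a) a v)"
    "energy (-b) b (cut (-a) a f) (cut (-a) a v) = energy (-a) a f v"
    "mass (-b) b (cut (-a) a f) = mass (-a) a f"
    "cut (-b) b (cut (-a) a f) = cut (-a) a f"
proof -
  have fa: "(\<lambda>x. p x * (norm (v x))\<^sup>2) absolutely_integrable_on {-a..a}" and a: "-a < a"
    using f by (auto simp: dirichlet_def finite_energy_def)
  have restr: "(\<lambda>x. p x * (norm (cut (-a) a v x))\<^sup>2) = (\<lambda>x. indicator {-a..a} x *\<^sub>R (p x * (norm (v x))\<^sup>2))"
    by (auto simp: cut_def indicator_def)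
  have "integrable lebesgue (\<lambda>x. p x * (norm (cut (-a) a v x))\<^sup>2)"
    unfolding restr using fa by (simp only: set_integrable_def)
  then have "(\<lambda>x. p x * (norm (cut (-a) a v x))\<^sup>2) absolutely_integrable_on {-b..b}"
    unfolding set_integrable_def by (intro integrable_mult_indicator) auto
  then show "finite_energy (-b) b (cut (-a) a f) (cut (-a) a v)"
    using dirichlet_extension[OF f ab] a ab by (simp add: finite_energy_def)
  have sub: "{-b..b} \<inter> {-a..a} = {-a..a}" "{-a..a} \<inter> {-b..b} = {-a..a}" using ab by auto
  have "energy (-b) b (cut (-a) a f) (cut (-a) a v) = integral {-b..b} (\<lambda>x. if x \<in> {-a..a} then p x * (norm (v x))\<^sup>2 + q x * (norm (f x))\<^sup>2 else 0)"
    unfolding energy_def by (intro integral_cong) (simp add: cut_def)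
  also have "\<dots> = energy (-a) a f v"
    unfolding energy_def by (simp only: integral_restrict_Int Int_commute sub)
  finally show "energy (-b) b (cut (-a) a f) (cut (-a) a v) = energy (-a) a f v" .
  have "mass (-b) b (cut (-a) a f) = integral {-b..b} (\<lambda>x. if x \<in> {-a..a} then r x * (norm (f x))\<^sup>2 else 0)"
    unfolding mass_def by (intro integral_cong) (simp add: cut_def)
  also have "\<dots> = mass (-a) a f"
    unfolding mass_def by (simp only: integral_restrict_Int Int_commute sub)
  finally show "mass (-b) b (cut (-a) a f) = mass (-a) a f" .
  show "cut (-b) b (cut (-a) a f) = cut (-a) a f" using ab by (auto simp: cut_def indicator_def)
qed

lemma energy_combination:
  assumes f: "finite_energy a b f v" and u: "solves u h k"
  shows "finite_energy a b (\<lambda>x. f x - of_real t * u x) (\<lambda>x. v x - of_real t * velocity h x)"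
    "energy a b (\<lambda>x. f x - of_real t * u x) (\<lambda>x. v x - of_real t * velocity h x) =
       energy a b f v - 2 * t * Re (form a b u h f v) + t\<^sup>2 * energy a b u (velocity h)"
proof -
  have ab: "a < b" and fv: "antideriv_on a b f v" and Ef: "(\<lambda>x. p x * (norm (v x))\<^sup>2) absolutely_integrable_on {a..b}"
    using f by (auto simp: finite_energy_def)
  have uv: "antideriv_on a b u (velocity h)" and Eu: "(\<lambda>x. p x * (norm (velocity h x))\<^sup>2) absolutely_integrable_on {a..b}"
    using solves_finite_energy[OF u ab] by (auto simp: finite_energy_def)
  have cf: "continuous_on {a..b} f" by (rule antideriv_on_continuous[OF fv])
  have cu: "continuous_on {a..b} u" and ch: "continuous_on {a..b} h" using solves_continuous[OF u] by auto
  have va: "v absolutely_integrable_on {a..b}" using fv by (simp add: antideriv_on_def)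
  have cva: "(\<lambda>x. cnj (v x)) absolutely_integrable_on {a..b}"
    using absolutely_integrable_linear[OF va bounded_linear_cnj] by (simp add: o_def)
  have hv: "(\<lambda>x. h x * cnj (v x)) absolutely_integrable_on {a..b}"
    by (rule continuous_times_absolutely_integrable(1)[OF ch cva])
  have quf: "(\<lambda>x. complex_of_real (q x) * (u x * cnj (f x))) absolutely_integrable_on {a..b}"
    by (intro continuous_times_absolutely_integrable(2) continuous_intros cu cf of_real_absolutely_integrable q_loc)
  have Rhv: "(\<lambda>x. Re (h x * cnj (v x))) absolutely_integrable_on {a..b}"
    using absolutely_integrable_linear[OF hv bounded_linear_Re] by (simp add: o_def)
  define e where "e x = p x * (norm (v x))\<^sup>2 - 2 * t * Re (h x * cnj (v x)) + t\<^sup>2 * (p x * (norm (velocity h x))\<^sup>2)" for x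
  have ea: "e absolutely_integrable_on {a..b}"
    unfolding e_def[abs_def] by (intro set_integral_add(1) set_integral_diff(1) set_integrable_mult_right Ef Eu Rhv)
  have kin: "AE x in lebesgue. p x * (norm (v x - of_real t * velocity h x))\<^sup>2 = e x"
    using p_pos
  proof eventually_elim
    case (elim x)
    have hx: "h x = of_real (p x) * velocity h x" using elim by (simp add: velocity_def)
    have "(norm (v x - of_real t * velocity h x))\<^sup>2 = (norm (v x))\<^sup>2 - 2 * t * Re (velocity h x * cnj (v x)) + t\<^sup>2 * (norm (velocity h x))\<^sup>2"
      unfolding cmod_power2 by (simp add: power2_eq_square algebra_simps)
    moreover have "p x * X = p x * A - 2 * t * (p x * R) + t\<^sup>2 * (p x * B)" if "X = A - 2 * t * R + t\<^sup>2 * B" for X A R B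
      unfolding that by (simp add: algebra_simps)
    ultimately have "p x * (norm (v x - of_real t * velocity h x))\<^sup>2 = p x * (norm (v x))\<^sup>2 - 2 * t * (p x * Re (velocity h x * cnj (v x))) + t\<^sup>2 * (p x * (norm (velocity h x))\<^sup>2)"
      by blast
    moreover have "Re (h x * cnj (v x)) = p x * Re (velocity h x * cnj (v x))"
      unfolding hx mult.assoc by (simp only: Re_complex_of_real Im_complex_of_real times_complex.simps)
    ultimately show ?case by (simp only: e_def)
  qed
  then obtain Z where Z: "Z \<in> null_sets lebesgue" "\<And>x. x \<notin> Z \<Longrightarrow> p x * (norm (v x - of_real t * velocity h x))\<^sup>2 = e x"
    unfolding completion.AE_iff_null_sets by auto
  have neg: "negligible Z" using Z(1) by (simp add: negligible_iff_null_sets)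
  have Ew: "(\<lambda>x. p x * (norm (v x - of_real t * velocity h x))\<^sup>2) absolutely_integrable_on {a..b}"
    by (rule absolutely_integrable_spike[OF ea neg]) (use Z(2) in auto)
  have "antideriv_on a b (\<lambda>x. f x + of_real (- t) * u x) (\<lambda>x. v x + of_real (- t) * velocity h x)"
    by (intro antideriv_on_add fv antideriv_on_linear[OF uv bounded_linear_mult_right])
  then have "antideriv_on a b (\<lambda>x. f x - of_real t * u x) (\<lambda>x. v x - of_real t * velocity h x)" by simp
  then show "finite_energy a b (\<lambda>x. f x - of_real t * u x) (\<lambda>x. v x - of_real t * velocity h x)"
    using ab Ew by (simp add: finite_energy_def)
  define F where "F x = h x * cnj (v x) + complex_of_real (q x) * u x * cnj (f x)" for x
  have qc: "(\<lambda>x. q x * (norm (g x))\<^sup>2) integrable_on {a..b}" if "continuous_on {a..b} g" for g :: "real \<Rightarrow> complex"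
    by (rule set_lebesgue_integral_eq_integral(1)[OF weight_norm_square_integrable[OF that q_loc]])
  have If: "((\<lambda>x. p x * (norm (v x))\<^sup>2 + q x * (norm (f x))\<^sup>2) has_integral energy a b f v) {a..b}"
    unfolding energy_def by (intro integrable_integral integrable_add qc cf set_lebesgue_integral_eq_integral(1)[OF Ef])
  have Iu: "((\<lambda>x. p x * (norm (velocity h x))\<^sup>2 + q x * (norm (u x))\<^sup>2) has_integral energy a b u (velocity h)) {a..b}"
    unfolding energy_def by (intro integrable_integral integrable_add qc cu set_lebesgue_integral_eq_integral(1)[OF Eu])
  have "F absolutely_integrable_on {a..b}"
    unfolding F_def[abs_def] using set_integral_add(1)[OF hv quf] by (simp add: mult.assoc)
  then have "(F has_integral form a b u h f v) {a..b}"
    unfolding form_def F_def[abs_def] by (intro integrable_integral set_lebesgue_integral_eq_integral(1))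
  from has_integral_linear[OF this bounded_linear_Re]
  have IF: "((\<lambda>x. Re (F x)) has_integral Re (form a b u h f v)) {a..b}" by (simp add: o_def)
  have I0: "((\<lambda>x. (p x * (norm (v x))\<^sup>2 + q x * (norm (f x))\<^sup>2) - 2 * t * Re (F x) + t\<^sup>2 * (p x * (norm (velocity h x))\<^sup>2 + q x * (norm (u x))\<^sup>2))
     has_integral energy a b f v - 2 * t * Re (form a b u h f v) + t\<^sup>2 * energy a b u (velocity h)) {a..b}"
    by (intro has_integral_add has_integral_diff has_integral_mult_right If Iu IF)
  have pt: "p x * (norm (v x - of_real t * velocity h x))\<^sup>2 + q x * (norm (f x - of_real t * u x))\<^sup>2
      = (p x * (norm (v x))\<^sup>2 + q x * (norm (f x))\<^sup>2) - 2 * t * Re (F x) + t\<^sup>2 * (p x * (norm (velocity h x))\<^sup>2 + q x * (norm (u x))\<^sup>2)"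
    if "x \<notin> Z" for x
  proof -
    have "q x * (norm (f x - of_real t * u x))\<^sup>2 = q x * (norm (f x))\<^sup>2 - 2 * t * Re (complex_of_real (q x) * u x * cnj (f x)) + t\<^sup>2 * (q x * (norm (u x))\<^sup>2)"
      unfolding cmod_power2 by (simp add: power2_eq_square algebra_simps)
    then show ?thesis unfolding Z(2)[OF that] e_def F_def by (simp add: algebra_simps)
  qed
  have "((\<lambda>x. p x * (norm (v x - of_real t * velocity h x))\<^sup>2 + q x * (norm (f x - of_real t * u x))\<^sup>2)
     has_integral energy a b f v - 2 * t * Re (form a b u h f v) + t\<^sup>2 * energy a b u (velocity h)) {a..b}"
    by (rule has_integral_spike[OF neg _ I0]) (rule pt, simp)
  then show "energy a b (\<lambda>x. f x - of_real t * u x) (\<lambda>x. v x - of_real t * velocity h x) =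
       energy a b f v - 2 * t * Re (form a b u h f v) + t\<^sup>2 * energy a b u (velocity h)"
    unfolding energy_def by (rule integral_unique)
qed

lemma inner_r_commute: "inner_r f g = cnj (inner_r g f)"
proof -
  have "cnj (inner_r g f) = (LINT x|M. cnj (g x * cnj (f x)))" unfolding inner_r_def by (rule Bochner_Integration.integral_cnj[symmetric])
  then show ?thesis unfolding inner_r_def by (simp add: mult.commute)
qed

lemma source_commute: "source a b f g = cnj (source a b g f)"
  unfolding source_def Henstock_Kurzweil_Integration.integral_cnj by (simp add: mult_ac)

text \<open>Nonnegativity of the form of \<open>T - bottom\<close> at \<open>f - tu\<close>, where the mixed term and the quadratic term in \<open>u\<close> are
rewritten by the equation that \<open>u\<close> solves. In this shape all terms containing \<open>u\<close> behave well under weak limits.\<close>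

lemma quadratic_form_inequality:
  assumes f: "dirichlet a f v" and ab: "1 \<le> b" "a \<le> b"
    and u: "solves u h (\<lambda>x. complex_of_real l * u x + g x)" and z: "u (-b) = 0" "u b = 0" and g: "g \<in> L2"
  defines "fe \<equiv> cut (-a) a f" and "ue \<equiv> cut (-b) b u"
  shows "0 \<le> (energy (-a) a f v - bottom * mass (-a) a f)
     - 2 * t * ((l - bottom) * Re (inner_r fe ue) + Re (inner_r g fe))
     + t\<^sup>2 * (Re (inner_r g ue) + (l - bottom) * norm_sq ue)"
proof -
  let ?ve = "cut (-a) a v"
  note ext = finite_energy_extension[OF f ab(2), folded fe_def]
  have b0: "0 < b" using ab by simp
  have cu: "continuous_on {-b..b} u" by (rule solves_continuous(1)[OF u])
  have cf: "continuous_on {-b..b} fe" using ext(1) by (auto simp: finite_energy_def intro: antideriv_on_continuous)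
  have feL: "fe \<in> L2" unfolding fe_def by (rule cut_L2(1)[OF dirichlet_continuous[OF f]])
  have fa: "-a < a" using f by (simp add: dirichlet_def finite_energy_def)
  have fz: "fe (-b) = 0" "fe b = 0"
    using f ab(2) fa unfolding fe_def cut_def dirichlet_def by (auto simp: indicator_def order_antisym_conv)
  note comb = energy_combination[OF ext(1) u, of t]
  have anti: "antideriv_on (-b) b fe ?ve" using ext(1) by (simp add: finite_energy_def)
  let ?w = "\<lambda>x. fe x - of_real t * u x"
  have dir: "dirichlet b ?w (\<lambda>x. ?ve x - of_real t * velocity h x)"
    using comb(1) z fz by (simp add: dirichlet_def)
  have src: "source (-b) b u fe = cnj (inner_r fe ue)"
    unfolding source_commute[of _ _ u] source_eq_inner(1)[OF feL cu] ue_def ..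
  have "form (-b) b u h fe ?ve = source (-b) b (\<lambda>x. complex_of_real l * u x + g x) fe"
    using Green_formula[OF u anti] b0 fz by simp
  also have "\<dots> = complex_of_real l * cnj (inner_r fe ue) + inner_r g fe"
    unfolding source_add[OF cu cf g] src source_eq_inner(1)[OF g cf] ext(4) ..
  finally have form_eq: "Re (form (-b) b u h fe ?ve) = l * Re (inner_r fe ue) + Re (inner_r g fe)" by simp
  have "complex_of_real (energy (-b) b u (velocity h)) = complex_of_real (l * mass (-b) b u) + inner_r g ue"
    using dirichlet_energy_identity[OF u g b0 z] unfolding ue_def by (simp add: algebra_simps)
  from arg_cong[OF this, of Re]
  have en: "energy (-b) b u (velocity h) = l * norm_sq ue + Re (inner_r g ue)"
    using cut_L2(2)[OF cu] by (simp add: ue_def)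
  have "mass (-b) b (\<lambda>x. 1 * fe x + of_real (- t) * u x) = mass (-b) b fe + t\<^sup>2 * mass (-b) b u - 2 * t * Re (inner_r fe ue)"
    unfolding mass_combination[OF cf cu] source_eq_inner(1)[OF feL cu] by (simp add: ue_def)
  then have mw: "mass (-b) b ?w = mass (-a) a f + t\<^sup>2 * norm_sq ue - 2 * t * Re (inner_r fe ue)"
    using ext(3) cut_L2(2)[OF cu] by (simp add: ue_def)
  have "bottom * mass (-b) b ?w \<le> energy (-b) b ?w (\<lambda>x. ?ve x - of_real t * velocity h x)"
    by (rule bottom_le[OF ab(1) dir])
  then show ?thesis
    unfolding comb(2) mw ext(2) form_eq en by (simp add: algebra_simps)
qed

text \<open>Suppose that \<open>T - bottom\<close> has an inverse bounded by \<open>C\<close>, and let \<open>u\<close> be the image of \<open>f\<close> under it. The preceding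
inequality for the Dirichlet approximants of \<open>u\<close> passes to the limit
\<open>0 \<le> (energy - bottom m) - 2tm + t\<^sup>2 \<langle>f,u\<rangle>\<close> with \<open>m = \<parallel>f\<parallel>\<^sup>2\<close> and \<open>\<langle>f,u\<rangle> \<le> Cm\<close>. The choice \<open>t = 1/C\<close>
gives \<open>energy \<ge> (bottom + 1/C) m\<close> for every admissible \<open>f\<close>, a contradiction.\<close>

theorem bottom_in_spectrum:
  "complex_of_real bottom \<in> spectrum M (SL_domain p q r) (SL_expr p q r)"
proof (rule ccontr)
  let ?A = "SL_expr p q r" and ?D = "SL_domain p q r" and ?b = "complex_of_real bottom"
  assume "?b \<notin> spectrum M ?D ?A"
  then have res: "?b \<in> resolvent_set M ?D ?A" by (simp add: spectrum_def)
  then obtain C0 where C0: "\<forall>f\<in>?D. L2_norm M f \<le> C0 * L2_norm M (\<lambda>x. ?A f x - ?b * f x)"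
    unfolding resolvent_set_def by blast
  define C where "C = max C0 1"
  have C1: "1 \<le> C" by (simp add: C_def)
  have C: "L2_norm M f \<le> C * L2_norm M (\<lambda>x. ?A f x - ?b * f x)" if "f \<in> ?D" for f
  proof -
    have "C0 * L2_norm M (\<lambda>x. ?A f x - ?b * f x) \<le> C * L2_norm M (\<lambda>x. ?A f x - ?b * f x)"
      by (intro mult_right_mono) (auto simp: C_def L2_norm_eq norm_sq_nonneg)
    then show ?thesis using C0 that by force
  qed
  obtain l0 d where l0: "l0 < bottom" and approx: "\<And>f h k. solves f h k \<Longrightarrow> f \<in> L2 \<Longrightarrow> k \<in> L2 \<Longrightarrow>
        (\<exists>N F H. dirichlet_approximation (complex_of_real l0) (\<lambda>x. k x + (- complex_of_real l0) * f x) f N F H)"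
    using solves_L2_approximation by blast
  have "(bottom + 1 / C) * mass (-a) a f \<le> energy (-a) a f v" if a: "1 \<le> a" and f: "dirichlet a f v" for a f v
  proof -
    define fe where "fe = cut (-a) a f"
    let ?m = "mass (-a) a f"
    have feL: "fe \<in> L2" and fem: "norm_sq fe = ?m"
      unfolding fe_def by (intro cut_L2 dirichlet_continuous[OF f])+
    obtain u where u: "u \<in> ?D" "AE x in M. ?A u x - ?b * u x = fe x"
      using res feL unfolding resolvent_set_def by blast
    let ?k = "?A u"
    have uL: "u \<in> L2" and kL: "?k \<in> L2" using SL_domain_solves[OF u(1)] by auto
    obtain h where s: "solves u h ?k" using SL_domain_solves(3)[OF u(1)] by blast
    have resL: "(\<lambda>x. ?A u x - ?b * u x) \<in> L2" using L2_add_scaled[OF kL uL, of "- ?b"] by simp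
    have "norm_sq (\<lambda>x. ?A u x - ?b * u x) = norm_sq fe"
      unfolding norm_sq_def
      using L2D(2)[OF resL] L2D(2)[OF feL] u(2) by (intro integral_cong_AE) (auto elim: eventually_mono)
    then have un: "sqrt (norm_sq u) \<le> C * sqrt ?m" using C[OF u(1)] fem by (simp add: L2_norm_eq)
    have kinner: "inner_r ?k w = ?b * inner_r u w + inner_r fe w" if w: "w \<in> L2" for w
    proof -
      have "inner_r ?k w = inner_r (\<lambda>x. fe x + ?b * u x) w"
      proof (rule inner_r_cong_AE[OF _ kL L2_add_scaled[OF feL uL] w])
        show "AE x in M. ?k x = fe x + ?b * u x" using u(2) by eventually_elim (simp add: algebra_simps)
      qed
      then show ?thesis unfolding inner_r_add_scaled[OF feL uL w] by simp
    qed
    let ?g = "\<lambda>x. ?k x + (- complex_of_real l0) * u x"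
    have g: "?g \<in> L2" by (rule L2_add_scaled[OF kL uL])
    have ginner: "inner_r ?g w = complex_of_real (bottom - l0) * inner_r u w + inner_r fe w" if w: "w \<in> L2" for w
      unfolding inner_r_add_scaled[OF kL uL w] kinner[OF w] by (simp add: algebra_simps)
    obtain N F H where A: "dirichlet_approximation (complex_of_real l0) ?g u N F H"
      using approx[OF s uL kL] by blast
    let ?G = "\<lambda>j. cut (- N j) (N j) (F j)"
    have N: "1 \<le> N j" "real j \<le> N j" and Fs: "solves (F j) (H j) (\<lambda>x. complex_of_real l0 * F j x + ?g x)"
      and Fz: "F j (- N j) = 0" "F j (N j) = 0" for j
      using A by (auto simp: dirichlet_approximation_def)
    have lim: "(\<lambda>j. inner_r w (?G j)) \<longlonglongrightarrow> inner_r w u" if "w \<in> L2" for w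
      using A that by (auto simp: dirichlet_approximation_def)
    have GL: "?G j \<in> L2" for j by (rule cut_L2(1)[OF solves_continuous(1)[OF Fs]])
    let ?t = "1 / C"
    let ?R = "\<lambda>j. (energy (-a) a f v - bottom * ?m)
       - 2 * ?t * ((l0 - bottom) * Re (inner_r fe (?G j)) + Re (inner_r ?g fe))
       + ?t\<^sup>2 * (Re (inner_r ?g (?G j)) + (l0 - bottom) * (2 * Re (inner_r u (?G j)) - norm_sq u))"
    have Rnn: "0 \<le> ?R j" if j: "a \<le> N j" for j
    proof -
      have q: "0 \<le> (energy (-a) a f v - bottom * ?m)
       - 2 * ?t * ((l0 - bottom) * Re (inner_r fe (?G j)) + Re (inner_r ?g fe))
       + ?t\<^sup>2 * (Re (inner_r ?g (?G j)) + (l0 - bottom) * norm_sq (?G j))"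
        using quadratic_form_inequality[OF f N(1) j Fs Fz g, of ?t] by (simp add: fe_def)
      have "(l0 - bottom) * norm_sq (?G j) \<le> (l0 - bottom) * (2 * Re (inner_r u (?G j)) - norm_sq u)"
        using norm_sq_lower[OF uL GL] l0 by (intro mult_left_mono_neg) auto
      then have "?t\<^sup>2 * (Re (inner_r ?g (?G j)) + (l0 - bottom) * norm_sq (?G j)) \<le> ?t\<^sup>2 * (Re (inner_r ?g (?G j)) + (l0 - bottom) * (2 * Re (inner_r u (?G j)) - norm_sq u))"
        by (intro mult_left_mono) auto
      then show ?thesis using q by linarith
    qed
    have Rlim: "?R \<longlonglongrightarrow> (energy (-a) a f v - bottom * ?m)
       - 2 * ?t * ((l0 - bottom) * Re (inner_r fe u) + Re (inner_r ?g fe))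
       + ?t\<^sup>2 * (Re (inner_r ?g u) + (l0 - bottom) * (2 * Re (inner_r u u) - norm_sq u))"
      by (intro tendsto_intros lim feL g uL)
    obtain J :: nat where J: "a \<le> real J" using real_arch_simple by blast
    have "0 \<le> (energy (-a) a f v - bottom * ?m)
       - 2 * ?t * ((l0 - bottom) * Re (inner_r fe u) + Re (inner_r ?g fe))
       + ?t\<^sup>2 * (Re (inner_r ?g u) + (l0 - bottom) * (2 * Re (inner_r u u) - norm_sq u))"
    proof (rule LIMSEQ_le_const[OF Rlim], intro exI allI impI)
      fix j assume "J \<le> j"
      then have "a \<le> N j" using J N(2)[of j] by linarith
      then show "0 \<le> ?R j" by (rule Rnn)
    qed
    also have "(l0 - bottom) * Re (inner_r fe u) + Re (inner_r ?g fe) = ?m"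
      unfolding ginner[OF feL] inner_r_self fem using arg_cong[OF inner_r_commute[of u fe], of Re] by (simp add: algebra_simps)
    also have "Re (inner_r ?g u) + (l0 - bottom) * (2 * Re (inner_r u u) - norm_sq u) = Re (inner_r fe u)"
      unfolding ginner[OF uL] inner_r_self by (simp add: algebra_simps)
    finally have main: "0 \<le> (energy (-a) a f v - bottom * ?m) - 2 * ?t * ?m + ?t\<^sup>2 * Re (inner_r fe u)" .
    have m0: "0 \<le> ?m" using fem norm_sq_nonneg[of fe] by simp
    have "Re (inner_r fe u) \<le> sqrt ?m * sqrt (norm_sq u)"
      using L2_mult(2)[OF feL uL] complex_Re_le_cmod[of "inner_r fe u"] unfolding fem by linarith
    also have "\<dots> \<le> sqrt ?m * (C * sqrt ?m)" using un m0 by (intro mult_left_mono) auto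
    also have "\<dots> = C * ?m" using m0 by (simp add: mult.left_commute)
    finally have "?t\<^sup>2 * Re (inner_r fe u) \<le> ?t\<^sup>2 * (C * ?m)" by (intro mult_left_mono) auto
    also have "\<dots> = ?t * ?m" using C1 by (simp add: power2_eq_square)
    finally have "0 \<le> (energy (-a) a f v - bottom * ?m) - 2 * ?t * ?m + ?t * ?m" using main by linarith
    then show ?thesis by (simp add: algebra_simps)
  qed
  then have "bottom + 1 / C \<le> bottom" by (rule bottom_ge)
  then show False using C1 by simp
qed

theorem spectrum_minimum: "is_real_min (SL_spectrum p q r) bottom"
proof -
  have "Im z = 0 \<and> bottom \<le> Re z" if z: "z \<in> SL_spectrum p q r" for z
  proof (rule ccontr)
    assume "\<not> (Im z = 0 \<and> bottom \<le> Re z)"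
    then have "Im z \<noteq> 0 \<or> Re z < bottom" by auto
    then have "z \<in> resolvent_set M (SL_domain p q r) (SL_expr p q r)" by (rule resolvent_if)
    then show False using z by (simp add: SL_spectrum_def spectrum_def)
  qed
  then show ?thesis
    unfolding is_real_min_def using bottom_in_spectrum by (auto simp: SL_spectrum_def complex_is_Real_iff)
qed

lemma energy_nonneg_if_Q_zero:
  assumes "finite_energy a b f v" "Q = 0"
  shows "0 \<le> energy a b f v"
proof -
  obtain N E X x y where "0 \<le> E" "E - Q * X powr \<sigma> * N powr (1 - \<sigma>) \<le> energy a b f v"
    using finite_energy_estimates[OF assms(1)] by (elim exE conjE)
  then show ?thesis using assms(2) by simp
qed

text \<open>If \<open>Q = 0\<close>, the set \<open>\<Omega>\<^sub>g\<close> may have infinite measure, since \<open>\<infinity> * 0 = 0\<close>; but then the energy is nonnegative.\<close>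

theorem bottom_lower_bound:
  fixes g :: "real \<Rightarrow> real" and \<beta> \<alpha> G :: real
  defines "\<beta> \<equiv> (4 * P * Q) powr (1 / (2 - \<sigma>))"
  defines "\<alpha> \<equiv> Q * (if \<sigma> = 0 then 1 else \<beta> powr \<sigma>)"
  assumes g: "g \<in> borel_measurable lebesgue" "AE x in lebesgue. 0 \<le> g x" "AE x in lebesgue. g x \<le> G" "0 \<le> G"
    and small: "emeasure lebesgue (Omega_set r g) * ennreal \<beta> < 1"
  shows "- \<alpha> * G / (1 - measure lebesgue (Omega_set r g) * \<beta>) \<le> bottom"
proof (cases "Q = 0")
  case True
  have "0 \<le> bottom"
    by (rule bottom_ge) (use energy_nonneg_if_Q_zero True in \<open>auto simp: dirichlet_def\<close>)
  then show ?thesis using True by (simp add: \<alpha>_def)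
next
  case False
  then have "0 < \<beta>" using P_pos Q_nonneg by (simp add: \<beta>_def)
  have fin: "emeasure lebesgue (Omega_set r g) < \<infinity>"
  proof (rule ccontr)
    assume "\<not> emeasure lebesgue (Omega_set r g) < \<infinity>"
    then have "emeasure lebesgue (Omega_set r g) = \<infinity>" by (simp add: less_top[symmetric])
    then show False using small \<open>0 < \<beta>\<close> by (simp add: ennreal_top_mult)
  qed
  let ?\<mu> = "measure lebesgue (Omega_set r g)"
  have "ennreal (?\<mu> * \<beta>) < 1"
    using small fin \<open>0 < \<beta>\<close> by (simp add: emeasure_eq_ennreal_measure ennreal_mult less_imp_le)
  then have mb: "?\<mu> * \<beta> < 1" by (simp add: ennreal_less_one_iff)
  have wb: "weight_bound G ?\<mu>" by (rule weight_bound_Omega_set[OF g fin])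
  show ?thesis
  proof (rule bottom_ge)
    fix a f v assume "1 \<le> a" and f: "dirichlet a f v"
    have "- (Q * (if \<sigma> = 0 then 1 else \<beta> powr \<sigma>) * G / (1 - ?\<mu> * \<beta>)) * mass (-a) a f \<le> energy (-a) a f v"
      unfolding \<beta>_def by (rule energy_lower_bound_vanishing[OF _ _ wb]) (use f mb in \<open>auto simp: dirichlet_def \<beta>_def\<close>)
    then show "- \<alpha> * G / (1 - ?\<mu> * \<beta>) * mass (-a) a f \<le> energy (-a) a f v" by (simp add: \<alpha>_def)
  qed
qed

end

lemma Lp_space_infinity:
  assumes "h \<in> Lp_space \<infinity>"
  shows "h \<in> borel_measurable lebesgue" "AE x in lebesgue. \<bar>h x\<bar> \<le> Lp_norm \<infinity> h" "0 \<le> Lp_norm \<infinity> h"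
proof -
  let ?e = "esssup lebesgue (\<lambda>x. ereal \<bar>h x\<bar>)"
  show "h \<in> borel_measurable lebesgue" using assms by (simp add: Lp_space_def)
  have fin: "?e < \<infinity>" using assms by (simp add: Lp_space_def)
  have ae: "AE x in lebesgue. ereal \<bar>h x\<bar> \<le> ?e" by (rule esssup_AE)
  have ex: "\<exists>x. R x" if "AE x in lebesgue. R x" for R :: "real \<Rightarrow> bool"
  proof -
    have "ae_filter (lebesgue :: real measure) \<noteq> bot" by (simp add: ae_filter_eq_bot_iff)
    then show ?thesis using that by (rule eventually_happens')
  qed
  obtain x where x: "ereal \<bar>h x\<bar> \<le> ?e" using ex[OF ae] by blast
  have "0 \<le> ?e" by (rule order_trans[OF _ x]) simp
  then obtain c where c: "?e = ereal c" "0 \<le> c" using fin by (cases ?e) auto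
  have n: "Lp_norm \<infinity> h = c" by (simp add: Lp_norm_def c)
  show "0 \<le> Lp_norm \<infinity> h" using n c by simp
  show "AE x in lebesgue. \<bar>h x\<bar> \<le> Lp_norm \<infinity> h" using ae unfolding n c by simp
qed

lemma essinf_pos_tail:
  fixes r :: "real \<Rightarrow> real"
  assumes r: "r \<in> borel_measurable lebesgue" and pos: "0 < essinf (lebesgue_on (- {a..b})) (\<lambda>t. ereal (r t))"
  shows "\<exists>c0 x0. 0 < c0 \<and> (AE x in lebesgue. x0 \<le> \<bar>x\<bar> \<longrightarrow> c0 \<le> r x)"
proof -
  let ?R = "lebesgue_on (- {a..b})"
  have "(\<lambda>t. ereal (r t)) \<in> borel_measurable ?R"
    using measurable_restrict_space1[OF r] by simp
  then have L: "0 < Liminf (ae_filter ?R) (\<lambda>t. ereal (r t))" using pos by (simp add: essinf_def)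
  obtain c where c: "0 < ereal c" "ereal c < Liminf (ae_filter ?R) (\<lambda>t. ereal (r t))"
    using ereal_dense2[OF L] by blast
  have "AE t in ?R. ereal c < ereal (r t)" using less_LiminfD[OF c(2)] .
  then have "AE t in lebesgue. t \<in> - {a..b} \<longrightarrow> c < r t"
    using Compl_in_sets_lebesgue[of "{a..b}"] by (subst (asm) AE_restrict_space_iff) auto
  then have "AE x in lebesgue. \<bar>a\<bar> + \<bar>b\<bar> + 1 \<le> \<bar>x\<bar> \<longrightarrow> c \<le> r x"
    by eventually_elim auto
  then show ?thesis using c(1) by (intro exI[of _ c] exI[of _ "\<bar>a\<bar> + \<bar>b\<bar> + 1"]) simp
qed

lemma Hoelder_Lp_interval:
  assumes s: "1 \<le> s" and n: "n \<in> Lp_space s" "\<And>x. 0 \<le> n x" and loc: "n absolutely_integrable_on {a..b}" and ab: "a < b"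
    and w: "continuous_on {a..b} w" "\<And>x. x \<in> {a..b} \<Longrightarrow> 0 \<le> w x" "\<And>x. x \<in> {a..b} \<Longrightarrow> w x \<le> X"
  defines "\<sigma> \<equiv> (if s = \<infinity> then 0 else 1 / enn2real s)"
  shows "integral {a..b} (\<lambda>x. n x * w x) \<le> Lp_norm s n * X powr \<sigma> * integral {a..b} w powr (1 - \<sigma>)"
proof (cases "s = \<infinity>")
  case True
  have ae: "AE x in lebesgue. \<bar>n x\<bar> \<le> Lp_norm \<infinity> n" and Q0: "0 \<le> Lp_norm \<infinity> n" using Lp_space_infinity[of n] n True by auto
  have wi: "w integrable_on {a..b}" by (rule integrable_continuous_interval[OF w(1)])
  have W0: "0 \<le> integral {a..b} w" using wi w(2) by (rule Henstock_Kurzweil_Integration.integral_nonneg)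
  have "integral {a..b} (\<lambda>x. n x * w x) \<le> integral {a..b} (\<lambda>x. Lp_norm \<infinity> n * w x)"
  proof (rule integral_mono_AE_interval)
    show "(\<lambda>x. n x * w x) absolutely_integrable_on {a..b}" by (rule continuous_times_absolutely_integrable(2)[OF w(1) loc])
    show "(\<lambda>x. Lp_norm \<infinity> n * w x) absolutely_integrable_on {a..b}"
      by (intro absolutely_integrable_continuous_real continuous_intros w(1))
    show "AE x in lebesgue. x \<in> {a..b} \<longrightarrow> n x * w x \<le> Lp_norm \<infinity> n * w x"
      using ae by eventually_elim (use w(2) in \<open>auto intro!: mult_right_mono\<close>)
  qed
  then have le: "integral {a..b} (\<lambda>x. n x * w x) \<le> Lp_norm \<infinity> n * integral {a..b} w" by simp
  show ?thesis
  proof (cases "X = 0")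
    case True
    then have "w x = 0" if "x \<in> {a..b}" for x using w(2,3)[OF that] by simp
    then have "integral {a..b} (\<lambda>x. n x * w x) = integral {a..b} (\<lambda>x. 0)" by (intro integral_cong) auto
    then show ?thesis using True \<open>s = \<infinity>\<close> by (simp add: \<sigma>_def)
  next
    case False
    then show ?thesis using le True W0 by (simp add: \<sigma>_def)
  qed
next
  case False
  let ?s = "enn2real s"
  have s1: "1 \<le> ?s" using s False enn2real_mono[of 1 s] by (simp add: top.not_eq_extremum)
  have int: "integrable lebesgue (\<lambda>x. n x powr ?s)" using n False by (simp add: Lp_space_def)
  from Hoelder_interval[OF ab n(2) loc int s1 w]
  show ?thesis using False n(2) by (simp add: \<sigma>_def Lp_norm_def)
qed

theorem theorem3p3:
  fixes p q r :: "real \<Rightarrow> real" and s :: ennreal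
  assumes meas: "p \<in> borel_measurable lebesgue" "q \<in> borel_measurable lebesgue"
      "r \<in> borel_measurable lebesgue"
    and loc: "r \<in> L1_loc" "(\<lambda>x. 1 / p x) \<in> L1_loc" "q \<in> L1_loc"
    and hyp_a: "AE x in lebesgue. 0 < p x" "\<exists>\<eta>\<ge>1. (\<lambda>x. 1 / p x) \<in> Lp_space \<eta>"
    and hyp_b: "q \<in> L1_u"
    and hyp_c: "AE x in lebesgue. 0 < r x"
      "\<exists>a b. a < b \<and> 0 < essinf (lebesgue_on (- {a..b})) (\<lambda>t. ereal (r t))"
    and p_inf: "(\<lambda>x. 1 / p x) \<in> Lp_space \<infinity>"
    and s: "1 \<le> s" "neg_part q \<in> Lp_space s"
  shows "\<exists>m. is_real_min (SL_spectrum p q r) m \<and>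
    (\<forall>g. g \<in> Lp_space \<infinity> \<longrightarrow> (AE x in lebesgue. 0 \<le> g x) \<longrightarrow>
       emeasure lebesgue (Omega_set r g) * ennreal (SL_beta p q s) < 1 \<longrightarrow>
       m \<ge> - SL_alpha p q s * Lp_norm \<infinity> g
             / (1 - measure lebesgue (Omega_set r g) * SL_beta p q s)) \<and>
    ((\<lambda>x. 1 / r x) \<in> Lp_space \<infinity> \<longrightarrow>
       emeasure lebesgue (Omega_set r (\<lambda>x. 1 / r x)) = 0 \<and>
       (s < \<infinity> \<longrightarrow>
          m \<ge> - ((4 * Lp_norm \<infinity> (\<lambda>x. 1 / p x)) powr (1 / (2 * enn2real s - 1))
                * Lp_norm s (neg_part q) powr (2 * enn2real s / (2 * enn2real s - 1))
                * Lp_norm \<infinity> (\<lambda>x. 1 / r x))) \<and>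
       (s = \<infinity> \<longrightarrow>
          m \<ge> - (Lp_norm \<infinity> (neg_part q) * Lp_norm \<infinity> (\<lambda>x. 1 / r x))))"
proof -
  define P where "P = Lp_norm \<infinity> (\<lambda>x. 1 / p x)"
  define Q where "Q = Lp_norm s (neg_part q)"
  define \<sigma> where "\<sigma> = (if s = \<infinity> then 0 else 1 / enn2real s)"
  have s1: "1 \<le> enn2real s" if "s \<noteq> \<infinity>"
    using s(1) that enn2real_mono[of 1 s] by (simp add: top.not_eq_extremum)
  have \<sigma>: "0 \<le> \<sigma>" "\<sigma> \<le> 1" using s1 by (auto simp: \<sigma>_def)
  have \<sigma>0: "\<sigma> = 0 \<longleftrightarrow> s = \<infinity>" using s1 by (auto simp: \<sigma>_def)
  have Q0: "0 \<le> Q" using Lp_space_infinity(3)[of "neg_part q"] s(2) by (auto simp: Q_def Lp_norm_def split: if_splits)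
  have pinv_le: "AE x in lebesgue. 1 / p x \<le> P"
    using Lp_space_infinity(2)[OF p_inf] unfolding P_def by eventually_elim linarith
  have P_pos: "0 < P"
  proof -
    have ne: "ae_filter (lebesgue :: real measure) \<noteq> bot" by (simp add: ae_filter_eq_bot_iff)
    obtain x where "0 < p x \<and> 1 / p x \<le> P"
      using eventually_happens'[OF ne eventually_conj[OF hyp_a(1) pinv_le]] by blast
    then show ?thesis by (meson less_le_trans zero_less_divide_1_iff)
  qed
  obtain a b where "0 < essinf (lebesgue_on (- {a..b})) (\<lambda>t. ereal (r t))" using hyp_c(2) by blast
  then obtain c0 x0 where tail: "0 < c0" "AE x in lebesgue. x0 \<le> \<bar>x\<bar> \<longrightarrow> c0 \<le> r x"
    using essinf_pos_tail[OF meas(3)] by blast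
  have q_loc: "q absolutely_integrable_on {a..b}" for a b using loc(3) by (simp add: L1_loc_def)
  have n0: "0 \<le> neg_part q x" for x by (simp add: neg_part_def)
  have n_loc: "neg_part q absolutely_integrable_on {a..b}" for a b
    by (rule neg_part_absolutely_integrable[OF q_loc])
  interpret sturm_liouville p q r P Q \<sigma> c0 x0
  proof
    show "(\<lambda>x. 1 / p x) absolutely_integrable_on {a..b}" "r absolutely_integrable_on {a..b}" for a b
      using loc by (auto simp: L1_loc_def)
    show "integral {a..b} (\<lambda>x. neg_part q x * w x) \<le> Q * X powr \<sigma> * integral {a..b} w powr (1 - \<sigma>)"
      if "a < b" "continuous_on {a..b} w" "\<And>x. x \<in> {a..b} \<Longrightarrow> 0 \<le> w x" "\<And>x. x \<in> {a..b} \<Longrightarrow> w x \<le> X" for a b w X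
      unfolding Q_def \<sigma>_def by (rule Hoelder_Lp_interval[OF s n0 n_loc that])
  qed (use meas hyp_a(1) hyp_c(1) pinv_le P_pos Q0 \<sigma> tail q_loc in auto)
  let ?\<beta> = "(4 * P * Q) powr (1 / (2 - \<sigma>))"
  have exponent: "(if s = \<infinity> then 1 / 2 else enn2real s / (2 * enn2real s - 1)) = 1 / (2 - \<sigma>)"
    using s1 by (auto simp: \<sigma>_def field_simps)
  have beta: "SL_beta p q s = ?\<beta>"
    unfolding SL_beta_def exponent by (simp add: P_def Q_def)
  have alpha: "SL_alpha p q s = Q * (if \<sigma> = 0 then 1 else ?\<beta> powr \<sigma>)"
    unfolding SL_alpha_def beta \<sigma>0 by (simp add: Q_def \<sigma>_def)
  have bound: "- SL_alpha p q s * Lp_norm \<infinity> g / (1 - measure lebesgue (Omega_set r g) * SL_beta p q s) \<le> bottom"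
    if g: "g \<in> Lp_space \<infinity>" "AE x in lebesgue. 0 \<le> g x"
      and small: "emeasure lebesgue (Omega_set r g) * ennreal (SL_beta p q s) < 1" for g
  proof -
    have le: "AE x in lebesgue. g x \<le> Lp_norm \<infinity> g"
      using Lp_space_infinity(2)[OF g(1)] by eventually_elim linarith
    show ?thesis
      unfolding alpha beta
      by (rule bottom_lower_bound[OF Lp_space_infinity(1)[OF g(1)] g(2) le Lp_space_infinity(3)[OF g(1)] small[unfolded beta]])
  qed
  have Omega0: "emeasure lebesgue (Omega_set r (\<lambda>x. 1 / r x)) = 0"
  proof -
    have "AE x in lebesgue. x \<notin> Omega_set r (\<lambda>x. 1 / r x)"
      using hyp_c(1) by eventually_elim (simp add: Omega_set_def)
    moreover have "Omega_set r (\<lambda>x. 1 / r x) \<in> sets lebesgue"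
      unfolding Omega_set_def
      by (intro sublevel_set_lebesgue borel_measurable_times borel_measurable_divide meas(3) borel_measurable_const)
    ultimately show ?thesis using AE_iff_null_sets by blast
  qed
  have special: "- (SL_alpha p q s * Lp_norm \<infinity> (\<lambda>x. 1 / r x)) \<le> bottom" if r: "(\<lambda>x. 1 / r x) \<in> Lp_space \<infinity>"
  proof -
    have "AE x in lebesgue. 0 \<le> 1 / r x" using hyp_c(1) by eventually_elim simp
    from bound[OF r this] Omega0 show ?thesis by (simp add: measure_def)
  qed
  have alpha_finite: "SL_alpha p q s = (4 * P) powr (1 / (2 * enn2real s - 1)) * Q powr (2 * enn2real s / (2 * enn2real s - 1))"
    if "s \<noteq> \<infinity>"
  proof -
    let ?s = "enn2real s"
    have e: "\<sigma> / (2 - \<sigma>) = 1 / (2 * ?s - 1)" using s1[OF that] that by (simp add: \<sigma>_def field_simps)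
    have e2: "2 * ?s / (2 * ?s - 1) = 1 + 1 / (2 * ?s - 1)" using s1[OF that] by (simp add: field_simps)
    have "SL_alpha p q s = Q * (4 * P * Q) powr (1 / (2 * ?s - 1))"
      unfolding alpha using \<sigma>0 that by (simp add: powr_powr e)
    also have "\<dots> = (4 * P) powr (1 / (2 * ?s - 1)) * (Q * Q powr (1 / (2 * ?s - 1)))"
      using P_pos Q0 by (simp add: powr_mult)
    also have "Q * Q powr (1 / (2 * ?s - 1)) = Q powr (2 * ?s / (2 * ?s - 1))"
      unfolding e2 using Q0 by (cases "Q = 0") (auto simp: powr_add)
    finally show ?thesis .
  qed
  have alpha_infinite: "SL_alpha p q s = Lp_norm \<infinity> (neg_part q)" if "s = \<infinity>"
    using that by (simp add: SL_alpha_def)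
  show ?thesis
  proof (intro exI[of _ bottom] conjI allI impI)
    show "is_real_min (SL_spectrum p q r) bottom" by (rule spectrum_minimum)
  next
    fix g assume "g \<in> Lp_space \<infinity>" "AE x in lebesgue. 0 \<le> g x"
      "emeasure lebesgue (Omega_set r g) * ennreal (SL_beta p q s) < 1"
    then show "- SL_alpha p q s * Lp_norm \<infinity> g / (1 - measure lebesgue (Omega_set r g) * SL_beta p q s) \<le> bottom"
      by (rule bound)
  next
    show "emeasure lebesgue (Omega_set r (\<lambda>x. 1 / r x)) = 0" by (rule Omega0)
  next
    assume "(\<lambda>x. 1 / r x) \<in> Lp_space \<infinity>" and "s < \<infinity>"
    then show "- ((4 * Lp_norm \<infinity> (\<lambda>x. 1 / p x)) powr (1 / (2 * enn2real s - 1))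
                * Lp_norm s (neg_part q) powr (2 * enn2real s / (2 * enn2real s - 1))
                * Lp_norm \<infinity> (\<lambda>x. 1 / r x)) \<le> bottom"
      using special alpha_finite by (simp add: P_def Q_def)
  next
    assume "(\<lambda>x. 1 / r x) \<in> Lp_space \<infinity>" and "s = \<infinity>"
    then show "- (Lp_norm \<infinity> (neg_part q) * Lp_norm \<infinity> (\<lambda>x. 1 / r x)) \<le> bottom"
      using special alpha_infinite by simp
  qed
qed

end
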